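(* Let $T$ be a complex torus of positive dimension. Suppose that the endomorphism algebra $\mathrm{End}^0(T)$ is a purely imaginary number field of degree $2s$ over $\mathbb{Q}$ that does not contain roots of unity except $\{1,-1\}$. Let $\mathrm{Aut}(T)$ be the automorphism group of the complex Lie group $T$. Then $\mathrm{Aut}(T)$ is isomorphic to $\{\pm 1\}\times\mathbb{Z}^{s-1}$. In particular, $\mathrm{Aut}(T)$ is commutative and its torsion subgroup is a cyclic group of order $2$.
   Context: For a complex torus $T$, $\mathrm{End}(T)$ is the ring of endomorphisms of the complex Lie group $T$ and $\mathrm{End}^0(T)=\mathrm{End}(T)\otimes\mathbb{Q}$. A number field is purely imaginary if it has no field embedding into $\mathbb{R}$. *)

theory Defs
  imports
    "HOL-Analysis.Analysis"
    "HOL-Algebra.Algebra"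
    "HOL-Algebra.Algebraic_Closure_Type"
begin

text \<open>
  A complex torus of dimension \<open>CARD('n)\<close> (automatically positive) is \<open>\<complex>\<^sup>n / L\<close> for a lattice
  \<open>L\<close>, that is, the set of integer combinations of a basis of \<open>\<complex>\<^sup>n\<close> as a real vector space.
\<close>

definition is_lattice :: "'a::euclidean_space set \<Rightarrow> bool" where
  "is_lattice L \<longleftrightarrow>
     (\<exists>B. independent B \<and> span B = UNIV \<and>
          L = {\<Sum>b\<in>B. of_int (c b) *\<^sub>R b | c :: 'a \<Rightarrow> int. True})"

definition additive_group :: "'a::ab_group_add monoid" where
  "additive_group = \<lparr>carrier = UNIV, monoid.mult = (+), one = 0\<rparr>"

definition complex_torus :: "(complex^'n) set \<Rightarrow> (complex^'n) set monoid" where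
  "complex_torus L = additive_group Mod L"

definition torus_proj :: "(complex^'n) set \<Rightarrow> complex^'n \<Rightarrow> (complex^'n) set" where
  "torus_proj L z = L #>\<^bsub>additive_group\<^esub> z"

text \<open>
  Holomorphic maps of several variables: complex differentiable at each point of an open set.
\<close>

definition holomorphic_on_vec :: "(complex^'n \<Rightarrow> complex^'n) \<Rightarrow> (complex^'n) set \<Rightarrow> bool" where
  "holomorphic_on_vec g U \<longleftrightarrow> open U \<and>
     (\<forall>z\<in>U. \<exists>g'. Vector_Spaces.linear (*s) (*s) g' \<and> (g has_derivative g') (at z))"

text \<open>
  The charts of the torus are the local inverses of the projection, so a self-map \<open>f\<close> is
  holomorphic iff, locally on \<open>\<complex>\<^sup>n\<close>, it is induced by a holomorphic map \<open>g\<close>. Continuity of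
  \<open>f\<close> is a consequence.
\<close>

definition torus_holomorphic ::
  "(complex^'n) set \<Rightarrow> ((complex^'n) set \<Rightarrow> (complex^'n) set) \<Rightarrow> bool" where
  "torus_holomorphic L f \<longleftrightarrow>
     (\<forall>x. \<exists>U g. x \<in> U \<and> holomorphic_on_vec g U \<and>
        (\<forall>z\<in>U. f (torus_proj L z) = torus_proj L (g z)))"

text \<open>
  Endomorphisms and automorphisms of the complex Lie group. As in \<^const>\<open>auto\<close>, maps are
  extensional, so that equality of elements is equality of maps on the torus.
\<close>

definition torus_End :: "(complex^'n) set \<Rightarrow> ((complex^'n) set \<Rightarrow> (complex^'n) set) ring" where
  "torus_End L = (let T = complex_torus L in
     \<lparr>carrier = {f \<in> hom T T \<inter> extensional (carrier T). torus_holomorphic L f},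
      monoid.mult = compose (carrier T),
      one = (\<lambda>x\<in>carrier T. x),
      ring.zero = (\<lambda>x\<in>carrier T. \<one>\<^bsub>T\<^esub>),
      add = (\<lambda>f g. \<lambda>x\<in>carrier T. f x \<otimes>\<^bsub>T\<^esub> g x)\<rparr>)"

definition torus_Aut :: "(complex^'n) set \<Rightarrow> ((complex^'n) set \<Rightarrow> (complex^'n) set) monoid" where
  "torus_Aut L = (let T = complex_torus L in
     AutoGroup T \<lparr>carrier := {f \<in> auto T. torus_holomorphic L f \<and>
                                  torus_holomorphic L (inv_into (carrier T) f)}\<rparr>)"

text \<open>
  The tensor product over \<open>\<int>\<close> of two rings. The free abelian group on the set \<open>R \<times> S\<close> is given
  the multiplication \<open>(a, b) (a', b') = (a a', b b')\<close>, extended biadditively, and is divided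
  by the biadditivity relations. The additive span of these relations is already an ideal, so
  it makes no difference whether one takes the subgroup or the ideal they generate.
\<close>

definition int_monoid_ring :: "('a, 'b) monoid_scheme \<Rightarrow> ('a \<Rightarrow>\<^sub>0 int) ring" where
  "int_monoid_ring M =
     \<lparr>carrier = {c. Poly_Mapping.keys c \<subseteq> carrier M},
      monoid.mult = (\<lambda>x y. frag_extend (\<lambda>a. frag_extend (\<lambda>b. frag_of (a \<otimes>\<^bsub>M\<^esub> b)) y) x),
      one = frag_of \<one>\<^bsub>M\<^esub>,
      ring.zero = 0,
      add = (+)\<rparr>"

definition tensor_relations ::
  "('a, 'm) ring_scheme \<Rightarrow> ('b, 'n) ring_scheme \<Rightarrow> ('a \<times> 'b \<Rightarrow>\<^sub>0 int) set" where
  "tensor_relations R S =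
     {frag_of (a \<oplus>\<^bsub>R\<^esub> a', b) - frag_of (a, b) - frag_of (a', b) | a a' b.
        a \<in> carrier R \<and> a' \<in> carrier R \<and> b \<in> carrier S} \<union>
     {frag_of (a, b \<oplus>\<^bsub>S\<^esub> b') - frag_of (a, b) - frag_of (a, b') | a b b'.
        a \<in> carrier R \<and> b \<in> carrier S \<and> b' \<in> carrier S}"

definition ring_tensor ::
  "('a, 'm) ring_scheme \<Rightarrow> ('b, 'n) ring_scheme \<Rightarrow> ('a \<times> 'b \<Rightarrow>\<^sub>0 int) set ring" where
  "ring_tensor R S =
     (let F = int_monoid_ring (R \<times>\<times> S) in F Quot (Idl\<^bsub>F\<^esub> (tensor_relations R S)))"

definition torus_End0 ::
  "(complex^'n) set \<Rightarrow> (((complex^'n) set \<Rightarrow> (complex^'n) set) \<times> rat \<Rightarrow>\<^sub>0 int) set ring" where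
  "torus_End0 L = ring_tensor (torus_End L) (ring_of_type_algebra :: rat ring)"

text \<open>\<open>generate_field K {}\<close> is the prime field, a copy of \<open>\<rat>\<close> in characteristic zero.\<close>

definition number_field :: "('a, 'b) ring_scheme \<Rightarrow> nat \<Rightarrow> bool" where
  "number_field K d \<longleftrightarrow>
     field K \<and> (\<forall>n::nat. n > 0 \<longrightarrow> [n] \<cdot>\<^bsub>K\<^esub> \<one>\<^bsub>K\<^esub> \<noteq> \<zero>\<^bsub>K\<^esub>) \<and>
     ring.dimension K d (generate_field K {}) (carrier K)"

definition purely_imaginary :: "('a, 'b) ring_scheme \<Rightarrow> bool" where
  "purely_imaginary K \<longleftrightarrow> ring_hom K (ring_of_type_algebra :: real ring) = {}"

definition torsion :: "('a, 'b) monoid_scheme \<Rightarrow> 'a set" where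
  "torsion G = {x \<in> carrier G. \<exists>n::nat. n > 0 \<and> x [^]\<^bsub>G\<^esub> n = \<one>\<^bsub>G\<^esub>}"

definition roots_of_unity :: "('a, 'b) ring_scheme \<Rightarrow> 'a set" where
  "roots_of_unity K = torsion K"

end

theory Submission
  imports Defs "Jordan_Normal_Form.Determinant"
begin

text \<open>
  A holomorphic endomorphism of \<open>\<complex>\<^sup>n / L\<close> lifts to a unique matrix preserving \<open>L\<close>, so
  \<open>End\<^sup>0(T)\<close> maps to complex matrices. As \<open>End\<^sup>0(T)\<close> is a field, the image is commutative and has a
  joint eigenvector; its eigenvalue embeds \<open>End\<^sup>0(T)\<close> into \<open>\<complex>\<close> and identifies \<open>End(T)\<close> with an order
  \<open>R\<close> of rank \<open>2s\<close> in a number field, and \<open>Aut(T)\<close> with the unit group of \<open>R\<close>. Dirichlet's unit theorem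
  for \<open>R\<close> then gives the result: the logarithms of the absolute values at the \<open>s\<close> complex places
  map the units onto a discrete relatively dense subgroup of a hyperplane in \<open>\<real>\<^sup>s\<close>, and the kernel
  consists of roots of unity.
\<close>

hide_const (open) Module.module.smult UnivPoly.up_ring.monom UnivPoly.up_ring.coeff
  Polynomials.degree Polynomials.lead_coeff Matrix.mat Ring_Hom.ring_hom

section \<open>Discrete subgroups of coordinate spaces\<close>

text \<open>The eigenvalue map is injective only because its source is a field, and it forgets the
  topology: for s > 1 the order R is dense in \<complex>, so its finite generation is not visible
  there. It is therefore proved on the matrix side, where endomorphisms have integral coordinates
  with respect to a lattice basis, and only then carried to \<complex>. One theorem on discrete
  subgroups serves twice, for matrices and for logarithms of units; in the second use the exact rank
  matters, and bounded distance to every point yields it without volumes. R need not be the maximal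
  order, so ideals are avoided: the norm is the determinant of an integer multiplication matrix, and
  the adjugate shows that an element divides its norm inside R. Embeddings are labelled by the
  conjugates z of a primitive element \<theta>; conjugating an embedding then means conjugating its
  label, and a real embedding is one with a real label.\<close>

lemma int_mult_mem:
  fixes \<Gamma> :: "('i \<Rightarrow> real) set"
  assumes zero: "(\<lambda>_. 0) \<in> \<Gamma>"
    and diff: "\<And>x y. x \<in> \<Gamma> \<Longrightarrow> y \<in> \<Gamma> \<Longrightarrow> (\<lambda>i. x i - y i) \<in> \<Gamma>"
    and x: "x \<in> \<Gamma>"
  shows "(\<lambda>i. of_int n * x i) \<in> \<Gamma>"
proof (induction n rule: int_induct[where k = 0])
  case base
  show ?case using zero by simp
next
  case (step1 n)
  have "(\<lambda>i. 0 - x i) \<in> \<Gamma>" using diff[OF zero x] by simp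
  from diff[OF step1(2) this] show ?case by (simp add: algebra_simps)
next
  case (step2 n)
  from diff[OF step2(2) x] show ?case by (simp add: algebra_simps)
qed

lemma int_combination_mem:
  fixes \<Gamma> :: "('i \<Rightarrow> real) set"
  assumes zero: "(\<lambda>_. 0) \<in> \<Gamma>"
    and diff: "\<And>x y. x \<in> \<Gamma> \<Longrightarrow> y \<in> \<Gamma> \<Longrightarrow> (\<lambda>i. x i - y i) \<in> \<Gamma>"
    and g: "\<And>k. k < r \<Longrightarrow> g k \<in> \<Gamma>"
  shows "(\<lambda>i. \<Sum>k<(r::nat). of_int (n k) * g k i) \<in> \<Gamma>"
  using g
proof (induction r)
  case 0
  show ?case using zero by simp
next
  case (Suc r)
  have "(\<lambda>i. \<Sum>k<r. of_int (n k) * g k i) \<in> \<Gamma>" using Suc by simp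
  moreover have "(\<lambda>i. of_int (- n r) * g r i) \<in> \<Gamma>"
    using int_mult_mem[OF zero diff] Suc.prems by blast
  ultimately have "(\<lambda>i. (\<Sum>k<r. of_int (n k) * g k i) - of_int (- n r) * g r i) \<in> \<Gamma>"
    by (rule diff)
  then show ?case by simp
qed

text \<open>The multiples of \<open>y\<close> by factors in (0, 1] stay in a bounded box, so only
  finitely many of them lie in the group; the least such factor gives a primitive vector on the line
  of \<open>y\<close>. Coordinate \<open>i0\<close> later serves as the pivot of a
  projection.\<close>

lemma discrete_line_generator:
  fixes \<Gamma> :: "('i \<Rightarrow> real) set"
  assumes "finite I"
    and zero: "(\<lambda>_. 0) \<in> \<Gamma>"
    and diff: "\<And>x y. x \<in> \<Gamma> \<Longrightarrow> y \<in> \<Gamma> \<Longrightarrow> (\<lambda>i. x i - y i) \<in> \<Gamma>"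
    and disc: "\<And>C. finite {x \<in> \<Gamma>. \<forall>i\<in>I. \<bar>x i\<bar> \<le> C}"
    and y: "y \<in> \<Gamma>" "y i0 \<noteq> 0"
  obtains h where "h \<in> \<Gamma>" "h i0 \<noteq> 0"
    "\<And>c. (\<lambda>i. c * h i) \<in> \<Gamma> \<Longrightarrow> c \<in> \<int>"
proof -
  define P where "P = {c. 0 < c \<and> c \<le> 1 \<and> (\<lambda>i. c * y i) \<in> \<Gamma>}"
  have "(\<lambda>c i. c * y i) ` P \<subseteq> {x \<in> \<Gamma>. \<forall>i\<in>I. \<bar>x i\<bar> \<le> (\<Sum>i\<in>I. \<bar>y i\<bar>)}"
  proof (clarsimp simp: P_def)
    fix c :: real and i assume c: "0 < c" "c \<le> 1" "i \<in> I"
    have "\<bar>c * y i\<bar> \<le> 1 * \<bar>y i\<bar>"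
      unfolding abs_mult by (rule mult_right_mono) (use c in auto)
    also have "\<dots> \<le> (\<Sum>i\<in>I. \<bar>y i\<bar>)"
      using member_le_sum[of i I "\<lambda>i. \<bar>y i\<bar>"] c \<open>finite I\<close> by simp
    finally show "\<bar>c * y i\<bar> \<le> (\<Sum>i\<in>I. \<bar>y i\<bar>)" .
  qed
  moreover have "inj_on (\<lambda>c i. c * y i) P"
    by (rule inj_onI) (metis y(2) mult_right_cancel)
  ultimately have "finite P"
    using disc finite_subset inj_on_finite by blast
  have "1 \<in> P" using y by (simp add: P_def)
  define c0 where "c0 = Min P"
  have c0: "c0 \<in> P" "\<And>c. c \<in> P \<Longrightarrow> c0 \<le> c"
    using \<open>finite P\<close> \<open>1 \<in> P\<close> by (auto simp: c0_def intro!: Min_in)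
  then have pos: "0 < c0" "c0 \<le> 1" "(\<lambda>i. c0 * y i) \<in> \<Gamma>" by (auto simp: P_def)
  show thesis
  proof (rule that[of "\<lambda>i. c0 * y i"])
    fix c assume c: "(\<lambda>i. c * (c0 * y i)) \<in> \<Gamma>"
    \<comment> \<open>Subtracting an integer multiple leaves the factor \<open>frac c * c0\<close>
      of \<open>y\<close>, which is below the minimum \<open>c0\<close> and so cannot be
      positive.\<close>
    have "(\<lambda>i. c * (c0 * y i) - of_int \<lfloor>c\<rfloor> * (c0 * y i)) \<in> \<Gamma>"
      using diff[OF c int_mult_mem[OF zero diff pos(3)]] by blast
    then have mem: "(\<lambda>i. frac c * c0 * y i) \<in> \<Gamma>"
      by (simp add: frac_def algebra_simps)
    have lt: "frac c * c0 < 1 * c0"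
      by (rule mult_strict_right_mono) (use pos frac_lt_1 in auto)
    have "\<not> frac c > 0"
    proof
      assume "frac c > 0"
      moreover have "frac c * c0 \<le> 1" using lt pos by linarith
      ultimately have "frac c * c0 \<in> P" using mem pos by (auto simp: P_def)
      then show False using c0(2) lt by fastforce
    qed
    then show "c \<in> \<int>" using frac_ge_0[of c] by (simp add: frac_eq_0_iff[symmetric] del: frac_eq_0_iff)
  qed (use pos y in auto)
qed

text \<open>Points are functions on a type of labels, so that an induction can shrink the set of
  active coordinates without changing the type. Independence is over \<int>.\<close>

definition int_basis :: "('i \<Rightarrow> real) set \<Rightarrow> nat \<Rightarrow> (nat \<Rightarrow> 'i \<Rightarrow> real) \<Rightarrow> bool" where
  "int_basis \<Gamma> r g \<longleftrightarrow> (\<forall>k<r. g k \<in> \<Gamma>) \<and>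
     (\<forall>x\<in>\<Gamma>. \<exists>n::nat \<Rightarrow> int. \<forall>i. x i = (\<Sum>k<r. of_int (n k) * g k i)) \<and>
     (\<forall>n::nat \<Rightarrow> int. (\<forall>i. (\<Sum>k<r. of_int (n k) * g k i) = 0) \<longrightarrow> (\<forall>k<r. n k = 0))"

text \<open>Cocompactness in a form that passes to projections: this is what forces full rank in the
  induction below.\<close>

definition relatively_dense :: "'i set \<Rightarrow> ('i \<Rightarrow> real) set \<Rightarrow> bool" where
  "relatively_dense I \<Gamma> \<longleftrightarrow> (\<exists>D. \<forall>t. \<exists>x\<in>\<Gamma>. \<forall>i\<in>I. \<bar>x i - t i\<bar> \<le> D)"

lemma int_basisD:
  assumes "int_basis \<Gamma> r g"
  shows "k < r \<Longrightarrow> g k \<in> \<Gamma>"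
    and "x \<in> \<Gamma> \<Longrightarrow> \<exists>n::nat \<Rightarrow> int. \<forall>i. x i = (\<Sum>k<r. of_int (n k) * g k i)"
    and "(\<And>i. (\<Sum>k<r. of_int (n k) * g k i) = 0) \<Longrightarrow> k < r \<Longrightarrow> (n k :: int) = 0"
  using assms unfolding int_basis_def by blast+

text \<open>Induction on the dimension: project along a primitive vector of \<open>\<Gamma>\<close>. It stays
  discrete, since elements of \<open>\<Gamma>\<close> can be reduced modulo that vector.\<close>

lemma discrete_subgroup_basis:
  fixes \<Gamma> :: "('i \<Rightarrow> real) set"
  assumes "finite I"
    and "(\<lambda>_. 0) \<in> \<Gamma>"
    and "\<And>x y. x \<in> \<Gamma> \<Longrightarrow> y \<in> \<Gamma> \<Longrightarrow> (\<lambda>i. x i - y i) \<in> \<Gamma>"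
    and "\<And>x i. x \<in> \<Gamma> \<Longrightarrow> i \<notin> I \<Longrightarrow> x i = 0"
    and "\<And>C. finite {x \<in> \<Gamma>. \<forall>i\<in>I. \<bar>x i\<bar> \<le> C}"
  shows "\<exists>r g. int_basis \<Gamma> r g \<and> (relatively_dense I \<Gamma> \<longrightarrow> r = card I)"
  using assms
proof (induction "card I" arbitrary: I \<Gamma> rule: less_induct)
  case less
  note zero = less.prems(2) and diff = less.prems(3) and supp = less.prems(4)
    and disc = less.prems(5)
  have im: "(\<lambda>i. of_int n * x i) \<in> \<Gamma>" if "x \<in> \<Gamma>" for n x
    using zero diff that by (rule int_mult_mem)
  have ic: "(\<lambda>i. \<Sum>k<r. of_int (n k) * g k i) \<in> \<Gamma>" if "\<And>k. k < r \<Longrightarrow> g k \<in> \<Gamma>"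
    for n g and r :: nat
    using zero diff that by (rule int_combination_mem)
  show ?case
  proof (cases "\<Gamma> \<subseteq> {\<lambda>_. 0}")
    case True
    \<comment> \<open>The zero vector cannot approximate the point with all coordinates
      \<open>D + 1\<close> to within \<open>D\<close>, so density leaves no coordinate at
      all.\<close>
    have "card I = 0" if "\<forall>t. \<exists>x\<in>\<Gamma>. \<forall>i\<in>I. \<bar>x i - t i\<bar> \<le> D" for D
    proof (rule ccontr)
      assume "card I \<noteq> 0"
      then obtain i where i: "i \<in> I" by fastforce
      from that[rule_format, of "\<lambda>_. D + 1"] obtain x where "x \<in> \<Gamma>" "\<bar>x i - (D + 1)\<bar> \<le> D"
        using i by blast
      then show False using True by auto
    qed
    with True show ?thesis
      unfolding int_basis_def relatively_dense_def by (intro exI[of _ 0] exI) auto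
  next
    case False
    then obtain y i0 where y: "y \<in> \<Gamma>" "y i0 \<noteq> 0" by force
    from discrete_line_generator[OF less.prems(1) zero diff disc y]
    obtain h where h: "h \<in> \<Gamma>" "h i0 \<noteq> 0" and hint: "\<And>c. (\<lambda>i. c * h i) \<in> \<Gamma> \<Longrightarrow> c \<in> \<int>"
      by blast
    have i0: "i0 \<in> I" using supp h by blast
    define S where "S = (\<Sum>i\<in>I. \<bar>h i\<bar>)"
    have S: "\<bar>h i\<bar> \<le> S" if "i \<in> I" for i
      unfolding S_def using member_le_sum[of i I "\<lambda>i. \<bar>h i\<bar>"] that less.prems(1) by simp
    \<comment> \<open>The projection along \<open>h\<close> onto the hyperplane where coordinate
      \<open>i0\<close> vanishes.\<close>
    define T where "T x = (\<lambda>i. x i - x i0 / h i0 * h i)" for x :: "'i \<Rightarrow> real"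
    define J where "J = I - {i0}"
    have cJ: "card J < card I" "Suc (card J) = card I"
      using card_Suc_Diff1[OF less.prems(1) i0] by (auto simp: J_def)
    have T_sum: "T (\<lambda>i. \<Sum>k<r. c k * G k i) = (\<lambda>i. \<Sum>k<r. c k * T (G k) i)"
      for c :: "nat \<Rightarrow> real" and G and r :: nat
      by (auto simp: T_def sum_subtractf sum_distrib_left sum_distrib_right sum_divide_distrib algebra_simps
          intro!: ext)
    have T_diff: "T (\<lambda>i. x i - z i) = (\<lambda>i. T x i - T z i)" for x z
      by (auto simp: T_def diff_divide_distrib algebra_simps)
    have T_h: "T h = (\<lambda>_. 0)" using h by (auto simp: T_def)
    have IH: "\<exists>r g. int_basis (T ` \<Gamma>) r g \<and> (relatively_dense J (T ` \<Gamma>) \<longrightarrow> r = card J)"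
    proof (rule less.hyps[OF cJ(1)])
      show "finite J" using less.prems(1) by (simp add: J_def)
      have "T (\<lambda>_. 0) = (\<lambda>_. 0)" by (simp add: T_def)
      then show "(\<lambda>_. 0) \<in> T ` \<Gamma>" using zero by force
      show "(\<lambda>i. x i - z i) \<in> T ` \<Gamma>" if "x \<in> T ` \<Gamma>" "z \<in> T ` \<Gamma>" for x z
        using that by (auto simp: T_diff[symmetric] intro: diff)
      show "x i = 0" if "x \<in> T ` \<Gamma>" "i \<notin> J" for x i
      proof -
        from that(1) obtain w where w: "w \<in> \<Gamma>" "x = T w" by blast
        show ?thesis
          using that(2) supp[OF w(1), of i] supp[OF h(1), of i] h(2)
          by (cases "i = i0") (auto simp: w T_def J_def)
      qed
      show "finite {x \<in> T ` \<Gamma>. \<forall>i\<in>J. \<bar>x i\<bar> \<le> C}" for C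
      proof (rule finite_subset)
        show "{x \<in> T ` \<Gamma>. \<forall>i\<in>J. \<bar>x i\<bar> \<le> C} \<subseteq> T ` {x \<in> \<Gamma>. \<forall>i\<in>I. \<bar>x i\<bar> \<le> \<bar>C\<bar> + S}"
        proof clarify
          fix x assume x: "x \<in> \<Gamma>" "\<forall>i\<in>J. \<bar>T x i\<bar> \<le> C"
          \<comment> \<open>Reducing the coefficient of \<open>h\<close> to its fractional part
            keeps the projection and bounds every coordinate, so finiteness for \<Gamma> yields
            finiteness for its image.\<close>
          define x' where "x' = (\<lambda>i. x i - of_int \<lfloor>x i0 / h i0\<rfloor> * h i)"
          have x': "x' \<in> \<Gamma>" unfolding x'_def by (rule diff[OF x(1) im[OF h(1)]])
          have eq: "x' i = T x i + frac (x i0 / h i0) * h i" for i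
            by (simp add: x'_def T_def frac_def algebra_simps)
          have "T x' = T x" using h(2)
            by (intro ext) (simp add: T_def x'_def field_simps)
          moreover have "\<bar>x' i\<bar> \<le> \<bar>C\<bar> + S" if i: "i \<in> I" for i
          proof -
            have "\<bar>frac (x i0 / h i0) * h i\<bar> \<le> 1 * \<bar>h i\<bar>"
              unfolding abs_mult by (rule mult_right_mono) (auto simp: less_imp_le[OF frac_lt_1])
            moreover have "\<bar>T x i\<bar> \<le> \<bar>C\<bar>"
            proof (cases "i = i0")
              case True then show ?thesis using h by (simp add: T_def)
            next
              case False then show ?thesis using x(2) i by (force simp: J_def)
            qed
            ultimately show ?thesis using S[OF i] unfolding eq by linarith
          qed
          ultimately show "T x \<in> T ` {x \<in> \<Gamma>. \<forall>i\<in>I. \<bar>x i\<bar> \<le> \<bar>C\<bar> + S}"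
            using x' by (intro image_eqI[of _ _ x']) auto
        qed
      qed (rule finite_imageI[OF disc])
    qed
    then obtain r g where basis: "int_basis (T ` \<Gamma>) r g"
      and rk: "relatively_dense J (T ` \<Gamma>) \<Longrightarrow> r = card J" by blast
    note g = int_basisD(1)[OF basis] and gen = int_basisD(2)[OF basis] and ind = int_basisD(3)[OF basis]
    have "\<forall>k. \<exists>G. k < r \<longrightarrow> G \<in> \<Gamma> \<and> T G = g k" using g by (metis image_iff)
    then obtain G where G: "\<And>k. k < r \<Longrightarrow> G k \<in> \<Gamma>" "\<And>k. k < r \<Longrightarrow> T (G k) = g k" by metis
    \<comment> \<open>Lifts of a basis of the projection, with the primitive vector \<open>h\<close>
      appended at index \<open>r\<close>.\<close>
    define H where "H = (\<lambda>k. if k < r then G k else h)"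
    have H_sum: "(\<Sum>k<Suc r. of_int (n k) * H k i) = (\<Sum>k<r. of_int (n k) * G k i) + of_int (n r) * h i"
      for n :: "nat \<Rightarrow> int" and i by (simp add: H_def)
    have T_sum': "T (\<lambda>i. \<Sum>k<r. of_int (n k) * G k i) = (\<lambda>i. \<Sum>k<r. of_int (n k) * g k i)"
      for n :: "nat \<Rightarrow> int" unfolding T_sum by (simp add: G(2))
    show ?thesis
      unfolding int_basis_def
    proof (intro exI[of _ "Suc r"] exI[of _ H] conjI allI impI ballI)
      show "H k \<in> \<Gamma>" if "k < Suc r" for k using G(1) h(1) by (simp add: H_def)
      show "\<exists>n::nat \<Rightarrow> int. \<forall>i. x i = (\<Sum>k<Suc r. of_int (n k) * H k i)" if x: "x \<in> \<Gamma>" for x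
      proof -
        from gen[of "T x"] x obtain n :: "nat \<Rightarrow> int"
          where n: "T x = (\<lambda>i. \<Sum>k<r. of_int (n k) * g k i)" by blast
        define w where "w = (\<lambda>i. x i - (\<Sum>k<r. of_int (n k) * G k i))"
        have w: "w \<in> \<Gamma>" unfolding w_def by (rule diff[OF x ic[OF G(1)]])
        \<comment> \<open>What the projection kills is a multiple of \<open>h\<close>, and
          primitivity of \<open>h\<close> makes the factor an integer.\<close>
        have "T w = (\<lambda>_. 0)" unfolding w_def T_diff T_sum' n by simp
        then have weq: "w = (\<lambda>i. w i0 / h i0 * h i)" unfolding T_def by (metis eq_iff_diff_eq_0)
        then have "w i0 / h i0 \<in> \<int>" using hint w by metis
        then obtain m :: int where "w i0 / h i0 = of_int m" by (auto elim: Ints_cases)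
        with weq have "w i = of_int m * h i" for i by metis
        then have "x i = (\<Sum>k<r. of_int (n k) * G k i) + of_int m * h i" for i
          unfolding w_def by (metis add.commute diff_add_cancel)
        then have "\<forall>i. x i = (\<Sum>k<Suc r. of_int ((n(r := m)) k) * H k i)"
          unfolding H_sum by simp
        then show ?thesis by blast
      qed
      show "n k = 0" if n: "\<forall>i. (\<Sum>k<Suc r. of_int (n k) * H k i) = 0" and k: "k < Suc r"
        for n :: "nat \<Rightarrow> int" and k
      proof -
        have *: "(\<Sum>k<r. of_int (n k) * G k i) = - of_int (n r) * h i" for i
          using n unfolding H_sum by (simp add: eq_neg_iff_add_eq_0)
        \<comment> \<open>Projecting removes the multiple of \<open>h\<close>, so the other
          coefficients vanish; coordinate \<open>i0\<close> then decides the last one.\<close>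
        have "(\<lambda>i. \<Sum>k<r. of_int (n k) * g k i) = T (\<lambda>i. - of_int (n r) * h i)"
          unfolding T_sum'[symmetric] * ..
        also have "\<dots> = (\<lambda>i. 0)" using h by (simp add: T_def)
        finally have "(\<Sum>k<r. of_int (n k) * g k i) = 0" for i by metis
        then have 0: "\<forall>k<r. n k = 0" using ind[of n] by blast
        then have "of_int (n r) * h i0 = 0" using *[of i0] by simp
        with h 0 k show ?thesis by (auto simp: less_Suc_eq)
      qed
      show "Suc r = card I" if ex: "relatively_dense I \<Gamma>"
      proof -
        from ex obtain D where D: "\<And>t. \<exists>x\<in>\<Gamma>. \<forall>i\<in>I. \<bar>x i - t i\<bar> \<le> D"
          unfolding relatively_dense_def by blast
        have "\<exists>x\<in>T ` \<Gamma>. \<forall>i\<in>J. \<bar>x i - t i\<bar> \<le> D + D / \<bar>h i0\<bar> * S" for t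
        proof -
          \<comment> \<open>With target 0 in coordinate \<open>i0\<close>, the approximating point
            has an entry of size at most \<open>D\<close> there, and the projection moves it by at
            most \<open>D / \<bar>h i0\<bar> * S\<close>.\<close>
          from D[of "t(i0 := 0)"] obtain x where x: "x \<in> \<Gamma>" "\<And>i. i \<in> J \<Longrightarrow> \<bar>x i - t i\<bar> \<le> D" "\<bar>x i0\<bar> \<le> D"
            using i0 by (force simp: J_def)
          have "\<bar>T x i - t i\<bar> \<le> D + D / \<bar>h i0\<bar> * S" if i: "i \<in> J" for i
          proof -
            have "\<bar>x i0 / h i0 * h i\<bar> = \<bar>x i0\<bar> / \<bar>h i0\<bar> * \<bar>h i\<bar>" by (simp add: abs_mult)
            also have "\<dots> \<le> D / \<bar>h i0\<bar> * S"
              using x(3) S[of i] i by (intro mult_mono divide_right_mono) (auto simp: J_def)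
            finally show ?thesis using x(2)[OF i] unfolding T_def by linarith
          qed
          then show ?thesis using x(1) by blast
        qed
        then have "r = card J" by (intro rk) (auto simp: relatively_dense_def)
        then show ?thesis using cJ by simp
      qed
    qed
  qed
qed

section \<open>Joint eigenvectors of commuting complex matrices\<close>

text \<open>There is one more vector than the spanning set has elements. The vectors form a family
  rather than a set because powers may repeat; a repetition is itself a relation, with coefficients
  1 and -1.\<close>

lemma (in vector_space) ex_nontrivial_relation:
  assumes "finite S" and u: "\<And>i. i \<le> card S \<Longrightarrow> u i \<in> span S"
  obtains c :: "nat \<Rightarrow> 'a" where "\<exists>i\<le>card S. c i \<noteq> 0" "(\<Sum>i\<le>card S. scale (c i) (u i)) = 0"
proof (cases "inj_on u {..card S}")
  case True
  have "dependent (u ` {..card S})"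
  proof (rule ccontr)
    assume "independent (u ` {..card S})"
    then have "card (u ` {..card S}) \<le> card S"
      using independent_span_bound[OF assms(1)] u by blast
    with True show False by (simp add: card_image)
  qed
  then obtain f where "\<exists>v\<in>u ` {..card S}. f v \<noteq> 0" "(\<Sum>v\<in>u ` {..card S}. scale (f v) v) = 0"
    by (auto simp: dependent_finite)
  with True show ?thesis by (intro that[of "f \<circ> u"]) (auto simp: sum.reindex)
next
  case False
  then obtain i j where ij: "i \<le> card S" "j \<le> card S" "u i = u j" "i \<noteq> j"
    by (auto simp: inj_on_def)
  define c :: "nat \<Rightarrow> 'a" where "c = (\<lambda>k. if k = i then 1 else if k = j then -1 else 0)"
  have "(\<Sum>k\<le>card S. scale (c k) (u k)) = (\<Sum>k\<in>{i, j}. scale (c k) (u k))"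
    by (rule sum.mono_neutral_right) (use ij in \<open>auto simp: c_def\<close>)
  also have "\<dots> = 0" using ij by (simp add: c_def)
  finally show ?thesis by (intro that[of c]) (use ij in \<open>auto simp: c_def\<close>)
qed

text \<open>The vector p(A)w in Horner form. Only the orbit of one vector matters, so a polynomial
  in the matrix itself is never formed.\<close>

definition poly_mat_vec :: "complex^'n^'n \<Rightarrow> complex poly \<Rightarrow> complex^'n \<Rightarrow> complex^'n" where
  "poly_mat_vec A p w = fold_coeffs (\<lambda>a v. a *s w + A *v v) p 0"

lemma poly_mat_vec_0 [simp]: "poly_mat_vec A 0 w = 0"
  by (simp add: poly_mat_vec_def)

lemma poly_mat_vec_pCons [simp]:
  "poly_mat_vec A (pCons a p) w = a *s w + A *v poly_mat_vec A p w"
  by (cases "p = 0"; cases "a = 0") (auto simp: poly_mat_vec_def)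

lemma poly_mat_vec_add: "poly_mat_vec A (p + q) w = poly_mat_vec A p w + poly_mat_vec A q w"
proof (induction p arbitrary: q)
  case (pCons a p)
  obtain b r where q: "q = pCons b r" by (cases q)
  show ?case
    unfolding q add_pCons poly_mat_vec_pCons pCons.IH
    by (simp add: matrix_vector_right_distrib vec.scale_left_distrib algebra_simps)
qed simp

lemma poly_mat_vec_smult: "poly_mat_vec A (smult c p) w = c *s poly_mat_vec A p w"
  by (induction p) (simp_all add: vec.scale vec.scale_right_distrib)

lemma poly_mat_vec_monom: "poly_mat_vec A (monom c i) w = c *s (((*v) A) ^^ i) w"
  by (induction i) (simp_all add: monom_0 monom_Suc vec.scale)

lemma poly_mat_vec_sum: "poly_mat_vec A (\<Sum>i\<in>I. p i) w = (\<Sum>i\<in>I. poly_mat_vec A (p i) w)"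
  by (induction I rule: infinite_finite_induct) (simp_all add: poly_mat_vec_add)

lemma poly_mat_vec_mem:
  assumes "vec.subspace W" "w \<in> W" "\<And>w. w \<in> W \<Longrightarrow> A *v w \<in> W"
  shows "poly_mat_vec A p w \<in> W"
  by (induction p) (auto intro!: assms vec.subspace_0 vec.subspace_add vec.subspace_scale)

text \<open>Let p be a polynomial of least degree with p(A)w = 0, and write p = (x - e) q for a root
  e. By minimality q(A)w is non-zero; it is an eigenvector for e, and it stays in the invariant
  subspace.\<close>

lemma eigenvector_in_invariant_subspace:
  fixes A :: "complex^'n^'n"
  assumes W: "vec.subspace W" "w \<in> W" "w \<noteq> 0" and inv: "\<And>w. w \<in> W \<Longrightarrow> A *v w \<in> W"
  obtains c u where "u \<in> W" "u \<noteq> 0" "A *v u = c *s u"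
proof -
  obtain c where c: "\<exists>i\<le>card (cart_basis :: (complex^'n) set). c i \<noteq> 0"
     "(\<Sum>i\<le>card (cart_basis :: (complex^'n) set). c i *s (((*v) A) ^^ i) w) = 0"
    by (rule vec.ex_nontrivial_relation[of "cart_basis :: (complex^'n) set" "\<lambda>i. (((*v) A) ^^ i) w"])
       (auto simp: finite_cart_basis span_cart_basis)
  define P where "P p \<longleftrightarrow> p \<noteq> 0 \<and> poly_mat_vec A p w = 0" for p
  let ?p = "\<Sum>i\<le>card (cart_basis :: (complex^'n) set). monom (c i) i"
  from c(1) obtain i where i: "i \<le> card (cart_basis :: (complex^'n) set)" "c i \<noteq> 0" by blast
  have "coeff ?p i = c i" using i by (simp add: coeff_sum)
  then have "P ?p" using c(2) i by (auto simp: P_def poly_mat_vec_sum poly_mat_vec_monom)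
  then obtain p where p: "P p" "\<And>q. P q \<Longrightarrow> degree p \<le> degree q"
    using ex_has_least_nat[of P _ degree] by blast
  have "degree p \<noteq> 0"
  proof
    assume "degree p = 0"
    then obtain a where "p = [:a:]" by (rule degree_eq_zeroE)
    with p W show False by (auto simp: P_def)
  qed
  then have "\<not> constant (poly p)" by (simp add: constant_degree)
  then obtain e where "poly p e = 0" using fundamental_theorem_of_algebra by blast
  then obtain q where q: "p = [:-e, 1:] * q" by (auto simp: poly_eq_0_iff_dvd)
  then have "q \<noteq> 0" using p by (auto simp: P_def)
  then have "degree p = Suc (degree q)" unfolding q by (subst degree_mult_eq) auto
  then have ne: "poly_mat_vec A q w \<noteq> 0" using p(2)[of q] \<open>q \<noteq> 0\<close> by (auto simp: P_def)
  have "p = pCons 0 q + smult (-e) q" by (simp add: q)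
  then have "poly_mat_vec A p w = A *v poly_mat_vec A q w - e *s poly_mat_vec A q w"
    by (simp only: poly_mat_vec_add poly_mat_vec_smult poly_mat_vec_pCons) simp
  then have "A *v poly_mat_vec A q w = e *s poly_mat_vec A q w" using p by (simp add: P_def)
  moreover have "poly_mat_vec A q w \<in> W" using W(1,2) inv by (rule poly_mat_vec_mem)
  ultimately show ?thesis using ne that by blast
qed

text \<open>Take a non-zero invariant subspace W of least dimension. An eigenspace of one matrix
  inside W is invariant under all the others, since they commute with it, so it is all of W. Hence
  every matrix acts on W as a scalar.\<close>

lemma commuting_joint_eigenvector:
  fixes S :: "(complex^'n^'n) set"
  assumes comm: "\<And>A B. A \<in> S \<Longrightarrow> B \<in> S \<Longrightarrow> A ** B = B ** A"
  obtains v where "v \<noteq> 0" "\<And>A. A \<in> S \<Longrightarrow> \<exists>c. A *v v = c *s v"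
proof -
  define P where "P W \<longleftrightarrow> vec.subspace W \<and> (\<exists>w\<in>W. w \<noteq> 0) \<and> (\<forall>A\<in>S. \<forall>w\<in>W. A *v w \<in> W)"
    for W :: "(complex^'n) set"
  have "(\<chi> i. 1) \<noteq> (0 :: complex^'n)" by (simp add: Finite_Cartesian_Product.vec_eq_iff)
  then have "P UNIV" unfolding P_def by (metis UNIV_I vec.subspace_UNIV)
  then obtain W where W: "P W" "\<And>V. P V \<Longrightarrow> vec.dim W \<le> vec.dim V"
    using ex_has_least_nat[of P _ vec.dim] by blast
  then obtain v where v: "v \<in> W" "v \<noteq> 0" by (auto simp: P_def)
  have "\<exists>c. A *v v = c *s v" if A: "A \<in> S" for A
  proof -
    have sub: "vec.subspace W" and inv: "\<And>B w. B \<in> S \<Longrightarrow> w \<in> W \<Longrightarrow> B *v w \<in> W"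
      using W(1) by (auto simp: P_def)
    obtain c u where cu: "u \<in> W" "u \<noteq> 0" "A *v u = c *s u"
      using sub v inv[OF A] by (rule eigenvector_in_invariant_subspace)
    define V where "V = {w \<in> W. A *v w = c *s w}"
    have "vec.subspace V"
      unfolding V_def vec.subspace_def
      by (auto simp: vec.subspace_0[OF sub] vec.subspace_add[OF sub] vec.subspace_scale[OF sub]
          vec.add vec.scale vec.scale_right_distrib mult.commute)
    moreover have "B *v w \<in> V" if "B \<in> S" "w \<in> V" for B w
    proof -
      have "A *v (B *v w) = B *v (A *v w)"
        using comm[OF A \<open>B \<in> S\<close>] by (simp add: matrix_vector_mul_assoc)
      with that inv show ?thesis by (auto simp: V_def vec.scale)
    qed
    ultimately have "P V" using cu by (auto simp: P_def V_def)
    then have "V = W"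
      by (intro vec.subspace_dim_equal W(2)) (use sub in \<open>auto simp: P_def V_def\<close>)
    with v show ?thesis by (auto simp: V_def)
  qed
  with v show ?thesis using that by blast
qed

section \<open>Embeddings of a number field inside the complex numbers\<close>

text \<open>Elements of \<rat>(\<theta>) are handled as values q(\<theta>), so that an embedding is
  nothing but evaluation of the same q at a conjugate of \<theta>.\<close>

definition qev :: "rat poly \<Rightarrow> complex \<Rightarrow> complex" where
  "qev p x = poly (map_poly of_rat p) x"

lemma qev_0 [simp]: "qev 0 x = 0" by (simp add: qev_def)

lemma qev_pCons [simp]: "qev (pCons a p) x = of_rat a + x * qev p x"
  by (simp add: qev_def map_poly_pCons)

lemma qev_add: "qev (p + q) x = qev p x + qev q x"
proof (induction p arbitrary: q)
  case (pCons a p)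
  obtain b r where q: "q = pCons b r" by (cases q)
  show ?case unfolding q add_pCons qev_pCons pCons.IH by (simp add: of_rat_add algebra_simps)
qed simp

lemma qev_smult: "qev (smult c p) x = of_rat c * qev p x"
  by (induction p) (simp_all add: of_rat_mult algebra_simps)

lemma qev_mult: "qev (p * q) x = qev p x * qev q x"
  by (induction p) (simp_all add: qev_add qev_smult algebra_simps)

lemma qev_minus: "qev (- p) x = - qev p x"
  using qev_smult[of "-1" p x] by simp

lemma qev_diff: "qev (p - q) x = qev p x - qev q x"
  using qev_add[of p "- q" x] by (simp add: qev_minus)

lemma qev_sum: "qev (\<Sum>i\<in>I. p i) x = (\<Sum>i\<in>I. qev (p i) x)"
  by (induction I rule: infinite_finite_induct) (simp_all add: qev_add)

lemma qev_monom: "qev (monom c i) x = of_rat c * x ^ i"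
  by (induction i) (simp_all add: monom_0 monom_Suc)

lemma qev_pcompose: "qev (pcompose p q) x = qev p (qev q x)"
  by (induction p) (simp_all add: pcompose_pCons qev_add qev_mult)

lemma qev_cnj: "qev p (cnj x) = cnj (qev p x)"
proof (induction p)
  case (pCons a p)
  have "cnj (of_rat a) = of_rat a" by (cases a) (simp add: of_rat_rat)
  with pCons show ?case by simp
qed simp

section \<open>The complex numbers over \<rat>: algebraic elements and primitive elements\<close>

interpretation rat_vec: vector_space "\<lambda>(q::rat) (z::complex). of_rat q * z"
  by unfold_locales (simp_all add: algebra_simps of_rat_add of_rat_mult)

lemma algebraic_in_finite_span:
  assumes "finite B" and pow: "\<And>i. x ^ i \<in> rat_vec.span B"
  obtains p where "p \<noteq> 0" "qev p x = 0"
proof -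
  obtain c where c: "\<exists>i\<le>card B. c i \<noteq> 0" "(\<Sum>i\<le>card B. of_rat (c i) * x ^ i) = 0"
    using rat_vec.ex_nontrivial_relation[OF assms(1), of "\<lambda>i. x ^ i"] pow by blast
  from c(1) obtain i where i: "i \<le> card B" "c i \<noteq> 0" by blast
  let ?p = "\<Sum>i\<le>card B. monom (c i) i"
  have "coeff ?p i = c i" using i by (simp add: coeff_sum)
  with i have "?p \<noteq> 0" by auto
  moreover have "qev ?p x = 0" using c(2) by (simp add: qev_sum qev_monom)
  ultimately show ?thesis by (rule that)
qed

text \<open>If the constant term of the annihilating polynomial is zero, divide by x; otherwise the
  relation can be solved for the inverse of x.\<close>

lemma inverse_qev:
  assumes "p \<noteq> 0" "qev p x = 0" "x \<noteq> 0"
  obtains q where "inverse x = qev q x"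
  using assms(1,2)
proof (induction p arbitrary: thesis)
  case (pCons a p)
  show ?case
  proof (cases "a = 0")
    case True
    with pCons assms(3) show ?thesis by (metis add_0 mult_eq_0_iff of_rat_0 pCons_0_0 qev_pCons)
  next
    case False
    have "x * qev p x = - of_rat a" using pCons.prems(3) by (simp add: add_eq_0_iff2)
    then have "inverse x = qev p x * - inverse (of_rat a)"
      using False assms(3) by (simp add: field_simps)
    then have "inverse x = qev (smult (- inverse a) p) x"
      by (simp only: qev_smult of_rat_minus of_rat_inverse mult.commute)
    then show ?thesis by (rule pCons.prems(1))
  qed
qed simp

text \<open>If \<open>b\<close> were a repeated root of \<open>m\<close>, it would be a multiple
  root of \<open>g\<close>, against the non-vanishing derivative; and a further factor of
  \<open>m\<close> can have no root other than \<open>b\<close>.\<close>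

lemma root_unique_imp_linear:
  fixes m g :: "complex poly"
  assumes m: "lead_coeff m = 1" "poly m b = 0" and uniq: "\<And>z. poly m z = 0 \<Longrightarrow> z = b"
    and dvd: "m dvd g" and simple: "poly (pderiv g) b \<noteq> 0"
  shows "m = [:-b, 1:]"
proof -
  obtain m1 where m1: "m = [:-b, 1:] * m1" using m by (auto simp: poly_eq_0_iff_dvd)
  then have lc: "lead_coeff m1 = 1" using m by (simp add: lead_coeff_mult del: mult_pCons_left)
  have "degree m1 = 0"
  proof (rule ccontr)
    assume "degree m1 \<noteq> 0"
    then have "\<not> constant (poly m1)" by (simp add: constant_degree)
    then obtain z where "poly m1 z = 0" using fundamental_theorem_of_algebra by blast
    moreover from this have "z = b" by (intro uniq) (simp add: m1)
    ultimately obtain m2 where "m1 = [:-b, 1:] * m2" by (auto simp: poly_eq_0_iff_dvd)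
    moreover from dvd obtain h where "g = m * h" by (rule dvdE)
    ultimately have "g = [:-b, 1:] * ([:-b, 1:] * (m2 * h))"
      by (simp only: m1 mult.assoc)
    then have "poly (pderiv g) b = 0"
      by (simp add: pderiv_mult pderiv_pCons del: mult_pCons_left)
    with simple show False ..
  qed
  then obtain a where "m1 = [:a:]" by (rule degree_eq_zeroE)
  with lc m1 show ?thesis by simp
qed

text \<open>The subfield is a set, not a type, so polynomial division is carried out by hand: a
  multiple of \<open>m\<close> cancels the leading term of \<open>u\<close>, and its coefficients
  remain in \<open>E\<close>.\<close>

lemma minimal_poly_dvd_over_subfield:
  fixes E :: "complex set"
  assumes E: "\<And>x y. x \<in> E \<Longrightarrow> y \<in> E \<Longrightarrow> x - y \<in> E" "\<And>x y. x \<in> E \<Longrightarrow> y \<in> E \<Longrightarrow> x * y \<in> E"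
      "\<And>x. x \<in> E \<Longrightarrow> inverse x \<in> E"
    and m: "m \<noteq> 0" "\<And>i. coeff m i \<in> E" "poly m b = 0"
    and min: "\<And>q. q \<noteq> 0 \<Longrightarrow> (\<And>i. coeff q i \<in> E) \<Longrightarrow> poly q b = 0 \<Longrightarrow> degree m \<le> degree q"
    and u: "\<And>i. coeff u i \<in> E" "poly u b = 0"
  shows "m dvd u"
  using u
proof (induction "degree u" arbitrary: u rule: less_induct)
  case less
  show ?case
  proof (cases "u = 0")
    case False
    with min less.prems have le: "degree m \<le> degree u" by blast
    define a where "a = lead_coeff u * inverse (lead_coeff m)"
    define t where "t = monom a (degree u - degree m) * m"
    have a: "a \<in> E" unfolding a_def using E less.prems m by blast
    have "a \<noteq> 0" using False m by (simp add: a_def)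
    have ct: "coeff t i = (if i < degree u - degree m then 0 else a * coeff m (i - (degree u - degree m)))"
      for i by (simp add: t_def coeff_monom_mult)
    have "0 \<in> E" using E(1)[of "coeff m 0" "coeff m 0"] m by simp
    then have "coeff (u - t) i \<in> E" for i using E a m less.prems by (simp add: ct)
    moreover have "poly (u - t) b = 0" using less.prems m by (simp add: t_def)
    moreover have "degree t = degree u"
      unfolding t_def using \<open>a \<noteq> 0\<close> m le by (subst degree_mult_eq) (auto simp: degree_monom_eq)
    moreover have "coeff t (degree u) = lead_coeff u"
      using le m by (simp add: ct a_def field_simps)
    ultimately have "m dvd (u - t)"
    proof (cases "u - t = 0")
      case False
      have "degree (u - t) \<le> degree u" by (rule degree_diff_le) (use \<open>degree t = degree u\<close> in auto)
      moreover have "degree (u - t) \<noteq> degree u"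
        using False \<open>coeff t (degree u) = lead_coeff u\<close>
        by (metis coeff_diff diff_self leading_coeff_0_iff)
      ultimately have "degree (u - t) < degree u" by simp
      with \<open>\<And>i. coeff (u - t) i \<in> E\<close> \<open>poly (u - t) b = 0\<close> show ?thesis using less.hyps by blast
    qed simp
    moreover have "m dvd t" by (simp add: t_def)
    ultimately have "m dvd (u - t) + t" by (rule dvd_add)
    then show ?thesis by simp
  qed simp
qed

text \<open>For \<open>c = a + n b\<close> with generic \<open>n\<close>, the number \<open>b\<close> is the only common root of its minimal
  polynomial and of \<open>f (c - n x)\<close>, where \<open>f\<close> annihilates \<open>a\<close>; so \<open>x - b\<close> is defined over \<open>\<rat>(c)\<close>.\<close>

lemma primitive_element_pair:
  fixes F :: "complex set"
  assumes F: "\<And>x y. x \<in> F \<Longrightarrow> y \<in> F \<Longrightarrow> x + y \<in> F" "\<And>q x. x \<in> F \<Longrightarrow> of_rat q * x \<in> F"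
      "\<And>p x. x \<in> F \<Longrightarrow> qev p x \<in> F"
    and alg: "\<And>x. x \<in> F \<Longrightarrow> \<exists>p. p \<noteq> 0 \<and> qev p x = 0"
    and ab: "a \<in> F" "b \<in> F"
  obtains c r r' where "c \<in> F" "a = qev r c" "b = qev r' c"
proof -
  from alg[OF ab(1)] obtain f where f: "f \<noteq> 0" "qev f a = 0" by blast
  from alg[OF ab(2)] obtain g where g: "g \<noteq> 0" "qev g b = 0"
    and gmin: "\<And>q. q \<noteq> 0 \<Longrightarrow> qev q b = 0 \<Longrightarrow> degree g \<le> degree q"
    using ex_has_least_nat[of "\<lambda>g. g \<noteq> 0 \<and> qev g b = 0" _ degree] by blast
  define fc gc where "fc = (map_poly of_rat f :: complex poly)" and "gc = (map_poly of_rat g :: complex poly)"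
  have fg: "poly fc x = qev f x" "poly gc x = qev g x" for x by (simp_all add: fc_def gc_def qev_def)
  have "fc \<noteq> 0" "gc \<noteq> 0" using f g by (auto simp: fc_def gc_def poly_eq_iff coeff_map_poly)
  then have fin: "finite {x. poly fc x = 0}" "finite {x. poly gc x = 0}" by (simp_all add: poly_roots_finite)
  \<comment> \<open>Separability from minimality of \<open>g\<close>: in characteristic zero the
    derivative is non-zero and has smaller degree, so it cannot vanish at \<open>b\<close>.\<close>
  have "poly (pderiv gc) b \<noteq> 0"
  proof
    assume "poly (pderiv gc) b = 0"
    moreover have "pderiv gc = map_poly of_rat (pderiv g)"
      by (rule poly_eqI) (simp add: gc_def coeff_map_poly coeff_pderiv of_rat_mult of_rat_add)
    ultimately have "qev (pderiv g) b = 0" by (simp add: qev_def)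
    moreover have "degree g \<noteq> 0"
    proof
      assume "degree g = 0"
      then obtain d where "g = [:d:]" by (rule degree_eq_zeroE)
      with g show False by simp
    qed
    moreover from this have "pderiv g \<noteq> 0" by (simp add: pderiv_eq_0_iff)
    ultimately show False using gmin[of "pderiv g"] by (simp add: degree_pderiv)
  qed
  \<comment> \<open>These quotients are the values of n for which c - n w = z with a root z of
    \<open>fc\<close> and a root w \<noteq> b of \<open>gc\<close>. The pairs with w = b contribute
    only the value 0 of a division by zero.\<close>
  define bad where "bad = (\<lambda>(z, w). (z - a) / (b - w)) ` ({x. poly fc x = 0} \<times> {x. poly gc x = 0})"
  have "finite bad" using fin by (simp add: bad_def)
  moreover have "infinite (range (of_nat :: nat \<Rightarrow> complex))"
    by (rule range_inj_infinite) (simp add: inj_on_def)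
  ultimately obtain n :: nat where n: "of_nat n \<notin> bad" by (meson finite_subset image_subsetI)
  define c where "c = a + of_nat n * b"
  have "c \<in> F" unfolding c_def using F(1)[OF ab(1) F(2)[OF ab(2), of "of_nat n"]] by simp
  define E where "E = range (\<lambda>p. qev p c)"
  have EI: "qev p c \<in> E" for p by (simp add: E_def)
  have E: "x - y \<in> E" "x + y \<in> E" "x * y \<in> E" if "x \<in> E" "y \<in> E" for x y
    using that by (auto simp: E_def simp flip: qev_diff qev_add qev_mult)
  have Erat: "of_rat q \<in> E" for q using EI[of "[:q:]"] by simp
  have "c \<in> E" using EI[of "[:0, 1:]"] by simp
  have "0 \<in> E" using Erat[of 0] by simp
  \<comment> \<open>\<open>c\<close> is algebraic, so the ring \<rat>[c] is closed under inverses
    and is the field \<rat>(c).\<close>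
  have Einv: "inverse x \<in> E" if "x \<in> E" for x
  proof (cases "x = 0")
    case False
    from that obtain p where p: "x = qev p c" by (auto simp: E_def)
    then have "x \<in> F" using F(3)[OF \<open>c \<in> F\<close>] by simp
    with alg obtain q where "q \<noteq> 0" "qev q x = 0" by blast
    then obtain r where "inverse x = qev r x" using False by (rule inverse_qev)
    then have "inverse x = qev (pcompose r p) c" by (simp add: qev_pcompose p)
    then show ?thesis using EI by simp
  qed (simp add: \<open>0 \<in> E\<close>)
  define P where "P q \<longleftrightarrow> q \<noteq> 0 \<and> (\<forall>i. coeff q i \<in> E) \<and> poly q b = 0" for q
  have gcE: "coeff gc i \<in> E" for i by (simp add: gc_def coeff_map_poly Erat)
  then have "P gc" using \<open>gc \<noteq> 0\<close> g by (simp add: P_def fg)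
  then obtain m0 where m0: "P m0" "\<And>q. P q \<Longrightarrow> degree m0 \<le> degree q"
    using ex_has_least_nat[of P _ degree] by blast
  define m where "m = smult (inverse (lead_coeff m0)) m0"
  have Pm: "P m" using m0(1) E Einv by (auto simp: m_def P_def)
  have min: "\<And>q. P q \<Longrightarrow> degree m \<le> degree q" using m0 by (auto simp: m_def P_def)
  have lc: "lead_coeff m = 1" using m0(1) by (simp add: m_def P_def)
  have m: "m \<noteq> 0" "coeff m i \<in> E" "poly m b = 0" for i using Pm by (auto simp: P_def)
  have min': "degree m \<le> degree q" if "q \<noteq> 0" "\<And>i. coeff q i \<in> E" "poly q b = 0" for q
    using min that by (simp add: P_def)
  have dvd: "m dvd u" if "\<And>i. coeff u i \<in> E" "poly u b = 0" for u
    using E(1,3) Einv m min' that by (rule minimal_poly_dvd_over_subfield)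
  \<comment> \<open>This is f(c - n x); it vanishes at \<open>b\<close> because c - n b = a, and its
    coefficients lie in \<rat>(c).\<close>
  define h where "h = pcompose fc [:c, - of_nat n:]"
  have closed_mult: "coeff (p * q) i \<in> E" if "\<And>i. coeff p i \<in> E" "\<And>i. coeff q i \<in> E" for p q i
  proof -
    have "sum f A \<in> E" if "\<And>x. x \<in> A \<Longrightarrow> f x \<in> E" for f :: "nat \<Rightarrow> complex" and A
      using that by (induction A rule: infinite_finite_induct) (auto intro!: E(2) \<open>0 \<in> E\<close>)
    note sum_closed = this
    show ?thesis unfolding coeff_mult by (intro sum_closed E(3) that)
  qed
  have "coeff (pcompose p [:c, - of_nat n:]) i \<in> E" if "\<And>i. coeff p i \<in> E" for p i
    using that
  proof (induction p arbitrary: i)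
    case (pCons x p)
    have "coeff p i \<in> E" for i using pCons.prems[of "Suc i"] by simp
    then have *: "coeff (pcompose p [:c, - of_nat n:]) i \<in> E" for i by (rule pCons.IH)
    have "- of_nat n \<in> E" using Erat[of "- of_nat n"] by (simp add: of_rat_minus)
    then have "coeff [:c, - of_nat n:] i \<in> E" for i using \<open>c \<in> E\<close> \<open>0 \<in> E\<close>
      by (auto simp: coeff_pCons split: nat.split)
    with * have "coeff ([:c, - of_nat n:] * pcompose p [:c, - of_nat n:]) i \<in> E" for i
      by (intro closed_mult)
    moreover have "coeff [:x:] i \<in> E" for i using pCons.prems[of 0] \<open>0 \<in> E\<close>
      by (auto simp: coeff_pCons split: nat.split)
    ultimately show ?case unfolding pcompose_pCons coeff_add by (intro E)
  qed (simp add: \<open>0 \<in> E\<close>)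
  then have hE: "coeff h i \<in> E" for i unfolding h_def by (simp add: fc_def coeff_map_poly Erat)
  have "poly h b = 0" using f by (simp add: h_def poly_pcompose c_def fg)
  have "m = [:- b, 1:]"
  proof (rule root_unique_imp_linear[OF lc])
    show "poly m b = 0" using Pm by (simp add: P_def)
    show "m dvd gc" using gcE g by (intro dvd) (auto simp: fg)
    fix z assume z: "poly m z = 0"
    have "m dvd h" using hE \<open>poly h b = 0\<close> by (rule dvd)
    with z have hz: "poly h z = 0" by (auto elim!: dvdE)
    from \<open>m dvd gc\<close> z have gz: "poly gc z = 0" by (auto elim!: dvdE)
    show "z = b"
    proof (rule ccontr)
      assume "z \<noteq> b"
      \<comment> \<open>A second common root \<open>z\<close> would exhibit \<open>n\<close> as one
        of the excluded quotients.\<close>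
      then have "of_nat n = (c - of_nat n * z - a) / (b - z)" by (simp add: c_def field_simps)
      moreover have "poly fc (c - of_nat n * z) = 0" using hz by (simp add: h_def poly_pcompose algebra_simps)
      ultimately have "of_nat n \<in> bad" unfolding bad_def using gz by force
      with n show False ..
    qed
  qed fact
  then have "b = 0 - coeff m 0" by simp
  moreover have "coeff m 0 \<in> E" using Pm by (simp add: P_def)
  ultimately have "b \<in> E" using E(1)[OF \<open>0 \<in> E\<close>] by metis
  have "of_nat n \<in> E" using Erat[of "of_nat n"] by simp
  then have "a \<in> E" using E(1)[OF \<open>c \<in> E\<close> E(3)[OF _ \<open>b \<in> E\<close>], of "of_nat n"] by (simp add: c_def)
  with \<open>b \<in> E\<close> \<open>c \<in> F\<close> show ?thesis using that unfolding E_def by blast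
qed

lemma qev_mem_span:
  assumes "F = rat_vec.span B" "1 \<in> F" "\<And>x y. x \<in> F \<Longrightarrow> y \<in> F \<Longrightarrow> x * y \<in> F" "x \<in> F"
  shows "qev p x \<in> F"
proof (induction p)
  case 0
  show ?case using assms(1) rat_vec.span_zero by simp
next
  case (pCons a p)
  have "of_rat a * 1 \<in> F" using assms(1,2) rat_vec.span_scale by blast
  with pCons assms show ?case by (auto intro: rat_vec.span_add)
qed

text \<open>Choose \<theta> so that \<rat>[\<theta>] has the largest dimension, which is bounded by
  \<open>card B\<close>. If some x were missing, the pair \<theta>, x would be generated by one
  element c, and \<rat>[c] would be strictly larger.\<close>

lemma primitive_element:
  assumes fin: "finite B" and F: "F = rat_vec.span B" "1 \<in> F"
    and mult: "\<And>x y. x \<in> F \<Longrightarrow> y \<in> F \<Longrightarrow> x * y \<in> F"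
  obtains \<theta> where "\<theta> \<in> F" "\<And>x. x \<in> F \<Longrightarrow> \<exists>p. x = qev p \<theta>"
proof -
  note qevF = qev_mem_span[OF F mult]
  have pow: "x ^ i \<in> F" if "x \<in> F" for x i
    by (induction i) (use that F mult in auto)
  have alg: "\<exists>p. p \<noteq> 0 \<and> qev p x = 0" if "x \<in> F" for x
    using algebraic_in_finite_span[OF fin, of x] pow[OF that] F by metis
  define V where "V x = range (\<lambda>p. qev p x)" for x
  have sub: "rat_vec.subspace (V x)" for x
    unfolding rat_vec.subspace_def V_def
    by (auto simp flip: qev_add qev_smult intro: range_eqI[of _ _ 0])
  have VF: "V x \<subseteq> F" if "x \<in> F" for x using qevF that by (auto simp: V_def)
  have le: "rat_vec.dim (V x) \<le> card B" if "x \<in> F" for x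
    using rat_vec.dim_le_card[of "V x" B] VF[OF that] F fin by auto
  have "\<exists>x. x \<in> F \<and> (\<forall>y. y \<in> F \<longrightarrow> rat_vec.dim (V y) \<le> rat_vec.dim (V x))"
    by (rule ex_has_greatest_nat[of _ 1 _ "Suc (card B)"]) (simp_all add: F(2) le less_Suc_eq_le)
  then obtain \<theta> where \<theta>: "\<theta> \<in> F" "\<And>x. x \<in> F \<Longrightarrow> rat_vec.dim (V x) \<le> rat_vec.dim (V \<theta>)"
    by blast
  have "x \<in> V \<theta>" if x: "x \<in> F" for x
  proof (rule ccontr)
    assume nx: "x \<notin> V \<theta>"
    obtain c r r' where c: "c \<in> F" "\<theta> = qev r c" "x = qev r' c"
    proof (rule primitive_element_pair[of F \<theta> x])
      show "y + z \<in> F" if "y \<in> F" "z \<in> F" for y z using that F rat_vec.span_add by blast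
      show "of_rat q * y \<in> F" if "y \<in> F" for y q using that F rat_vec.span_scale by blast
    qed (use qevF alg \<theta> x in auto)
    have sub': "V \<theta> \<subseteq> V c" by (auto simp: V_def c(2) simp flip: qev_pcompose)
    have "x \<in> V c" by (auto simp: V_def c(3))
    obtain A where A: "A \<subseteq> V \<theta>" "rat_vec.independent A" "V \<theta> \<subseteq> rat_vec.span A" "card A = rat_vec.dim (V \<theta>)"
      using rat_vec.basis_exists by blast
    obtain A' where A': "A' \<subseteq> V c" "rat_vec.independent A'" "V c \<subseteq> rat_vec.span A'" "card A' = rat_vec.dim (V c)"
      using rat_vec.basis_exists by blast
    have finA: "finite S" if "S \<subseteq> F" "rat_vec.independent S" for S
      using rat_vec.independent_span_bound[OF fin that(2)] that(1) F(1) by simp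
    have "finite A" "finite A'" 
      using finA A(1,2) A'(1,2) VF[OF \<theta>(1)] VF[OF c(1)] by (meson subset_trans)+
    have "rat_vec.span A \<subseteq> V \<theta>" using A(1) sub rat_vec.span_minimal by blast
    with nx have nxA: "x \<notin> rat_vec.span A" by blast
    then have ind: "rat_vec.independent (insert x A)" using A(2) rat_vec.independent_insertI by blast
    have "insert x A \<subseteq> rat_vec.span A'" using \<open>x \<in> V c\<close> A(1) A'(3) sub' by blast
    then have "card (insert x A) \<le> card A'"
      using rat_vec.independent_span_bound[OF \<open>finite A'\<close> ind] by blast
    moreover have "x \<notin> A" using nxA rat_vec.span_base by blast
    ultimately have "Suc (card A) \<le> card A'" using \<open>finite A\<close> by simp
    with A(4) A'(4) \<theta>(2)[OF c(1)] show False by simp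
  qed
  then show thesis by (intro that[OF \<theta>(1)]) (auto simp: V_def)
qed

section \<open>Conjugates of a primitive element and the embeddings they define\<close>

lemma qev_mod:
  assumes "qev p x = 0"
  shows "qev (q mod p) x = qev q x"
proof -
  have "qev q x = qev (p * (q div p) + q mod p) x" by simp
  then show ?thesis unfolding qev_add qev_mult assms by simp
qed

lemma minimal_poly_mod_eq_0:
  assumes p: "p \<noteq> 0" "qev p x = 0"
    and min: "\<And>q. q \<noteq> 0 \<Longrightarrow> qev q x = 0 \<Longrightarrow> degree p \<le> degree q"
    and q: "qev q x = 0"
  shows "q mod p = 0"
proof (rule ccontr)
  assume *: "q mod p \<noteq> 0"
  then have "degree (q mod p) < degree p" by (rule degree_mod_less'[OF p(1)])
  moreover have "degree p \<le> degree (q mod p)" using * by (rule min) (simp add: qev_mod p(2) q)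
  ultimately show False by simp
qed

text \<open>Suppose z is a common root of p and its derivative, with minimal polynomial m. Then p =
  m k, and \<theta> must be a root of m because k has too small a degree, so m has degree at least
  that of p. But m also annihilates a root of the derivative, so its degree is smaller.\<close>

lemma card_roots_minimal_poly:
  assumes p: "p \<noteq> 0" "qev p \<theta> = 0"
    and min: "\<And>q. q \<noteq> 0 \<Longrightarrow> qev q \<theta> = 0 \<Longrightarrow> degree p \<le> degree q"
  shows "card {z. qev p z = 0} = degree p"
proof -
  define pc where "pc = (map_poly of_rat p :: complex poly)"
  have pc: "poly pc z = qev p z" for z by (simp add: pc_def qev_def)
  have deg: "degree pc = degree p" unfolding pc_def by (rule degree_map_poly) simp
  have pd: "poly (pderiv pc) z = qev (pderiv p) z" for z
  proof -
    have "pderiv pc = map_poly of_rat (pderiv p)"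
      by (rule poly_eqI) (simp add: pc_def coeff_map_poly coeff_pderiv of_rat_mult of_rat_add)
    then show ?thesis by (simp add: qev_def)
  qed
  have "rsquarefree pc"
    unfolding rsquarefree_roots
  proof (intro allI notI, elim conjE)
    fix z assume z: "poly pc z = 0" "poly (pderiv pc) z = 0"
    obtain m where m: "m \<noteq> 0" "qev m z = 0"
      and mmin: "\<And>q. q \<noteq> 0 \<Longrightarrow> qev q z = 0 \<Longrightarrow> degree m \<le> degree q"
      using ex_has_least_nat[of "\<lambda>q. q \<noteq> 0 \<and> qev q z = 0" p degree] p(1) z(1) by (auto simp: pc)
    have dm: "degree m \<noteq> 0"
    proof
      assume "degree m = 0"
      then obtain a where "m = [:a:]" by (rule degree_eq_zeroE)
      with m show False by simp
    qed
    have "p mod m = 0" using m mmin z(1)[unfolded pc] by (rule minimal_poly_mod_eq_0)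
    then obtain k where k: "p = m * k" by (auto elim!: dvdE simp: mod_eq_0_iff_dvd)
    then have "k \<noteq> 0" using p by auto
    have dk: "degree p = degree m + degree k" using k m(1) \<open>k \<noteq> 0\<close> by (simp add: degree_mult_eq)
    have "qev m \<theta> * qev k \<theta> = 0" using p(2) by (simp add: k qev_mult)
    moreover have "qev k \<theta> \<noteq> 0" using min[OF \<open>k \<noteq> 0\<close>] dk dm by auto
    ultimately have "degree p \<le> degree m" using min m(1) by auto
    moreover have "degree m \<le> degree (pderiv p)"
    proof (rule mmin)
      show "pderiv p \<noteq> 0" using dk dm by (simp add: pderiv_eq_0_iff)
    qed (use z pd in auto)
    ultimately show False using dk dm by (simp add: degree_pderiv)
  qed
  from complex_poly_decompose_rsquarefree[OF this]
  have eq: "smult (lead_coeff pc) (\<Prod>z | poly pc z = 0. [:- z, 1:]) = pc" .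
  have "pc \<noteq> 0" using p by (auto simp: pc_def poly_eq_iff coeff_map_poly)
  have "degree (\<Prod>z | poly pc z = 0. [:- z, 1:]) = (\<Sum>z | poly pc z = 0. 1)"
    by (subst degree_prod_eq_sum_degree) auto
  then have "degree pc = card {z. poly pc z = 0}"
    using arg_cong[OF eq, of degree] \<open>pc \<noteq> 0\<close> by simp
  with deg show ?thesis by (simp add: pc)
qed

text \<open>Reduction modulo \<open>p\<close> shows that the powers of \<theta> below the degree
  span \<open>F\<close>; minimality of \<open>p\<close> makes them independent.\<close>

lemma degree_minimal_poly_eq_dim:
  assumes F: "\<And>x. x \<in> F \<longleftrightarrow> (\<exists>q. x = qev q \<theta>)"
    and p: "p \<noteq> 0" "qev p \<theta> = 0"
    and min: "\<And>q. q \<noteq> 0 \<Longrightarrow> qev q \<theta> = 0 \<Longrightarrow> degree p \<le> degree q"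
  shows "rat_vec.dim F = degree p"
proof -
  define n where "n = degree p"
  let ?A = "(\<lambda>i. \<theta> ^ i) ` {..<n}"
  have zero: "q = 0" if "qev q \<theta> = 0" "\<And>i. i \<ge> n \<Longrightarrow> coeff q i = 0" for q
  proof (rule ccontr)
    assume "q \<noteq> 0"
    moreover from this that(2) have "degree q < n"
      using leading_coeff_0_iff not_le by blast
    ultimately show False using min that(1) by (fastforce simp: n_def)
  qed
  have inj: "inj_on (\<lambda>i. \<theta> ^ i) {..<n}"
  proof (rule inj_onI)
    fix i j assume ij: "i \<in> {..<n}" "j \<in> {..<n}" "\<theta> ^ i = \<theta> ^ j"
    then have "monom 1 i - monom 1 j = (0 :: rat poly)"
      by (intro zero) (auto simp: qev_diff qev_monom)
    then have "coeff (monom 1 i) i = coeff (monom (1::rat) j) i" by simp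
    then show "i = j" by (simp split: if_splits)
  qed
  have "rat_vec.independent ?A"
  proof (rule rat_vec.independent_if_scalars_zero)
    fix f x assume f: "(\<Sum>x\<in>?A. of_rat (f x) * x) = 0" and x: "x \<in> ?A"
    let ?q = "\<Sum>i<n. monom (f (\<theta> ^ i)) i"
    have "?q = 0" using f inj by (intro zero) (auto simp: qev_sum qev_monom sum.reindex coeff_sum)
    from x obtain i where i: "i < n" "x = \<theta> ^ i" by blast
    then have "f x = coeff ?q i" by (simp add: coeff_sum)
    with \<open>?q = 0\<close> show "f x = 0" by (metis coeff_0)
  qed simp
  moreover have "rat_vec.span ?A = rat_vec.span F"
  proof (rule antisym)
    have "\<theta> ^ i \<in> F" for i using F by (metis mult_1 of_rat_1 qev_monom)
    then show "rat_vec.span ?A \<subseteq> rat_vec.span F" by (intro rat_vec.span_mono) auto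
    have "x \<in> rat_vec.span ?A" if x: "x \<in> F" for x
    proof -
      from x F obtain q where q: "x = qev q \<theta>" by blast
      have "x = qev (q mod p) \<theta>" by (simp add: q qev_mod p(2))
      also have "q mod p = (\<Sum>i<n. monom (coeff (q mod p) i) i)"
      proof (cases "q mod p = 0")
        case False
        then have "degree (q mod p) < n" using degree_mod_less[OF p(1), of q] by (simp add: n_def)
        then show ?thesis
          by (intro poly_eqI) (auto simp: coeff_sum coeff_eq_0)
      qed simp
      finally have "x = (\<Sum>i<n. of_rat (coeff (q mod p) i) * \<theta> ^ i)"
        by (simp add: qev_sum qev_monom)
      also have "\<dots> \<in> rat_vec.span ?A"
        by (rule rat_vec.span_sum, rule rat_vec.span_scale, rule rat_vec.span_base) auto
      finally show ?thesis .
    qed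
    then show "rat_vec.span F \<subseteq> rat_vec.span ?A"
      by (intro rat_vec.span_minimal rat_vec.subspace_span) auto
  qed
  ultimately have "rat_vec.dim F = card ?A" by (intro rat_vec.dim_eq_card)
  with inj show ?thesis by (simp add: card_image n_def)
qed

text \<open>\<open>Z\<close> is the set of roots of the minimal polynomial of \<theta>, and
  \<open>\<sigma> z\<close> sends q(\<theta>) to q(z). Each embedding is labelled by its value at
  \<theta>.\<close>

lemma number_field_embeddings:
  assumes fin: "finite B" and ind: "rat_vec.independent B" and F: "F = rat_vec.span B" "1 \<in> F"
    and mult: "\<And>x y. x \<in> F \<Longrightarrow> y \<in> F \<Longrightarrow> x * y \<in> F"
  obtains Z \<sigma> \<theta> where "finite Z" "card Z = card B" "\<theta> \<in> F" "\<And>z. \<sigma> z \<theta> = z"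
    "\<And>z x y. z \<in> Z \<Longrightarrow> x \<in> F \<Longrightarrow> y \<in> F \<Longrightarrow> \<sigma> z (x + y) = \<sigma> z x + \<sigma> z y"
    "\<And>z x y. z \<in> Z \<Longrightarrow> x \<in> F \<Longrightarrow> y \<in> F \<Longrightarrow> \<sigma> z (x * y) = \<sigma> z x * \<sigma> z y"
    "\<And>z q. z \<in> Z \<Longrightarrow> \<sigma> z (of_rat q) = of_rat q"
    "\<And>z. z \<in> Z \<Longrightarrow> cnj z \<in> Z" "\<And>z x. \<sigma> (cnj z) x = cnj (\<sigma> z x)"
proof -
  obtain \<theta> where \<theta>: "\<theta> \<in> F" "\<And>x. x \<in> F \<Longrightarrow> \<exists>p. x = qev p \<theta>"
    by (rule primitive_element[OF fin F]) (use mult in auto)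
  have qevF: "qev q \<theta> \<in> F" for q using F mult \<theta>(1) by (rule qev_mem_span)
  have "\<theta> ^ i \<in> rat_vec.span B" for i using qevF[of "monom 1 i"] F by (simp add: qev_monom)
  then obtain p0 where "p0 \<noteq> 0" "qev p0 \<theta> = 0" by (rule algebraic_in_finite_span[OF fin])
  then obtain p where p: "p \<noteq> 0" "qev p \<theta> = 0"
    and min: "\<And>q. q \<noteq> 0 \<Longrightarrow> qev q \<theta> = 0 \<Longrightarrow> degree p \<le> degree q"
    using ex_has_least_nat[of "\<lambda>q. q \<noteq> 0 \<and> qev q \<theta> = 0" p0 degree] by auto
  define Z where "Z = {z. qev p z = 0}"
  have memF: "x \<in> F \<longleftrightarrow> (\<exists>q. x = qev q \<theta>)" for x using qevF \<theta>(2) by auto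
  have dim: "rat_vec.dim F = degree p"
    using memF p min by (rule degree_minimal_poly_eq_dim)
  have "rat_vec.dim F = card B" using F ind by (simp add: rat_vec.dim_eq_card_independent)
  with dim have "degree p = card B" by simp
  have card: "card Z = degree p" unfolding Z_def using p min by (rule card_roots_minimal_poly)
  have "degree p \<noteq> 0"
  proof
    assume "degree p = 0"
    then obtain a where "p = [:a:]" by (rule degree_eq_zeroE)
    with p show False by simp
  qed
  then have "finite Z" using card card.infinite by fastforce
  \<comment> \<open>Well-definedness: polynomials with equal value at \<theta> differ by a multiple
    of the minimal polynomial, which also vanishes at \<open>z\<close>.\<close>
  have eq: "qev q z = qev q' z" if "z \<in> Z" "qev q \<theta> = qev q' \<theta>" for z q q'
  proof -
    define d where "d = q - q'"
    have "qev d \<theta> = 0" using that by (simp add: d_def qev_diff)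
    with p min have "d mod p = 0" by (rule minimal_poly_mod_eq_0)
    then have "qev d z = 0" using qev_mod[of p z d] that(1) by (simp add: Z_def)
    with that show ?thesis by (simp add: Z_def d_def qev_diff)
  qed
  \<comment> \<open>The polynomial chosen for \<open>x\<close> does not depend on \<open>z\<close>,
    so conjugation commutes with \<open>\<sigma>\<close> even where \<open>x\<close> is outside
    \<open>F\<close>; the special case at \<theta> makes \<open>\<sigma> z \<theta> = z\<close> hold
    for all \<open>z\<close>.\<close>
  define \<sigma> where "\<sigma> z x = (if x = \<theta> then z else qev (SOME q. qev q \<theta> = x) z)" for z x
  have \<sigma>: "\<sigma> z (qev q \<theta>) = qev q z" if "z \<in> Z" for z q
  proof (cases "qev q \<theta> = \<theta>")
    case True
    have "qev q z = qev [:0, 1:] z" by (rule eq[OF that]) (simp add: True)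
    with True show ?thesis by (simp add: \<sigma>_def)
  next
    case False
    then have "\<sigma> z (qev q \<theta>) = qev (SOME q'. qev q' \<theta> = qev q \<theta>) z" by (simp add: \<sigma>_def)
    also have "\<dots> = qev q z" by (rule eq[OF that someI[of "\<lambda>q'. qev q' \<theta> = qev q \<theta>"]]) simp
    finally show ?thesis .
  qed
  show thesis
  proof (rule that[of Z \<theta> \<sigma>])
    fix z x y assume z: "z \<in> Z" "x \<in> F" "y \<in> F"
    then obtain q q' where q: "x = qev q \<theta>" "y = qev q' \<theta>" using \<theta>(2) by metis
    show "\<sigma> z (x + y) = \<sigma> z x + \<sigma> z y"
      unfolding q qev_add[symmetric] \<sigma>[OF z(1)] by (simp add: qev_add)
    show "\<sigma> z (x * y) = \<sigma> z x * \<sigma> z y"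
      unfolding q qev_mult[symmetric] \<sigma>[OF z(1)] by (simp add: qev_mult)
  next
    fix z q assume "z \<in> Z"
    from \<sigma>[OF this, of "[:q:]"] show "\<sigma> z (of_rat q) = of_rat q" by simp
  qed (use \<open>finite Z\<close> card \<open>degree p = card B\<close> \<theta>(1) in \<open>auto simp: \<sigma>_def Z_def qev_cnj\<close>)
qed

section \<open>Units of an order in a purely imaginary number field\<close>

lemma index_mult_mat_sum:
  assumes "A \<in> carrier_mat n n" "B \<in> carrier_mat n n" "i < n" "k < n"
  shows "(A * B) $$ (i, k) = (\<Sum>j<n. A $$ (i, j) * B $$ (j, k))"
  using assms by (auto simp: scalar_prod_def lessThan_atLeast0 intro!: sum.cong)

text \<open>A trivial kernel gives a non-zero determinant, and the adjugate divided by it is the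
  inverse.\<close>

lemma nonsingular_obtains_inverse:
  fixes a :: "nat \<Rightarrow> nat \<Rightarrow> 'a :: field"
  assumes inj: "\<And>v. (\<And>i. i < n \<Longrightarrow> (\<Sum>j<n. a i j * v j) = 0) \<Longrightarrow> \<forall>j<n. v j = 0"
  obtains w where "\<And>i k. i < n \<Longrightarrow> k < n \<Longrightarrow> (\<Sum>j<n. a i j * w j k) = (if i = k then 1 else 0)"
    and "Determinant.det (Matrix.mat n n (\<lambda>(i, j). a i j)) \<noteq> 0"
proof -
  define A where "A = Matrix.mat n n (\<lambda>(i, j). a i j)"
  have A: "A \<in> carrier_mat n n" by (simp add: A_def)
  have "Determinant.det A \<noteq> 0"
  proof
    assume "Determinant.det A = 0"
    then obtain v where v: "v \<in> carrier_vec n" "v \<noteq> 0\<^sub>v n" "A *\<^sub>v v = 0\<^sub>v n"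
      using det_0_iff_vec_prod_zero_field[OF A] by blast
    have "(\<Sum>j<n. a i j * vec_index v j) = 0" if "i < n" for i
    proof -
      have "vec_index (A *\<^sub>v v) i = (\<Sum>j<n. a i j * vec_index v j)"
        using that v(1) by (auto simp: A_def scalar_prod_def lessThan_atLeast0 intro!: sum.cong)
      then show ?thesis using v(3) that by simp
    qed
    then have "\<forall>j<n. vec_index v j = 0" by (rule inj)
    then have "v = 0\<^sub>v n" using v(1) by (intro eq_vecI) auto
    with v(2) show False ..
  qed
  note adj = adj_mat[OF A]
  show thesis
  proof (rule that)
    fix i k assume ik: "i < n" "k < n"
    have "(\<Sum>j<n. a i j * (adj_mat A $$ (j, k) / Determinant.det A)) =
        (\<Sum>j<n. A $$ (i, j) * adj_mat A $$ (j, k)) / Determinant.det A"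
      using ik by (simp add: A_def sum_divide_distrib)
    also have "(\<Sum>j<n. A $$ (i, j) * adj_mat A $$ (j, k)) = (A * adj_mat A) $$ (i, k)"
      by (rule index_mult_mat_sum[symmetric]) (use A adj ik in auto)
    also have "\<dots> / Determinant.det A = (if i = k then 1 else 0)"
      unfolding adj(2) using ik \<open>Determinant.det A \<noteq> 0\<close> by simp
    finally show "(\<Sum>j<n. a i j * (adj_mat A $$ (j, k) / Determinant.det A)) = (if i = k then 1 else 0)" .
  qed (use \<open>Determinant.det A \<noteq> 0\<close> in \<open>simp add: A_def\<close>)
qed

text \<open>The hypothesis says that \<open>a\<close> diagonalises the integer matrix
  \<open>M\<close>: M a = a D with D the diagonal matrix of the \<open>l j\<close>. As
  \<open>a\<close> is invertible, the product of the \<open>l j\<close> is the integer det M, and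
  the adjugate of \<open>M\<close> is integral as well.\<close>

lemma prod_eigenvalues_adjugate:
  fixes a :: "nat \<Rightarrow> nat \<Rightarrow> complex" and M :: "nat \<Rightarrow> nat \<Rightarrow> int"
  assumes inj: "\<And>v. (\<And>i. i < n \<Longrightarrow> (\<Sum>j<n. a i j * v j) = 0) \<Longrightarrow> \<forall>j<n. v j = 0"
    and eig: "\<And>i j. i < n \<Longrightarrow> j < n \<Longrightarrow> (\<Sum>k<n. of_int (M i k) * a k j) = a i j * l j"
  obtains m :: int and adj where "of_int m = (\<Prod>j<n. l j)"
    "\<And>i k. i < n \<Longrightarrow> k < n \<Longrightarrow> (\<Sum>j<n. adj i j * M j k) = (if i = k then m else 0)"
proof -
  define A where "A = Matrix.mat n n (\<lambda>(i, j). a i j)"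
  define MM where "MM = Matrix.mat n n (\<lambda>(i, j). M i j)"
  define MC where "MC = map_mat (of_int :: int \<Rightarrow> complex) MM"
  define D where "D = Matrix.mat n n (\<lambda>(i, j). if i = j then l j else 0)"
  have car: "A \<in> carrier_mat n n" "MM \<in> carrier_mat n n" "MC \<in> carrier_mat n n" "D \<in> carrier_mat n n"
    by (simp_all add: A_def MM_def MC_def D_def)
  have nz: "Determinant.det A \<noteq> 0"
    unfolding A_def by (rule nonsingular_obtains_inverse[of n a]) (use inj in auto)
  have "MC * A = A * D"
  proof (rule eq_matI)
    fix i j assume "i < dim_row (A * D)" "j < dim_col (A * D)"
    then have ij: "i < n" "j < n" using car by auto
    have "(MC * A) $$ (i, j) = (\<Sum>k<n. MC $$ (i, k) * A $$ (k, j))"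
      by (rule index_mult_mat_sum) (use car ij in auto)
    also have "\<dots> = (\<Sum>k<n. of_int (M i k) * a k j)"
      using ij by (intro sum.cong) (auto simp: MC_def MM_def A_def)
    also have "\<dots> = a i j * l j" by (rule eig[OF ij])
    also have "\<dots> = (\<Sum>k<n. if k = j then a i j * l j else 0)" using ij by simp
    also have "\<dots> = (\<Sum>k<n. A $$ (i, k) * D $$ (k, j))"
      using ij by (intro sum.cong) (auto simp: A_def D_def)
    also have "\<dots> = (A * D) $$ (i, j)"
      by (rule index_mult_mat_sum[symmetric]) (use car ij in auto)
    finally show "(MC * A) $$ (i, j) = (A * D) $$ (i, j)" .
  qed (use car in auto)
  then have "Determinant.det MC * Determinant.det A = Determinant.det A * Determinant.det D"
    using det_mult[OF car(3,1)] det_mult[OF car(1,4)] by metis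
  then have "Determinant.det MC = Determinant.det D" using nz by simp
  also have "Determinant.det D = prod_list (diag_mat D)"
    by (rule det_upper_triangular) (use car in \<open>auto simp: D_def upper_triangular_def\<close>)
  also have "\<dots> = (\<Prod>j<n. l j)"
    unfolding prod_list_diag_prod using car by (auto simp: D_def lessThan_atLeast0 intro!: prod.cong)
  finally have "of_int (Determinant.det MM) = (\<Prod>j<n. l j)"
    unfolding MC_def by (simp add: of_int_hom.hom_det)
  moreover have "(\<Sum>j<n. adj_mat MM $$ (i, j) * M j k) = (if i = k then Determinant.det MM else 0)"
    if ik: "i < n" "k < n" for i k
  proof -
    have "(\<Sum>j<n. adj_mat MM $$ (i, j) * M j k) = (\<Sum>j<n. adj_mat MM $$ (i, j) * MM $$ (j, k))"
      using ik by (intro sum.cong) (auto simp: MM_def)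
    also have "\<dots> = (adj_mat MM * MM) $$ (i, k)"
      by (rule index_mult_mat_sum[symmetric]) (use car adj_mat[OF car(2)] ik in auto)
    also have "\<dots> = (if i = k then Determinant.det MM else 0)"
      unfolding adj_mat(3)[OF car(2)] using ik by simp
    finally show ?thesis .
  qed
  ultimately show thesis by (rule that)
qed

text \<open>\<open>Z\<close> labels the 2s embeddings \<open>\<sigma> z\<close>, which are
  constrained algebraically only on R. The element \<theta> is used only as a member of R that tells
  the embeddings apart. Total imaginarity enters through labels that are non-real and closed under
  conjugation.\<close>

locale imaginary_order =
  fixes R :: "complex set" and b :: "nat \<Rightarrow> complex" and s :: nat
    and Z :: "complex set" and \<sigma> :: "complex \<Rightarrow> complex \<Rightarrow> complex" and \<theta> :: complex
  assumes one_mem: "1 \<in> R"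
    and diff_mem: "x \<in> R \<Longrightarrow> y \<in> R \<Longrightarrow> x - y \<in> R"
    and mult_mem: "x \<in> R \<Longrightarrow> y \<in> R \<Longrightarrow> x * y \<in> R"
    and basis_mem: "i < 2 * s \<Longrightarrow> b i \<in> R"
    and basis_gen: "x \<in> R \<Longrightarrow> \<exists>c::nat \<Rightarrow> int. x = (\<Sum>i<2 * s. of_int (c i) * b i)"
    and finite_Z: "finite Z" and card_Z: "card Z = 2 * s"
    and emb_add: "z \<in> Z \<Longrightarrow> x \<in> R \<Longrightarrow> y \<in> R \<Longrightarrow> \<sigma> z (x + y) = \<sigma> z x + \<sigma> z y"
    and emb_mult: "z \<in> Z \<Longrightarrow> x \<in> R \<Longrightarrow> y \<in> R \<Longrightarrow> \<sigma> z (x * y) = \<sigma> z x * \<sigma> z y"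
    and emb_one: "z \<in> Z \<Longrightarrow> \<sigma> z 1 = 1"
    and emb_nonzero: "z \<in> Z \<Longrightarrow> x \<in> R \<Longrightarrow> x \<noteq> 0 \<Longrightarrow> \<sigma> z x \<noteq> 0"
    and cnj_mem: "z \<in> Z \<Longrightarrow> cnj z \<in> Z"
    and emb_cnj: "\<sigma> (cnj z) x = cnj (\<sigma> z x)"
    and nonreal: "z \<in> Z \<Longrightarrow> Im z \<noteq> 0"
    and theta_mem: "\<theta> \<in> R" and theta_inj: "inj_on (\<lambda>z. \<sigma> z \<theta>) Z"
    and unity: "x \<in> R \<Longrightarrow> n > 0 \<Longrightarrow> x ^ n = 1 \<Longrightarrow> x = 1 \<or> x = -1"
begin

lemma zero_mem: "0 \<in> R" using diff_mem[OF one_mem one_mem] by simp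

lemma uminus_mem: "x \<in> R \<Longrightarrow> - x \<in> R" using diff_mem[OF zero_mem] by simp

lemma add_mem: "x \<in> R \<Longrightarrow> y \<in> R \<Longrightarrow> x + y \<in> R" using diff_mem[OF _ uminus_mem] by fastforce

lemma sum_mem: "(\<And>i. i \<in> I \<Longrightarrow> f i \<in> R) \<Longrightarrow> sum f I \<in> R"
  by (induction I rule: infinite_finite_induct) (auto intro: zero_mem add_mem)

lemma power_mem: "x \<in> R \<Longrightarrow> x ^ k \<in> R"
  by (induction k) (auto intro: one_mem mult_mem)

lemma of_int_mem: "of_int n \<in> R"
  by (induction n rule: int_induct[where k = 0]) (auto intro: zero_mem one_mem add_mem diff_mem)

lemma int_comb_mem: "(\<Sum>i<2 * s. of_int (c i) * b i) \<in> R"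
  by (intro sum_mem mult_mem of_int_mem basis_mem) auto

context
  fixes z assumes z: "z \<in> Z"
begin

lemma emb_zero: "\<sigma> z 0 = 0" using emb_add[OF z zero_mem zero_mem] by simp

lemma emb_diff: "x \<in> R \<Longrightarrow> y \<in> R \<Longrightarrow> \<sigma> z (x - y) = \<sigma> z x - \<sigma> z y"
  using emb_add[OF z diff_mem[of x y], of y] by simp

lemma emb_sum: "(\<And>i. i \<in> I \<Longrightarrow> f i \<in> R) \<Longrightarrow> \<sigma> z (sum f I) = (\<Sum>i\<in>I. \<sigma> z (f i))"
  by (induction I rule: infinite_finite_induct) (auto simp: emb_zero emb_add[OF z] sum_mem)

lemma emb_power: "x \<in> R \<Longrightarrow> \<sigma> z (x ^ k) = \<sigma> z x ^ k"
  by (induction k) (auto simp: emb_one[OF z] emb_mult[OF z] power_mem)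

lemma emb_of_int: "\<sigma> z (of_int n) = of_int n"
  by (induction n rule: int_induct[where k = 0])
    (simp_all add: emb_zero emb_one[OF z] emb_add[OF z] emb_diff of_int_mem one_mem)

lemma emb_int_comb: "\<sigma> z (\<Sum>i<2 * s. of_int (c i) * b i) = (\<Sum>i<2 * s. of_int (c i) * \<sigma> z (b i))"
  by (subst emb_sum) (auto simp: emb_mult[OF z] emb_of_int of_int_mem basis_mem intro!: mult_mem)

end

text \<open>Independence of the embeddings: a relation on the \<open>b i\<close> extends to all of
  R, in particular to the powers of \<theta>, and so to every complex polynomial evaluated at the
  conjugates of \<theta>.\<close>

lemma emb_separating:
  assumes v: "\<And>i. i < 2 * s \<Longrightarrow> (\<Sum>z\<in>Z. \<sigma> z (b i) * v z) = 0" and z: "z \<in> Z"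
  shows "v z = 0"
proof -
  have R0: "(\<Sum>z\<in>Z. \<sigma> z x * v z) = 0" if "x \<in> R" for x
  proof -
    from basis_gen[OF that] obtain c :: "nat \<Rightarrow> int" where c: "x = (\<Sum>i<2 * s. of_int (c i) * b i)" ..
    have "(\<Sum>z\<in>Z. \<sigma> z x * v z) = (\<Sum>z\<in>Z. \<Sum>i<2 * s. of_int (c i) * (\<sigma> z (b i) * v z))"
      by (intro sum.cong) (simp_all add: c emb_int_comb sum_distrib_right mult.assoc)
    also have "\<dots> = (\<Sum>i<2 * s. of_int (c i) * (\<Sum>z\<in>Z. \<sigma> z (b i) * v z))"
      by (subst sum.swap) (simp add: sum_distrib_left)
    also have "\<dots> = 0" using v by simp
    finally show ?thesis .
  qed
  have poly0: "(\<Sum>z\<in>Z. poly p (\<sigma> z \<theta>) * v z) = 0" for p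
  proof -
    have "(\<Sum>z\<in>Z. poly p (\<sigma> z \<theta>) * v z) =
        (\<Sum>z\<in>Z. \<Sum>k\<le>degree p. coeff p k * (\<sigma> z (\<theta> ^ k) * v z))"
      by (intro sum.cong) (simp_all add: poly_altdef emb_power theta_mem sum_distrib_right mult.assoc)
    also have "\<dots> = (\<Sum>k\<le>degree p. coeff p k * (\<Sum>z\<in>Z. \<sigma> z (\<theta> ^ k) * v z))"
      by (subst sum.swap) (simp add: sum_distrib_left)
    also have "\<dots> = 0" by (simp add: R0 power_mem theta_mem)
    finally show ?thesis .
  qed
  \<comment> \<open>A Lagrange polynomial: it vanishes at every conjugate of \<theta> except the one
    belonging to \<open>z\<close>, and so isolates \<open>v z\<close>.\<close>
  define p where "p = (\<Prod>y\<in>Z - {z}. [:- \<sigma> y \<theta>, 1:])"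
  have "poly p (\<sigma> y \<theta>) = 0" if "y \<in> Z - {z}" for y
    unfolding p_def poly_prod by (rule prod_zero) (use finite_Z that in auto)
  then have "(\<Sum>y\<in>Z. poly p (\<sigma> y \<theta>) * v y) = poly p (\<sigma> z \<theta>) * v z"
    using z finite_Z by (subst sum.remove[of _ z]) auto
  moreover have "poly p (\<sigma> z \<theta>) \<noteq> 0"
    unfolding p_def poly_prod using finite_Z theta_inj z by (auto simp: inj_on_def)
  ultimately show ?thesis using poly0[of p] by simp
qed

lemma obtain_enumeration:
  obtains e where "bij_betw e {..<2 * s} Z"
    "\<And>v. (\<And>i. i < 2 * s \<Longrightarrow> (\<Sum>j<2 * s. \<sigma> (e j) (b i) * v j) = 0) \<Longrightarrow> \<forall>j<2 * s. v j = 0"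
proof -
  obtain e where e: "bij_betw e {..<2 * s} Z"
    using ex_bij_betw_nat_finite[OF finite_Z] card_Z by (metis lessThan_atLeast0)
  have inv: "inv_into {..<2 * s} e (e j) = j" if "j < 2 * s" for j
    using e that by (simp add: bij_betw_def inv_into_f_f)
  have "\<forall>j<2 * s. v j = 0"
    if v: "\<And>i. i < 2 * s \<Longrightarrow> (\<Sum>j<2 * s. \<sigma> (e j) (b i) * v j) = 0" for v
  proof (intro allI impI)
    fix j assume j: "j < 2 * s"
    have "(\<Sum>z\<in>Z. \<sigma> z (b i) * v (inv_into {..<2 * s} e z)) = 0" if "i < 2 * s" for i
      unfolding sum.reindex_bij_betw[OF e, symmetric] using v[OF that] by (simp add: inv)
    moreover have "e j \<in> Z" using e j by (auto simp: bij_betw_def)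
    ultimately have "v (inv_into {..<2 * s} e (e j)) = 0" by (rule emb_separating)
    with inv j show "v j = 0" by simp
  qed
  with e show thesis by (rule that)
qed

text \<open>The matrix of the values \<open>\<sigma> z (b i)\<close> is square, as there are 2s
  embeddings, and invertible by separation. Its inverse \<open>w\<close> plays the part of the
  trace-dual basis.\<close>

lemma obtain_dual:
  obtains w where "\<And>i k. i < 2 * s \<Longrightarrow> k < 2 * s \<Longrightarrow>
    (\<Sum>z\<in>Z. \<sigma> z (b i) * w z k) = (if i = k then 1 else 0)"
proof -
  obtain e where e: "bij_betw e {..<2 * s} Z"
    "\<And>v. (\<And>i. i < 2 * s \<Longrightarrow> (\<Sum>j<2 * s. \<sigma> (e j) (b i) * v j) = 0) \<Longrightarrow> \<forall>j<2 * s. v j = 0"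
    by (rule obtain_enumeration) blast
  obtain w where w: "\<And>i k. i < 2 * s \<Longrightarrow> k < 2 * s \<Longrightarrow>
      (\<Sum>j<2 * s. \<sigma> (e j) (b i) * w j k) = (if i = k then 1 else 0)"
    by (rule nonsingular_obtains_inverse[of "2 * s" "\<lambda>i j. \<sigma> (e j) (b i)"]) (use e(2) in auto)
  have inv: "inv_into {..<2 * s} e (e j) = j" if "j < 2 * s" for j
    using e(1) that by (simp add: bij_betw_def inv_into_f_f)
  show thesis
  proof (rule that)
    fix i k assume "i < 2 * s" "k < 2 * s"
    then show "(\<Sum>z\<in>Z. \<sigma> z (b i) * w (inv_into {..<2 * s} e z) k) = (if i = k then 1 else 0)"
      unfolding sum.reindex_bij_betw[OF e(1), symmetric] using w by (simp add: inv)
  qed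
qed

text \<open>Integer coordinates are fixed linear combinations of the conjugates. Hence they are
  unique, and bounded conjugates leave only finitely many elements of R.\<close>

lemma coordinates_via_embeddings:
  obtains w where "\<And>c k. k < 2 * s \<Longrightarrow>
    of_int (c k) = (\<Sum>z\<in>Z. \<sigma> z (\<Sum>i<2 * s. of_int (c i :: int) * b i) * w z k)"
proof -
  obtain w where w: "\<And>i k. i < 2 * s \<Longrightarrow> k < 2 * s \<Longrightarrow>
    (\<Sum>z\<in>Z. \<sigma> z (b i) * w z k) = (if i = k then 1 else 0)" by (rule obtain_dual) blast
  show thesis
  proof (rule that)
    fix c :: "nat \<Rightarrow> int" and k assume k: "k < 2 * s"
    have "(\<Sum>z\<in>Z. \<sigma> z (\<Sum>i<2 * s. of_int (c i) * b i) * w z k) =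
        (\<Sum>z\<in>Z. \<Sum>i<2 * s. of_int (c i) * (\<sigma> z (b i) * w z k))"
      by (intro sum.cong) (simp_all add: emb_int_comb sum_distrib_right mult.assoc)
    also have "\<dots> = (\<Sum>i<2 * s. of_int (c i) * (\<Sum>z\<in>Z. \<sigma> z (b i) * w z k))"
      by (subst sum.swap) (simp add: sum_distrib_left)
    also have "\<dots> = (\<Sum>i<2 * s. of_int (c i) * (if i = k then 1 else 0))"
      using w k by (intro sum.cong) auto
    also have "\<dots> = of_int (c k)" using k by (simp add: if_distrib[of "\<lambda>x. _ * x"] cong: if_cong)
    finally show "of_int (c k) = (\<Sum>z\<in>Z. \<sigma> z (\<Sum>i<2 * s. of_int (c i) * b i) * w z k)" ..
  qed
qed

lemma coordinates_unique:
  assumes "(\<Sum>i<2 * s. of_int (c i) * b i) = (\<Sum>i<2 * s. of_int (c' i) * b i)" "k < 2 * s"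
  shows "c k = (c' k :: int)"
proof -
  obtain w where w: "\<And>c k. k < 2 * s \<Longrightarrow>
    of_int (c k) = (\<Sum>z\<in>Z. \<sigma> z (\<Sum>i<2 * s. of_int (c i :: int) * b i) * w z k)"
    by (rule coordinates_via_embeddings) blast
  have "(of_int (c k) :: complex) = of_int (c' k)"
    using w[OF assms(2), of c] w[OF assms(2), of c'] unfolding assms(1) by simp
  then show ?thesis by simp
qed

lemma finite_bounded: "finite {x \<in> R. \<forall>z\<in>Z. cmod (\<sigma> z x) \<le> C}"
proof -
  obtain w where w: "\<And>c k. k < 2 * s \<Longrightarrow>
    of_int (c k) = (\<Sum>z\<in>Z. \<sigma> z (\<Sum>i<2 * s. of_int (c i :: int) * b i) * w z k)"
    by (rule coordinates_via_embeddings) blast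
  define K where "K = (\<Sum>k<2 * s. \<Sum>z\<in>Z. \<bar>C\<bar> * cmod (w z k))"
  have "{x \<in> R. \<forall>z\<in>Z. cmod (\<sigma> z x) \<le> C} \<subseteq>
      (\<lambda>c. \<Sum>i<2 * s. of_int (c i) * b i) ` (PiE {..<2 * s} (\<lambda>_. {- \<lceil>K\<rceil>..\<lceil>K\<rceil>}))"
  proof clarify
    fix x assume x: "x \<in> R" "\<forall>z\<in>Z. cmod (\<sigma> z x) \<le> C"
    from basis_gen[OF x(1)] obtain c :: "nat \<Rightarrow> int"
      where c: "x = (\<Sum>i<2 * s. of_int (c i) * b i)" ..
    have "\<bar>c k\<bar> \<le> \<lceil>K\<rceil>" if k: "k < 2 * s" for k
    proof -
      have "real_of_int \<bar>c k\<bar> = cmod (of_int (c k))" by simp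
      also have "\<dots> = cmod (\<Sum>z\<in>Z. \<sigma> z x * w z k)" using w[OF k, of c] c by simp
      also have "\<dots> \<le> (\<Sum>z\<in>Z. cmod (\<sigma> z x * w z k))" by (rule norm_sum)
      also have "\<dots> \<le> (\<Sum>z\<in>Z. \<bar>C\<bar> * cmod (w z k))"
        unfolding norm_mult using x(2) by (intro sum_mono mult_right_mono) force+
      also have "\<dots> \<le> K" unfolding K_def
        by (rule member_le_sum[where f = "\<lambda>k. \<Sum>z\<in>Z. \<bar>C\<bar> * cmod (w z k)"])
           (use k in \<open>auto intro!: sum_nonneg\<close>)
      finally show ?thesis by (simp add: le_ceiling_iff)
    qed
    then have "restrict c {..<2 * s} \<in> PiE {..<2 * s} (\<lambda>_. {- \<lceil>K\<rceil>..\<lceil>K\<rceil>})"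
      by (intro restrict_PiE_iff[THEN iffD2] ballI) (auto simp: abs_le_iff minus_le_iff)
    moreover have "x = (\<Sum>i<2 * s. of_int (restrict c {..<2 * s} i) * b i)" by (simp add: c)
    ultimately show "x \<in> (\<lambda>c. \<Sum>i<2 * s. of_int (c i) * b i) `
        (PiE {..<2 * s} (\<lambda>_. {- \<lceil>K\<rceil>..\<lceil>K\<rceil>}))"
      by (intro image_eqI[where x = "restrict c {..<2 * s}"])
  qed
  moreover have "finite (PiE {..<2 * s} (\<lambda>_. {- \<lceil>K\<rceil>..\<lceil>K\<rceil>}))" by (intro finite_PiE) auto
  ultimately show ?thesis using finite_surj by blast
qed

text \<open>Multiplication by \<open>y\<close> has an integer matrix in the basis \<open>b\<close>,
  and the embeddings diagonalise it with eigenvalues the conjugates of \<open>y\<close>. Its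
  determinant is the norm; the adjugate provides the cofactor \<open>y'\<close> in R.\<close>

lemma norm_int:
  assumes y: "y \<in> R"
  obtains m :: int and y' where "y' \<in> R" "of_int m = (\<Prod>z\<in>Z. \<sigma> z y)" "of_int m = y * y'"
proof -
  obtain e where e: "bij_betw e {..<2 * s} Z"
    and sep: "\<And>v. (\<And>i. i < 2 * s \<Longrightarrow> (\<Sum>j<2 * s. \<sigma> (e j) (b i) * v j) = 0) \<Longrightarrow> \<forall>j<2 * s. v j = 0"
    by (rule obtain_enumeration) blast
  have eZ: "e j \<in> Z" if "j < 2 * s" for j using e that by (auto simp: bij_betw_def)
  have "\<forall>i. \<exists>c::nat \<Rightarrow> int. i < 2 * s \<longrightarrow> y * b i = (\<Sum>k<2 * s. of_int (c k) * b k)"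
    using basis_gen[OF mult_mem[OF y basis_mem]] by blast
  then obtain M :: "nat \<Rightarrow> nat \<Rightarrow> int"
    where M: "\<And>i. i < 2 * s \<Longrightarrow> y * b i = (\<Sum>k<2 * s. of_int (M i k) * b k)" by metis
  obtain m adj where m: "of_int m = (\<Prod>j<2 * s. \<sigma> (e j) y)"
    and adj: "\<And>i k. i < 2 * s \<Longrightarrow> k < 2 * s \<Longrightarrow>
      (\<Sum>j<2 * s. adj i j * M j k) = (if i = k then m else 0)"
  proof (rule prod_eigenvalues_adjugate[of "2 * s" "\<lambda>i j. \<sigma> (e j) (b i)" M "\<lambda>j. \<sigma> (e j) y"])
    fix i j assume ij: "i < 2 * s" "j < 2 * s"
    have "(\<Sum>k<2 * s. of_int (M i k) * \<sigma> (e j) (b k)) = \<sigma> (e j) (y * b i)"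
      unfolding M[OF ij(1)] by (rule emb_int_comb[OF eZ[OF ij(2)], symmetric])
    also have "\<dots> = \<sigma> (e j) (b i) * \<sigma> (e j) y"
      using emb_mult[OF eZ[OF ij(2)] y basis_mem[OF ij(1)]] by simp
    finally show "(\<Sum>k<2 * s. of_int (M i k) * \<sigma> (e j) (b k)) = \<sigma> (e j) (b i) * \<sigma> (e j) y" .
  qed (use sep in auto)
  from basis_gen[OF one_mem] obtain t :: "nat \<Rightarrow> int"
    where t: "1 = (\<Sum>i<2 * s. of_int (t i) * b i)" ..
  \<comment> \<open>Row \<open>i\<close> of the adjugate gives an element whose product with
    \<open>y\<close> is \<open>m * b i\<close>. Combining these with the coordinates of 1 gives an
    element whose product with \<open>y\<close> is \<open>m\<close>.\<close>
  define u where "u i = (\<Sum>j<2 * s. of_int (adj i j) * b j)" for i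
  have yu: "y * u i = of_int m * b i" if i: "i < 2 * s" for i
  proof -
    have "y * u i = (\<Sum>j<2 * s. of_int (adj i j) * (y * b j))"
      by (simp add: u_def sum_distrib_left algebra_simps)
    also have "\<dots> = (\<Sum>j<2 * s. \<Sum>k<2 * s. of_int (adj i j * M j k) * b k)"
      by (intro sum.cong) (simp_all add: M sum_distrib_left mult.assoc)
    also have "\<dots> = (\<Sum>k<2 * s. of_int (\<Sum>j<2 * s. adj i j * M j k) * b k)"
      by (subst sum.swap) (simp add: sum_distrib_right)
    also have "\<dots> = (\<Sum>k<2 * s. if i = k then of_int m * b i else 0)"
      using adj i by (intro sum.cong) auto
    also have "\<dots> = of_int m * b i" using i by simp
    finally show ?thesis .
  qed
  define y' where "y' = (\<Sum>i<2 * s. of_int (t i) * u i)"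
  have "y' \<in> R" unfolding y'_def u_def by (intro sum_mem mult_mem of_int_mem int_comb_mem)
  moreover have "of_int m = (\<Prod>z\<in>Z. \<sigma> z y)"
    unfolding m by (rule prod.reindex_bij_betw[OF e])
  moreover have "y * y' = of_int m"
  proof -
    have "y * y' = (\<Sum>i<2 * s. of_int (t i) * (y * u i))"
      by (simp add: y'_def sum_distrib_left algebra_simps)
    also have "\<dots> = of_int m * (\<Sum>i<2 * s. of_int (t i) * b i)"
      by (simp add: yu sum_distrib_left algebra_simps)
    finally show ?thesis using t by simp
  qed
  ultimately show thesis using that by metis
qed

end

section \<open>Places, units and the logarithmic embedding\<close>

context imaginary_order
begin

text \<open>One embedding from each conjugate pair, selected by the sign of the imaginary part of
  its label.\<close>

definition places :: "complex set" where "places = {z \<in> Z. Im z > 0}"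

definition units :: "complex set" where "units = {x \<in> R. \<exists>y\<in>R. x * y = 1}"

lemma finite_places [simp]: "finite places" using finite_Z by (simp add: places_def)

lemma places_Z: "z \<in> places \<Longrightarrow> z \<in> Z" by (simp add: places_def)

lemma Z_eq: "Z = places \<union> cnj ` places"
proof (intro equalityI subsetI)
  fix z assume z: "z \<in> Z"
  show "z \<in> places \<union> cnj ` places"
  proof (cases "Im z > 0")
    case False
    then have "cnj z \<in> places" using z nonreal[OF z] cnj_mem[OF z] by (simp add: places_def)
    then have "cnj (cnj z) \<in> cnj ` places" by (rule imageI)
    then show ?thesis by simp
  qed (simp add: places_def z)
qed (auto simp: places_def cnj_mem)

lemma places_disjoint: "places \<inter> cnj ` places = {}"
  by (auto simp: places_def)

lemma card_places: "card places = s"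
proof -
  have "card Z = card places + card (cnj ` places)"
    by (subst Z_eq, rule card_Un_disjoint) (simp_all add: places_disjoint)
  also have "card (cnj ` places) = card places"
    by (rule card_image) (auto simp: inj_on_def)
  finally show ?thesis using card_Z by simp
qed

lemma cmod_prod_emb: "cmod (\<Prod>z\<in>Z. \<sigma> z x) = (\<Prod>z\<in>places. cmod (\<sigma> z x)) ^ 2"
proof -
  have "cmod (\<Prod>z\<in>Z. \<sigma> z x) = (\<Prod>z\<in>places \<union> cnj ` places. cmod (\<sigma> z x))"
    by (simp add: prod_norm[symmetric] flip: Z_eq)
  also have "\<dots> = (\<Prod>z\<in>places. cmod (\<sigma> z x)) * (\<Prod>z\<in>cnj ` places. cmod (\<sigma> z x))"
    by (rule prod.union_disjoint) (simp_all add: places_disjoint)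
  also have "(\<Prod>z\<in>cnj ` places. cmod (\<sigma> z x)) = (\<Prod>z\<in>places. cmod (\<sigma> z x))"
    by (subst prod.reindex) (auto simp: inj_on_def emb_cnj)
  finally show ?thesis by (simp add: power2_eq_square)
qed

text \<open>The product over the places is the square root of the absolute value of the norm, a
  non-zero integer.\<close>

lemma prod_places_ge_1:
  assumes "x \<in> R" "x \<noteq> 0"
  shows "(\<Prod>z\<in>places. cmod (\<sigma> z x)) \<ge> 1"
proof -
  obtain m :: int and y where m: "of_int m = (\<Prod>z\<in>Z. \<sigma> z x)"
    using norm_int[OF assms(1)] by metis
  have "(\<Prod>z\<in>Z. \<sigma> z x) \<noteq> 0" using finite_Z emb_nonzero assms by auto
  with m have "m \<noteq> 0" by auto
  then have "1 \<le> real_of_int \<bar>m\<bar>" by simp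
  also have "\<dots> = cmod (of_int m)" by simp
  also have "\<dots> = (\<Prod>z\<in>places. cmod (\<sigma> z x)) ^ 2" unfolding m by (rule cmod_prod_emb)
  finally have "1 ^ 2 \<le> (\<Prod>z\<in>places. cmod (\<sigma> z x)) ^ 2" by simp
  then show ?thesis by (rule power2_le_imp_le) (simp add: prod_nonneg)
qed

lemma units_R: "u \<in> units \<Longrightarrow> u \<in> R" and units_nonzero: "u \<in> units \<Longrightarrow> u \<noteq> 0"
  by (auto simp: units_def)

lemma units_mult: "u \<in> units \<Longrightarrow> v \<in> units \<Longrightarrow> u * v \<in> units"
proof -
  assume "u \<in> units" "v \<in> units"
  then obtain u' v' where *: "u \<in> R" "v \<in> R" "u' \<in> R" "v' \<in> R" "u * u' = 1" "v * v' = 1"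
    by (auto simp: units_def)
  then have "(u * v) * (u' * v') = 1" by (metis mult.assoc mult.commute mult_1)
  with * show ?thesis unfolding units_def by (blast intro: mult_mem)
qed

lemma units_one: "1 \<in> units" using one_mem by (force simp: units_def)

lemma units_inverse: "u \<in> units \<Longrightarrow> inverse u \<in> units"
proof -
  assume "u \<in> units"
  then obtain v where v: "u \<in> R" "v \<in> R" "u * v = 1" by (auto simp: units_def)
  then have "inverse u = v" by (metis inverse_unique)
  with v show ?thesis by (auto simp: units_def mult.commute)
qed

lemma units_power: "u \<in> units \<Longrightarrow> u ^ n \<in> units"
  by (induction n) (simp_all add: units_one units_mult)

lemma units_powi: "u \<in> units \<Longrightarrow> u powi n \<in> units"
  by (auto simp: power_int_def units_power units_inverse simp flip: power_inverse)

lemma emb_inverse: "z \<in> Z \<Longrightarrow> u \<in> units \<Longrightarrow> \<sigma> z (inverse u) = inverse (\<sigma> z u)"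
proof -
  assume z: "z \<in> Z" and u: "u \<in> units"
  have "\<sigma> z u * \<sigma> z (inverse u) = \<sigma> z (u * inverse u)"
    using emb_mult[OF z] u units_inverse[OF u] by (simp add: units_R)
  also have "\<dots> = 1" using units_nonzero[OF u] emb_one[OF z] by simp
  finally show ?thesis by (simp add: inverse_unique)
qed

lemma emb_pos: "z \<in> Z \<Longrightarrow> u \<in> units \<Longrightarrow> cmod (\<sigma> z u) > 0"
  using emb_nonzero units_R units_nonzero by simp

text \<open>The customary factor 2 at complex places is omitted: all places are complex, so it would
  only rescale the whole picture.\<close>

definition log_emb :: "complex \<Rightarrow> complex \<Rightarrow> real" where
  "log_emb u z = ln (cmod (\<sigma> z u))"

lemma log_emb_mult:
  "z \<in> Z \<Longrightarrow> u \<in> units \<Longrightarrow> v \<in> units \<Longrightarrow> log_emb (u * v) z = log_emb u z + log_emb v z"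
  unfolding log_emb_def using emb_pos[of z u] emb_pos[of z v]
  by (simp add: emb_mult units_R norm_mult ln_mult)

lemma log_emb_inverse: "z \<in> Z \<Longrightarrow> u \<in> units \<Longrightarrow> log_emb (inverse u) z = - log_emb u z"
  unfolding log_emb_def using emb_pos[of z u] by (simp add: emb_inverse norm_inverse ln_inverse)

lemma log_emb_one: "z \<in> Z \<Longrightarrow> log_emb 1 z = 0"
  by (simp add: log_emb_def emb_one)

text \<open>The sum is non-negative for every unit, and passing to the inverse changes its
  sign.\<close>

lemma log_emb_sum: assumes u: "u \<in> units" shows "(\<Sum>z\<in>places. log_emb u z) = 0"
proof -
  have sum: "(\<Sum>z\<in>places. log_emb v z) = ln (\<Prod>z\<in>places. cmod (\<sigma> z v))" if "v \<in> units" for v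
    unfolding log_emb_def by (rule ln_prod[symmetric]) (use emb_pos that places_Z in auto)
  have ge: "(\<Sum>z\<in>places. log_emb v z) \<ge> 0" if "v \<in> units" for v
    unfolding sum[OF that] using prod_places_ge_1[of v] that by (intro ln_ge_zero) (auto simp: units_R units_nonzero)
  have "(\<Sum>z\<in>places. log_emb (inverse u) z) = - (\<Sum>z\<in>places. log_emb u z)"
    using u by (simp add: log_emb_inverse places_Z sum_negf)
  with ge[OF u] ge[OF units_inverse[OF u]] show ?thesis by simp
qed

text \<open>The pigeonhole principle replaces Minkowski's convex body theorem.\<close>

lemma small_element:
  obtains C where "C > 0" "\<And>t. (\<And>z. z \<in> places \<Longrightarrow> t z > 0) \<Longrightarrow> (\<Prod>z\<in>places. t z) = 1 \<Longrightarrow>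
    \<exists>x\<in>R. x \<noteq> 0 \<and> (\<forall>z\<in>places. cmod (\<sigma> z x) \<le> C * t z)"
proof -
  \<comment> \<open>\<open>B\<close> depends on the basis alone, which makes the final constant
    independent of \<open>t\<close>. The added 1 turns the later estimate into a strict one.\<close>
  define B where "B = (\<Sum>z\<in>Z. \<Sum>i<2 * s. cmod (\<sigma> z (b i))) + 1"
  have B1: "B \<ge> 1" unfolding B_def by (simp add: sum_nonneg)
  show thesis
  proof (rule that)
    \<comment> \<open>The 8 collects three factors 2: the interval length
      \<open>2 * (M * B)\<close>, the sum of real and imaginary part, and the rounding in
      \<open>k z\<close>.\<close>
    show "8 * B > 0" using B1 by simp
  next
    fix t :: "complex \<Rightarrow> real"
    assume t: "\<And>z. z \<in> places \<Longrightarrow> t z > 0" and t1: "(\<Prod>z\<in>places. t z) = 1"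
    \<comment> \<open>\<open>M\<close> is at least every \<open>t z\<close>, so
      \<open>M / t z\<close> is at least 1 and rounding it down loses at most a factor 2.\<close>
    define M :: nat where "M = nat \<lceil>\<Sum>z\<in>places. t z\<rceil> + 1"
    have tM: "t z \<le> M" if "z \<in> places" for z
    proof -
      have "t z \<le> (\<Sum>z\<in>places. t z)"
        by (rule member_le_sum) (use that t in \<open>auto intro: less_imp_le\<close>)
      also have "\<dots> \<le> M" unfolding M_def by linarith
      finally show ?thesis .
    qed
    have M0: "real M > 0" by (simp add: M_def)
    define k where "k z = nat \<lfloor>M / t z\<rfloor>" for z
    have k: "real (k z) \<le> M / t z" "M / t z \<le> 2 * real (k z)" "k z > 0" if "z \<in> places" for z
    proof -
      have "1 \<le> M / t z" using t[OF that] tM[OF that] by simp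
      then have "\<lfloor>M / t z\<rfloor> \<ge> 1" by simp
      then have "real (k z) = of_int \<lfloor>M / t z\<rfloor>" by (simp add: k_def)
      with \<open>\<lfloor>M / t z\<rfloor> \<ge> 1\<close> show "real (k z) \<le> M / t z" "M / t z \<le> 2 * real (k z)" "k z > 0"
        by linarith+
    qed
    define pt where "pt c = (\<Sum>i<2 * s. of_int (c i) * b i)" for c :: "nat \<Rightarrow> int"
    define A where "A = PiE {..<2 * s} (\<lambda>_. {0..int M})"
    \<comment> \<open>The index of the subinterval containing \<open>r\<close> when the interval
      from \<open>- (M * B)\<close> to \<open>M * B\<close> is cut into \<open>k z\<close> equal
      pieces. Cutting real and imaginary parts gives \<open>k z * k z\<close> squares at the place
      \<open>z\<close>.\<close>
    define cell where "cell z r = nat \<lfloor>(r + M * B) * k z / (2 * (M * B))\<rfloor>" for z and r :: real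
    define f where "f c = (\<lambda>z\<in>places. (cell z (Re (\<sigma> z (pt c))), cell z (Im (\<sigma> z (pt c)))))" for c
    have MB: "real M * B > 0" using M0 B1 by simp
    have bound: "cmod (\<sigma> z (pt c)) < M * B" if z: "z \<in> Z" and c: "c \<in> A" for z c
    proof -
      have "cmod (\<sigma> z (pt c)) = cmod (\<Sum>i<2 * s. of_int (c i) * \<sigma> z (b i))"
        unfolding pt_def by (simp add: emb_int_comb[OF z])
      also have "\<dots> \<le> (\<Sum>i<2 * s. cmod (of_int (c i) * \<sigma> z (b i)))" by (rule norm_sum)
      also have "\<dots> \<le> (\<Sum>i<2 * s. M * cmod (\<sigma> z (b i)))"
      proof (rule sum_mono)
        fix i assume "i \<in> {..<2 * s}"
        then have "c i \<in> {0..int M}" using c by (auto simp: A_def PiE_iff)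
        then have "cmod (of_int (c i)) \<le> M" by (simp add: abs_le_iff)
        then show "cmod (of_int (c i) * \<sigma> z (b i)) \<le> M * cmod (\<sigma> z (b i))"
          unfolding norm_mult by (rule mult_right_mono) simp
      qed
      also have "\<dots> = M * (\<Sum>i<2 * s. cmod (\<sigma> z (b i)))" by (simp add: sum_distrib_left)
      also have "\<dots> \<le> M * (B - 1)"
        unfolding B_def using z finite_Z
        by (intro mult_left_mono)
           (auto intro!: member_le_sum[where f = "\<lambda>z. \<Sum>i<2 * s. cmod (\<sigma> z (b i))"] sum_nonneg)
      also have "\<dots> < M * B" using M0 by (simp add: algebra_simps)
      finally show ?thesis .
    qed
    have cell_nonneg: "(r + M * B) * k z / (2 * (M * B)) \<ge> 0" if "\<bar>r\<bar> < M * B" for z r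
    proof -
      have "r + M * B \<ge> 0" using that by linarith
      then show ?thesis using MB by simp
    qed
    have cell_less: "cell z r < k z" if z: "z \<in> places" and r: "\<bar>r\<bar> < M * B" for z r
    proof -
      have "r + M * B < 2 * (M * B)" using r by linarith
      then have "(r + M * B) * k z < 2 * (M * B) * k z"
        using k(3)[OF z] by (intro mult_strict_right_mono) auto
      then have "(r + M * B) * k z / (2 * (M * B)) < k z" using MB by (simp add: field_simps)
      moreover have "(r + M * B) * k z / (2 * (M * B)) \<ge> 0" using r by (rule cell_nonneg)
      ultimately show ?thesis unfolding cell_def by linarith
    qed
    have close: "\<bar>r - r'\<bar> \<le> 2 * (M * B) / k z"
      if z: "z \<in> places" and r: "\<bar>r\<bar> < M * B" "\<bar>r'\<bar> < M * B" and eq: "cell z r = cell z r'" for z r r'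
    proof -
      have "(r + M * B) * k z / (2 * (M * B)) \<ge> 0" "(r' + M * B) * k z / (2 * (M * B)) \<ge> 0"
        using r by (simp_all only: cell_nonneg)
      then have "\<bar>(r + M * B) * k z / (2 * (M * B)) - (r' + M * B) * k z / (2 * (M * B))\<bar> \<le> 1"
        using eq unfolding cell_def by linarith
      also have "(r + M * B) * k z / (2 * (M * B)) - (r' + M * B) * k z / (2 * (M * B)) =
          (r - r') * (k z / (2 * (M * B)))"
        by (simp add: algebra_simps add_divide_distrib diff_divide_distrib)
      finally have "\<bar>r - r'\<bar> * (k z / (2 * (M * B))) \<le> 1" using B1 by (simp add: abs_mult)
      then show ?thesis using MB k(3)[OF z] by (simp add: field_simps)
    qed
    have comp: "\<bar>Re w\<bar> < M * B" "\<bar>Im w\<bar> < M * B" if "cmod w < M * B" for w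
      using that abs_Re_le_cmod[of w] abs_Im_le_cmod[of w] by linarith+
    have "\<not> inj_on f A"
    proof
      assume inj: "inj_on f A"
      have sub: "f ` A \<subseteq> PiE places (\<lambda>z. {..<k z} \<times> {..<k z})"
        using cell_less comp bound places_Z by (auto simp: f_def)
      have fin: "finite (PiE places (\<lambda>z. {..<k z} \<times> {..<k z}))" by (intro finite_PiE) auto
      have "card A \<le> card (PiE places (\<lambda>z. {..<k z} \<times> {..<k z}))"
        using card_mono[OF fin sub] card_image[OF inj] by simp
      also have "\<dots> = (\<Prod>z\<in>places. k z * k z)" by (simp add: card_PiE)
      finally have "(M + 1) ^ (2 * s) \<le> (\<Prod>z\<in>places. k z * k z)"
        by (simp add: A_def card_PiE nat_add_distrib)
      \<comment> \<open>The count behind the pigeonhole: as \<open>t\<close> has product 1, there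
        are at most \<open>M ^ (2 * s)\<close> cells, against \<open>(M + 1) ^ (2 * s)\<close>
        coefficient vectors.\<close>
      then have "real ((M + 1) ^ (2 * s)) \<le> real (\<Prod>z\<in>places. k z * k z)" by (rule of_nat_mono)
      also have "\<dots> = (\<Prod>z\<in>places. real (k z) * real (k z))" by simp
      also have "\<dots> \<le> (\<Prod>z\<in>places. (M / t z) * (M / t z))"
        using k(1) t by (intro prod_mono conjI mult_mono) (auto intro!: divide_nonneg_pos)
      also have "\<dots> = real M ^ (2 * s)"
        by (simp add: prod_dividef prod.distrib t1 card_places power_mult_distrib flip: mult_2 power_add)
      finally have "(M + 1) ^ (2 * s) \<le> M ^ (2 * s)" by (simp only: of_nat_le_iff flip: of_nat_power)
      moreover have "s > 0"
      proof (rule ccontr)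
        assume "\<not> s > 0"
        with basis_gen[OF one_mem] show False by simp
      qed
      ultimately show False using power_strict_mono[of M "M + 1" "2 * s"] by simp
    qed
    then obtain c c' where c: "c \<in> A" "c' \<in> A" "c \<noteq> c'" "f c = f c'" by (auto simp: inj_on_def)
    define x where "x = pt c - pt c'"
    have ptR: "pt c \<in> R" for c unfolding pt_def by (rule int_comb_mem)
    have "x \<noteq> 0"
    proof
      assume "x = 0"
      then have "c i = c' i" if "i < 2 * s" for i
        using coordinates_unique[of c c' i] that by (simp add: x_def pt_def)
      with c show False by (auto simp: A_def intro: PiE_ext)
    qed
    moreover have "cmod (\<sigma> z x) \<le> 8 * B * t z" if z: "z \<in> places" for z
    proof -
      have zZ: "z \<in> Z" using z by (rule places_Z)
      from fun_cong[OF c(4), of z] z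
      have "cell z (Re (\<sigma> z (pt c))) = cell z (Re (\<sigma> z (pt c')))"
        "cell z (Im (\<sigma> z (pt c))) = cell z (Im (\<sigma> z (pt c')))" by (simp_all add: f_def)
      note close[OF z comp(1)[OF bound[OF zZ c(1)]] comp(1)[OF bound[OF zZ c(2)]] this(1)]
        close[OF z comp(2)[OF bound[OF zZ c(1)]] comp(2)[OF bound[OF zZ c(2)]] this(2)]
      then have "\<bar>Re (\<sigma> z x)\<bar> \<le> 2 * (M * B) / k z" "\<bar>Im (\<sigma> z x)\<bar> \<le> 2 * (M * B) / k z"
        by (simp_all add: x_def emb_diff[OF zZ ptR ptR])
      then have "cmod (\<sigma> z x) \<le> 2 * (M * B) / k z + 2 * (M * B) / k z"
        using cmod_le[of "\<sigma> z x"] by linarith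
      also have "\<dots> = 4 * (M * B) / k z" by simp
      also have "\<dots> \<le> 8 * B * t z"
      proof -
        have "M \<le> 2 * k z * t z" using k(2)[OF z] t[OF z] by (simp add: field_simps)
        then have "(4 * B) * M \<le> (4 * B) * (2 * k z * t z)" using B1 by (intro mult_left_mono) auto
        then show ?thesis using k(3)[OF z] by (simp add: field_simps)
      qed
      finally show ?thesis .
    qed
    moreover have "x \<in> R" unfolding x_def by (intro diff_mem ptR)
    ultimately show "\<exists>x\<in>R. x \<noteq> 0 \<and> (\<forall>z\<in>places. cmod (\<sigma> z x) \<le> 8 * B * t z)" by blast
  qed
qed

text \<open>Elements with the same norm \<open>m\<close> and congruent modulo \<open>m\<close> are associated, because
  \<open>m\<close> is a multiple of each of them.\<close>

lemma finite_norm_classes: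
  obtains Y where "finite Y" "Y \<subseteq> R - {0}"
    "\<And>x. x \<in> R \<Longrightarrow> x \<noteq> 0 \<Longrightarrow> cmod (\<Prod>z\<in>Z. \<sigma> z x) \<le> K \<Longrightarrow> \<exists>y\<in>Y. \<exists>u\<in>units. x = u * y"
proof -
  define A where "A = {x \<in> R. x \<noteq> 0 \<and> cmod (\<Prod>z\<in>Z. \<sigma> z x) \<le> K}"
  have "\<forall>x. \<exists>m::int. x \<in> R \<longrightarrow> (of_int m = (\<Prod>z\<in>Z. \<sigma> z x) \<and> (\<exists>x'\<in>R. of_int m = x * x'))"
    using norm_int by metis
  then obtain m :: "complex \<Rightarrow> int" where m: "\<And>x. x \<in> R \<Longrightarrow> of_int (m x) = (\<Prod>z\<in>Z. \<sigma> z x)"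
    "\<And>x. x \<in> R \<Longrightarrow> \<exists>x'\<in>R. of_int (m x) = x * x'" by metis
  have "\<forall>x. \<exists>c::nat \<Rightarrow> int. x \<in> R \<longrightarrow> x = (\<Sum>i<2 * s. of_int (c i) * b i)"
    using basis_gen by blast
  then obtain c :: "complex \<Rightarrow> nat \<Rightarrow> int"
    where c: "\<And>x. x \<in> R \<Longrightarrow> x = (\<Sum>i<2 * s. of_int (c x i) * b i)" by metis
  have m0: "m x \<noteq> 0" if "x \<in> A" for x
  proof -
    have "(\<Prod>z\<in>Z. \<sigma> z x) \<noteq> 0" using finite_Z emb_nonzero that by (auto simp: A_def)
    then show ?thesis using m(1)[of x] that by (auto simp: A_def)
  qed
  have mK: "\<bar>m x\<bar> \<le> \<lceil>K\<rceil>" if "x \<in> A" for x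
  proof -
    have "real_of_int \<bar>m x\<bar> = cmod (of_int (m x))" by simp
    also have "\<dots> \<le> K" using that m(1)[of x] by (simp add: A_def)
    finally show ?thesis by (simp add: le_ceiling_iff)
  qed
  \<comment> \<open>Coordinates are reduced modulo the norm of the element itself; recording the
    norm too ensures that equal values of \<open>f\<close> refer to the same modulus.\<close>
  define f where "f x = (m x, \<lambda>i\<in>{..<2 * s}. c x i mod m x)" for x
  have "f ` A \<subseteq> {- \<lceil>K\<rceil>..\<lceil>K\<rceil>} \<times> PiE {..<2 * s} (\<lambda>_. {- \<lceil>K\<rceil>..\<lceil>K\<rceil>})"
  proof (rule image_subsetI)
    fix x assume x: "x \<in> A"
    have "\<bar>c x i mod m x\<bar> \<le> \<bar>m x\<bar>" for i using abs_mod_less[OF m0[OF x]] by (simp add: less_imp_le)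
    then have "\<bar>c x i mod m x\<bar> \<le> \<lceil>K\<rceil>" for i using mK[OF x] by (rule order_trans)
    then have ci: "c x i mod m x \<in> {- \<lceil>K\<rceil>..\<lceil>K\<rceil>}" for i
      unfolding atLeastAtMost_iff abs_le_iff by (metis minus_le_iff)
    have mi: "m x \<in> {- \<lceil>K\<rceil>..\<lceil>K\<rceil>}"
      using mK[OF x] unfolding atLeastAtMost_iff abs_le_iff by linarith
    show "f x \<in> {- \<lceil>K\<rceil>..\<lceil>K\<rceil>} \<times> PiE {..<2 * s} (\<lambda>_. {- \<lceil>K\<rceil>..\<lceil>K\<rceil>})"
      unfolding f_def by (intro SigmaI mi restrict_PiE_iff[THEN iffD2] ballI ci)
  qed
  then have fin: "finite (f ` A)" by (rule finite_subset) (intro finite_cartesian_product finite_PiE, auto)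
  define Y where "Y = inv_into A f ` (f ` A)"
  have dvd: "\<exists>u\<in>R. x = y * u" if x: "x \<in> A" and y: "y \<in> A" and eq: "f x = f y" for x y
  proof -
    have R: "x \<in> R" "y \<in> R" using x y by (auto simp: A_def)
    have mm: "m x = m y" using eq by (simp add: f_def)
    have "(c x i - c y i) mod m y = 0" if "i < 2 * s" for i
    proof -
      have "c x i mod m y = c y i mod m y"
        using fun_cong[OF arg_cong[OF eq, of snd], of i] that mm by (simp add: f_def)
      then show ?thesis by (simp add: mod_eq_dvd_iff)
    qed
    then have dv: "c x i - c y i = m y * ((c x i - c y i) div m y)" if "i < 2 * s" for i
      using that by (metis add.right_neutral mult_div_mod_eq)
    \<comment> \<open>\<open>x - y\<close> equals \<open>m y * w\<close>, and \<open>y\<close>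
      divides \<open>m y\<close>; hence \<open>y\<close> divides \<open>x\<close>.\<close>
    define w where "w = (\<Sum>i<2 * s. of_int ((c x i - c y i) div m y) * b i)"
    have wR: "w \<in> R" unfolding w_def by (rule int_comb_mem)
    obtain y' where y': "y' \<in> R" "of_int (m y) = y * y'" using m(2)[OF R(2)] by blast
    have "x - y = (\<Sum>i<2 * s. of_int (c x i) * b i) - (\<Sum>i<2 * s. of_int (c y i) * b i)"
      by (rule arg_cong2[where f = minus, OF c[OF R(1)] c[OF R(2)]])
    also have "\<dots> = (\<Sum>i<2 * s. of_int (c x i - c y i) * b i)"
      by (simp add: sum_subtractf algebra_simps)
    also have "\<dots> = (\<Sum>i<2 * s. of_int (m y) * (of_int ((c x i - c y i) div m y) * b i))"
      by (intro sum.cong refl) (metis dv lessThan_iff mult.assoc of_int_mult)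
    also have "\<dots> = of_int (m y) * w" by (simp add: w_def sum_distrib_left)
    finally have "x = y * (1 + y' * w)" unfolding y' by (simp add: algebra_simps)
    moreover have "1 + y' * w \<in> R" by (intro add_mem one_mem mult_mem y' wR)
    ultimately show ?thesis by blast
  qed
  show thesis
  proof (rule that)
    show "finite Y" using fin by (simp add: Y_def)
    show "Y \<subseteq> R - {0}" unfolding Y_def using inv_into_into[of _ f A] by (fastforce simp: A_def)
    fix x assume "x \<in> R" "x \<noteq> 0" "cmod (\<Prod>z\<in>Z. \<sigma> z x) \<le> K"
    then have x: "x \<in> A" by (simp add: A_def)
    define y where "y = inv_into A f (f x)"
    have y: "y \<in> A" "f y = f x" "y \<in> Y"
      using x by (auto simp: y_def Y_def inv_into_into f_inv_into_f)
    obtain u where u: "u \<in> R" "x = y * u" using dvd[OF x y(1)] y(2) by metis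
    obtain v where v: "v \<in> R" "y = x * v" using dvd[OF y(1) x] y(2) by metis
    \<comment> \<open>Divisibility holds in both directions, so the two quotients are inverse to
      each other.\<close>
    have "x * (v * u) = x * 1" using u v by (metis mult.assoc mult_1_right)
    then have "u * v = 1" using x by (simp add: A_def mult.commute)
    then have "u \<in> units" using u v by (auto simp: units_def)
    moreover have "x = u * y" using u(2) by (simp only: mult.commute)
    ultimately show "\<exists>y\<in>Y. \<exists>u\<in>units. x = u * y" using y(3) by blast
  qed
qed

text \<open>Exponentiating \<open>t\<close> gives weights of product 1, hence a small element x
  whose norm is bounded independently of \<open>t\<close>. It is a unit times one of finitely many
  elements, so the logarithms of that unit exceed \<open>t\<close> by at most a constant; the
  sum-zero relation turns these upper bounds into lower bounds.\<close>

lemma log_emb_relatively_dense: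
  obtains E where "\<And>t. (\<Sum>z\<in>places. t z) = 0 \<Longrightarrow> \<exists>u\<in>units. \<forall>z\<in>places. \<bar>log_emb u z - t z\<bar> \<le> E"
proof -
  obtain C where C: "C > 0" "\<And>t. (\<And>z. z \<in> places \<Longrightarrow> t z > 0) \<Longrightarrow> (\<Prod>z\<in>places. t z) = 1 \<Longrightarrow>
    \<exists>x\<in>R. x \<noteq> 0 \<and> (\<forall>z\<in>places. cmod (\<sigma> z x) \<le> C * t z)" by (rule small_element) blast
  obtain Y where Y: "finite Y" "Y \<subseteq> R - {0}"
    "\<And>x. x \<in> R \<Longrightarrow> x \<noteq> 0 \<Longrightarrow> cmod (\<Prod>z\<in>Z. \<sigma> z x) \<le> (C ^ s) ^ 2 \<Longrightarrow> \<exists>y\<in>Y. \<exists>u\<in>units. x = u * y"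
    by (rule finite_norm_classes) blast
  \<comment> \<open>The allowance for the constant of the small element and for the logarithms of
    the finitely many representatives.\<close>
  define D where "D = \<bar>ln C\<bar> + (\<Sum>y\<in>Y. \<Sum>z\<in>places. \<bar>log_emb y z\<bar>)"
  have D0: "D \<ge> 0" unfolding D_def by (intro add_nonneg_nonneg sum_nonneg) auto
  show thesis
  proof (rule that)
    fix t :: "complex \<Rightarrow> real" assume t: "(\<Sum>z\<in>places. t z) = 0"
    have "(\<Prod>z\<in>places. exp (t z)) = 1" using t by (simp flip: exp_sum)
    with C(2)[of "\<lambda>z. exp (t z)"] obtain x where x: "x \<in> R" "x \<noteq> 0"
      "\<And>z. z \<in> places \<Longrightarrow> cmod (\<sigma> z x) \<le> C * exp (t z)" by auto
    have "(\<Prod>z\<in>places. cmod (\<sigma> z x)) \<le> (\<Prod>z\<in>places. C * exp (t z))"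
      using x(3) by (intro prod_mono) auto
    also have "\<dots> = C ^ s" using t by (simp add: prod.distrib card_places flip: exp_sum)
    finally have "cmod (\<Prod>z\<in>Z. \<sigma> z x) \<le> (C ^ s) ^ 2"
      unfolding cmod_prod_emb by (intro power_mono prod_nonneg) auto
    with Y(3)[OF x(1,2)] obtain y u where yu: "y \<in> Y" "u \<in> units" "x = u * y" by blast
    have yR: "y \<in> R" "y \<noteq> 0" using yu Y(2) by auto
    have upper: "log_emb u z - t z \<le> D" if z: "z \<in> places" for z
    proof -
      have zZ: "z \<in> Z" using z by (rule places_Z)
      have pos: "cmod (\<sigma> z y) > 0" "cmod (\<sigma> z u) > 0"
        using emb_nonzero[OF zZ yR] emb_pos[OF zZ yu(2)] by simp_all
      have "log_emb u z + log_emb y z = ln (cmod (\<sigma> z x))"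
        using pos by (simp add: log_emb_def yu(3) emb_mult[OF zZ units_R[OF yu(2)] yR(1)] norm_mult ln_mult)
      also have "\<dots> \<le> ln (C * exp (t z))"
        using x(3)[OF z] emb_nonzero[OF zZ x(1,2)] by (intro ln_mono) auto
      also have "\<dots> = ln C + t z" using C(1) by (simp add: ln_mult)
      finally have "log_emb u z - t z \<le> \<bar>ln C\<bar> + \<bar>log_emb y z\<bar>" by linarith
      also have "\<bar>log_emb y z\<bar> \<le> (\<Sum>z\<in>places. \<bar>log_emb y z\<bar>)"
        by (rule member_le_sum) (use z in auto)
      also have "\<dots> \<le> (\<Sum>y\<in>Y. \<Sum>z\<in>places. \<bar>log_emb y z\<bar>)"
        by (rule member_le_sum[where f = "\<lambda>y. \<Sum>z\<in>places. \<bar>log_emb y z\<bar>"])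
           (use yu Y(1) in \<open>auto intro!: sum_nonneg\<close>)
      finally show ?thesis unfolding D_def by simp
    qed
    \<comment> \<open>The deviations sum to zero and each of the others is at most
      \<open>D\<close>.\<close>
    have lower: "- (s * D) \<le> log_emb u z - t z" if z: "z \<in> places" for z
    proof -
      have "0 = (\<Sum>z\<in>places. log_emb u z - t z)" by (simp add: sum_subtractf t log_emb_sum[OF yu(2)])
      also have "\<dots> = (log_emb u z - t z) + (\<Sum>z\<in>places - {z}. log_emb u z - t z)"
        by (rule sum.remove) (use z in auto)
      also have "(\<Sum>z\<in>places - {z}. log_emb u z - t z) \<le> of_nat (card (places - {z})) * D"
        by (rule sum_bounded_above) (use upper in auto)
      also have "\<dots> \<le> s * D"
        using D0 card_mono[of places "places - {z}"] card_places by (intro mult_right_mono) auto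
      finally show ?thesis by linarith
    qed
    have "\<bar>log_emb u z - t z\<bar> \<le> D + s * D" if "z \<in> places" for z
      using upper[OF that] lower[OF that] D0 mult_nonneg_nonneg[of "real s" D]
      unfolding abs_le_iff by linarith
    then show "\<exists>u\<in>units. \<forall>z\<in>places. \<bar>log_emb u z - t z\<bar> \<le> D + s * D" using yu(2) by blast
  qed
qed

end

section \<open>Fundamental units and the structure of the unit group\<close>

context imaginary_order
begin

lemma s_pos: "s > 0"
proof (rule ccontr)
  assume "\<not> s > 0"
  with basis_gen[OF one_mem] show False by simp
qed

text \<open>Kronecker's argument: all powers of \<open>u\<close> have conjugates of absolute value
  1, so they form a finite set, two of them coincide, and \<open>u\<close> is a root of
  unity.\<close>

lemma unit_bounded_powers:
  assumes u: "u \<in> units" and abs1: "\<And>z. z \<in> places \<Longrightarrow> log_emb u z = 0"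
  shows "u = 1 \<or> u = -1"
proof -
  have abs_places: "cmod (\<sigma> z u) = 1" if "z \<in> places" for z
    using abs1[OF that] emb_pos[OF places_Z[OF that] u] by (simp add: log_emb_def)
  have abs: "cmod (\<sigma> z u) = 1" if "z \<in> Z" for z
    using that abs_places by (subst (asm) Z_eq) (auto simp: emb_cnj)
  have "range (\<lambda>n. u ^ n) \<subseteq> {x \<in> R. \<forall>z\<in>Z. cmod (\<sigma> z x) \<le> 1}"
    using u abs by (auto simp: emb_power power_mem units_R norm_power)
  then have "finite (range (\<lambda>n. u ^ n))" using finite_bounded finite_subset by blast
  then have "\<not> inj (\<lambda>n::nat. u ^ n)" using finite_imageD by blast
  then obtain i j :: nat where "u ^ i = u ^ j" "i < j"
    unfolding inj_def by (metis linorder_neqE_nat)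
  then have "u ^ i * u ^ (j - i) = u ^ i * 1"
    by (metis le_add_diff_inverse less_imp_le mult_1_right power_add)
  then have "u ^ (j - i) = 1" using units_nonzero[OF u] by simp
  then show ?thesis using unity[OF units_R[OF u], of "j - i"] \<open>i < j\<close> by simp
qed

lemma units_prod: "(\<And>k. k \<in> I \<Longrightarrow> f k \<in> units) \<Longrightarrow> prod f I \<in> units"
  by (induction I rule: infinite_finite_induct) (simp_all add: units_one units_mult)

context
  fixes z assumes z: "z \<in> Z"
begin

lemma log_emb_power: "u \<in> units \<Longrightarrow> log_emb (u ^ n) z = of_nat n * log_emb u z"
  by (induction n) (simp_all add: log_emb_one[OF z] log_emb_mult[OF z] units_power algebra_simps)

lemma log_emb_powi: "u \<in> units \<Longrightarrow> log_emb (u powi n) z = of_int n * log_emb u z"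
  by (cases "n \<ge> 0")
    (simp_all add: power_int_def log_emb_power units_inverse log_emb_inverse[OF z])

lemma log_emb_prod:
  "(\<And>k. k \<in> I \<Longrightarrow> f k \<in> units) \<Longrightarrow> log_emb (prod f I) z = (\<Sum>k\<in>I. log_emb (f k) z)"
  by (induction I rule: infinite_finite_induct)
    (simp_all add: log_emb_one[OF z] log_emb_mult[OF z] units_prod)

lemma log_emb_prod_powi:
  "(\<And>k. k < r \<Longrightarrow> \<epsilon> k \<in> units) \<Longrightarrow>
    log_emb (\<Prod>k<(r::nat). \<epsilon> k powi n k) z = (\<Sum>k<r. of_int (n k) * log_emb (\<epsilon> k) z)"
  by (subst log_emb_prod) (auto simp: units_powi log_emb_powi intro!: sum.cong)

end

text \<open>One place \<open>z0\<close> is dropped, since the sum-zero relation recovers its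
  coordinate; on the remaining s - 1 places the logarithms form a discrete relatively dense group,
  hence one of rank s - 1. The statement compares logarithms only, because they determine a unit up
  to sign.\<close>

lemma fundamental_units:
  obtains \<epsilon> where "\<And>k. k < s - 1 \<Longrightarrow> \<epsilon> k \<in> units"
    "\<And>u. u \<in> units \<Longrightarrow> \<exists>n :: nat \<Rightarrow> int. \<forall>z\<in>places.
        log_emb u z = log_emb (\<Prod>k<s - 1. \<epsilon> k powi n k) z"
    "\<And>n k. (\<And>z. z \<in> places \<Longrightarrow> log_emb (\<Prod>k<s - 1. \<epsilon> k powi n k) z = 0) \<Longrightarrow> k < s - 1 \<Longrightarrow> n k = 0"
proof -
  obtain z0 where z0: "z0 \<in> places" using s_pos card_places by (metis card.empty equals0I less_irrefl)
  define I where "I = places - {z0}"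
  have finI: "finite I" by (simp add: I_def)
  have cI: "card I = s - 1" using z0 by (simp add: I_def card_places)
  have IZ: "z \<in> Z" if "z \<in> I" for z using that places_Z by (simp add: I_def)
  have z0_eq: "log_emb u z0 = - (\<Sum>z\<in>I. log_emb u z)" if "u \<in> units" for u
    using log_emb_sum[OF that] sum.remove[OF finite_places z0, of "log_emb u"] by (simp add: I_def)
  have ext: "\<forall>z\<in>places. log_emb u z = log_emb v z"
    if "u \<in> units" "v \<in> units" "\<And>z. z \<in> I \<Longrightarrow> log_emb u z = log_emb v z" for u v
  proof
    fix z assume "z \<in> places"
    show "log_emb u z = log_emb v z"
    proof (cases "z = z0")
      case True
      then show ?thesis using that by (simp add: z0_eq)
    qed (use that \<open>z \<in> places\<close> in \<open>simp add: I_def\<close>)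
  qed
  define L where "L u = (\<lambda>z. if z \<in> I then log_emb u z else 0)" for u
  have "\<exists>r g. int_basis (L ` units) r g \<and> (relatively_dense I (L ` units) \<longrightarrow> r = card I)"
  proof (rule discrete_subgroup_basis[OF finI])
    have "L 1 = (\<lambda>_. 0)" by (auto simp: L_def log_emb_one IZ)
    then show "(\<lambda>_. 0) \<in> L ` units" using units_one by force
    show "(\<lambda>i. x i - y i) \<in> L ` units" if xy: "x \<in> L ` units" "y \<in> L ` units" for x y
    proof -
      from xy obtain u v where uv: "u \<in> units" "v \<in> units" "x = L u" "y = L v" by blast
      then have "(\<lambda>i. x i - y i) = L (u * inverse v)"
        by (auto simp: L_def log_emb_mult units_inverse log_emb_inverse IZ)
      moreover have "u * inverse v \<in> units" using uv by (intro units_mult units_inverse)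
      ultimately show ?thesis by (rule image_eqI)
    qed
    show "x i = 0" if "x \<in> L ` units" "i \<notin> I" for x i using that by (auto simp: L_def)
    show "finite {x \<in> L ` units. \<forall>i\<in>I. \<bar>x i\<bar> \<le> C}" for C
    proof -
      \<comment> \<open>Upper bounds at all places suffice for finiteness; the bound at the dropped
        place \<open>z0\<close> is the sum of the other bounds.\<close>
      define C' where "C' = \<bar>C\<bar> + card I * \<bar>C\<bar>"
      have "{x \<in> L ` units. \<forall>i\<in>I. \<bar>x i\<bar> \<le> C} \<subseteq> L ` {x \<in> R. \<forall>z\<in>Z. cmod (\<sigma> z x) \<le> exp C'}"
      proof (clarify intro!: imageI)
        fix u assume u: "u \<in> units" and *: "\<forall>i\<in>I. \<bar>L u i\<bar> \<le> C"
        have leI: "\<bar>log_emb u z\<bar> \<le> \<bar>C\<bar>" if "z \<in> I" for z using * that by (force simp: L_def)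
        have le: "log_emb u z \<le> C'" if z: "z \<in> places" for z
        proof (cases "z = z0")
          case True
          have "\<bar>log_emb u z\<bar> \<le> (\<Sum>z\<in>I. \<bar>log_emb u z\<bar>)" unfolding True z0_eq[OF u] by simp
          also have "\<dots> \<le> card I * \<bar>C\<bar>" by (rule sum_bounded_above) (rule leI)
          finally show ?thesis by (simp add: C'_def)
        next
          case False
          then have "\<bar>log_emb u z\<bar> \<le> \<bar>C\<bar>" using z by (intro leI) (simp add: I_def)
          moreover have "0 \<le> card I * \<bar>C\<bar>" by simp
          ultimately show ?thesis unfolding C'_def by linarith
        qed
        have "cmod (\<sigma> z u) \<le> exp C'" if z: "z \<in> places" for z
        proof -
          have "cmod (\<sigma> z u) = exp (log_emb u z)"
            using emb_pos[OF places_Z[OF z] u] by (simp add: log_emb_def)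
          then show ?thesis using le[OF z] by simp
        qed
        then have "\<forall>z\<in>Z. cmod (\<sigma> z u) \<le> exp C'" by (subst Z_eq) (auto simp: emb_cnj)
        then show "u \<in> R \<and> (\<forall>z\<in>Z. cmod (\<sigma> z u) \<le> exp C')" using units_R[OF u] by blast
      qed
      then show ?thesis using finite_bounded finite_surj by blast
    qed
  qed
  then obtain r g where basis: "int_basis (L ` units) r g"
    and rk: "relatively_dense I (L ` units) \<Longrightarrow> r = card I" by blast
  note g = int_basisD(1)[OF basis] and gen = int_basisD(2)[OF basis] and ind = int_basisD(3)[OF basis]
  have r: "r = s - 1"
  proof -
    obtain E where E: "\<And>t. (\<Sum>z\<in>places. t z) = 0 \<Longrightarrow> \<exists>u\<in>units. \<forall>z\<in>places. \<bar>log_emb u z - t z\<bar> \<le> E"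
      by (rule log_emb_relatively_dense) blast
    have "\<exists>x\<in>L ` units. \<forall>i\<in>I. \<bar>x i - t i\<bar> \<le> E" for t
    proof -
      \<comment> \<open>The target is completed at \<open>z0\<close> to a vector of sum zero, as the
        density statement requires.\<close>
      define t' where "t' = t(z0 := - (\<Sum>z\<in>I. t z))"
      have "(\<Sum>z\<in>places. t' z) = t' z0 + (\<Sum>z\<in>I. t' z)"
        unfolding I_def by (rule sum.remove) (use z0 in auto)
      also have "(\<Sum>z\<in>I. t' z) = (\<Sum>z\<in>I. t z)" by (rule sum.cong) (auto simp: t'_def I_def)
      finally have "(\<Sum>z\<in>places. t' z) = 0" by (simp add: t'_def)
      from E[OF this] obtain u where "u \<in> units" "\<And>z. z \<in> places \<Longrightarrow> \<bar>log_emb u z - t' z\<bar> \<le> E"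
        by blast
      then show ?thesis by (intro bexI[of _ "L u"] ballI) (force simp: L_def t'_def I_def)+
    qed
    then have "r = card I" by (intro rk) (auto simp: relatively_dense_def)
    then show ?thesis using cI by simp
  qed
  have "\<forall>k. \<exists>e. k < r \<longrightarrow> e \<in> units \<and> g k = L e" using g by blast
  then obtain \<epsilon> where eps: "\<And>k. k < r \<Longrightarrow> \<epsilon> k \<in> units" "\<And>k. k < r \<Longrightarrow> g k = L (\<epsilon> k)" by metis
  have Lprod: "(\<Sum>k<r. of_int (n k) * g k z) = log_emb (\<Prod>k<r. \<epsilon> k powi n k) z" if "z \<in> I" for n z
    using that by (subst log_emb_prod_powi[OF IZ[OF that] eps(1)]) (auto simp: eps L_def)
  show thesis
  proof (rule that[of \<epsilon>])
    show "\<epsilon> k \<in> units" if "k < s - 1" for k using eps(1) that r by simp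
    show "\<exists>n :: nat \<Rightarrow> int. \<forall>z\<in>places. log_emb u z = log_emb (\<Prod>k<s - 1. \<epsilon> k powi n k) z"
      if u: "u \<in> units" for u
    proof -
      from gen[of "L u"] u obtain n :: "nat \<Rightarrow> int"
        where n: "\<And>z. L u z = (\<Sum>k<r. of_int (n k) * g k z)" by blast
      have "log_emb u z = log_emb (\<Prod>k<r. \<epsilon> k powi n k) z" if "z \<in> I" for z
        using n[of z] that Lprod[OF that] by (simp add: L_def)
      then have "\<forall>z\<in>places. log_emb u z = log_emb (\<Prod>k<r. \<epsilon> k powi n k) z"
        using u eps(1) by (intro ext units_prod units_powi) auto
      then show ?thesis unfolding r by blast
    qed
    show "n k = 0" if n: "\<And>z. z \<in> places \<Longrightarrow> log_emb (\<Prod>k<s - 1. \<epsilon> k powi n k) z = 0" and k: "k < s - 1"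
      for n :: "nat \<Rightarrow> int" and k
    proof -
      have "(\<Sum>k<r. of_int (n k) * g k z) = 0" for z
      proof (cases "z \<in> I")
        case True
        then show ?thesis using n[of z] Lprod[OF True] by (simp add: r I_def)
      next
        case False
        then show ?thesis by (intro sum.neutral) (auto simp: eps L_def)
      qed
      then show ?thesis using ind[of n] k r by blast
    qed
  qed
qed

text \<open>A sign and an exponent vector are sent to the corresponding product of fundamental
  units. Logarithms recover the exponents, after which the sign is determined; surjectivity holds
  because a unit with vanishing logarithms is 1 or -1.\<close>

lemma unit_group_iso:
  "sign_img \<times>\<times> product_group {..<s - 1} (\<lambda>_. integer_group) \<cong>
    \<lparr>carrier = units, monoid.mult = (*), one = 1\<rparr>" (is "?G \<cong> ?U")
proof -
  obtain \<epsilon> where eps: "\<And>k. k < s - 1 \<Longrightarrow> \<epsilon> k \<in> units"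
    and gen: "\<And>u. u \<in> units \<Longrightarrow> \<exists>n :: nat \<Rightarrow> int. \<forall>z\<in>places.
        log_emb u z = log_emb (\<Prod>k<s - 1. \<epsilon> k powi n k) z"
    and ind: "\<And>n k. (\<And>z. z \<in> places \<Longrightarrow> log_emb (\<Prod>k<s - 1. \<epsilon> k powi n k) z = 0) \<Longrightarrow> k < s - 1 \<Longrightarrow> n k = 0"
    by (rule fundamental_units) blast
  define P where "P n = (\<Prod>k<s - 1. \<epsilon> k powi n k)" for n :: "nat \<Rightarrow> int"
  have PU: "P n \<in> units" for n unfolding P_def by (intro units_prod units_powi eps) auto
  have P0: "P n \<noteq> 0" for n using PU by (rule units_nonzero)
  have Padd: "P (\<lambda>k. n k + n' k) = P n * P n'" for n n'
    unfolding P_def prod.distrib[symmetric]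
    by (rule prod.cong) (auto simp: power_int_add units_nonzero[OF eps])
  have Pcong: "P n = P n'" if "\<And>k. k < s - 1 \<Longrightarrow> n k = n' k" for n n'
    unfolding P_def using that by (intro prod.cong) auto
  have sgnU: "of_int e \<in> units" if "e = 1 \<or> e = (-1::int)" for e
  proof -
    have "-1 \<in> units"
      using uminus_mem[OF one_mem] by (auto simp: units_def intro!: bexI[of _ "-1"])
    with that units_one show ?thesis by auto
  qed
  have log_sgn: "log_emb (of_int e * u) z = log_emb u z" if "e = 1 \<or> e = (-1::int)" "u \<in> units" "z \<in> Z" for e u z
  proof -
    have "log_emb (of_int e) z = 0" using that(1,3) by (auto simp: log_emb_def emb_of_int)
    then show ?thesis using log_emb_mult[OF that(3) sgnU[OF that(1)] that(2)] by simp
  qed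
  define h where "h = (\<lambda>(e :: int, n). of_int e * P n)"
  have "h \<in> iso ?G ?U"
  proof (rule isoI)
    show "h \<in> hom ?G ?U"
    proof (rule homI)
      fix x assume "x \<in> carrier ?G"
      then show "h x \<in> carrier ?U"
        using sgnU PU by (auto simp: h_def sign_img_def DirProd_def intro!: units_mult)
    next
      fix x y :: "int \<times> (nat \<Rightarrow> int)"
      obtain e n where x: "x = (e, n)" by (cases x)
      obtain e' n' where y: "y = (e', n')" by (cases y)
      have "P (\<lambda>i\<in>{..<s - 1}. n i + n' i) = P n * P n'"
        unfolding Padd[symmetric] by (rule Pcong) simp
      then show "h (x \<otimes>\<^bsub>?G\<^esub> y) =
          h x \<otimes>\<^bsub>?U\<^esub> h y"
        by (simp add: x y h_def sign_img_def DirProd_def integer_group_def)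
    qed
    show "bij_betw h (carrier ?G)
       (carrier ?U)"
    proof (rule bij_betwI')
      fix x y
      assume xy: "x \<in> carrier ?G"
        "y \<in> carrier ?G"
      obtain e n where x: "x = (e, n)" by (cases x)
      obtain e' n' where y: "y = (e', n')" by (cases y)
      have e: "e = 1 \<or> e = -1" "e' = 1 \<or> e' = -1" and n: "n \<in> extensional {..<s - 1}" "n' \<in> extensional {..<s - 1}"
        using xy by (auto simp: x y sign_img_def DirProd_def PiE_def)
      show "h x = h y \<longleftrightarrow> x = y"
      proof
        assume h: "h x = h y"
        have Pn: "P (\<lambda>k. n k - n' k) * P n' = P n" by (simp flip: Padd)
        have "log_emb (P (\<lambda>k. n k - n' k)) z = 0" if z: "z \<in> places" for z
        proof -
          have "log_emb (P n) z = log_emb (h x) z"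
            using log_sgn[OF e(1) PU places_Z[OF z]] by (simp add: h_def x)
          also have "\<dots> = log_emb (P n') z"
            unfolding h using log_sgn[OF e(2) PU places_Z[OF z]] by (simp add: h_def y)
          finally show ?thesis
            using log_emb_mult[OF places_Z[OF z] PU PU, of "\<lambda>k. n k - n' k" n'] unfolding Pn by simp
        qed
        then have "n k - n' k = 0" if "k < s - 1" for k
          unfolding P_def using ind[of "\<lambda>k. n k - n' k"] that by blast
        then have "n = n'" using n by (intro extensionalityI) auto
        moreover have "e = e'" using h P0[of n'] \<open>n = n'\<close> by (simp add: h_def x y)
        ultimately show "x = y" by (simp add: x y)
      qed simp
    next
      fix x assume "x \<in> carrier ?G"
      then show "h x \<in> carrier ?U"
        using sgnU PU by (auto simp: h_def sign_img_def DirProd_def intro!: units_mult)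
    next
      fix u assume "u \<in> carrier ?U"
      then have u: "u \<in> units" by simp
      from gen[OF u] obtain n :: "nat \<Rightarrow> int"
        where n: "\<And>z. z \<in> places \<Longrightarrow> log_emb u z = log_emb (P n) z" unfolding P_def by blast
      have "log_emb (u * inverse (P n)) z = 0" if "z \<in> places" for z
        using n[OF that] places_Z[OF that] u PU
        by (simp add: log_emb_mult units_inverse log_emb_inverse)
      then have "u * inverse (P n) = 1 \<or> u * inverse (P n) = -1"
        by (intro unit_bounded_powers units_mult u units_inverse PU)
      then obtain e :: int where e: "e = 1 \<or> e = -1" "u * inverse (P n) = of_int e" by force
      have "u = of_int e * P n" using e(2) P0[of n] by (simp add: field_simps)
      \<comment> \<open>Members of the product group are extensional, so the exponents are cut off
        outside the index range.\<close>
      also have "P n = P (restrict n {..<s - 1})" by (rule Pcong) simp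
      finally have "u = h (e, restrict n {..<s - 1})" by (simp add: h_def)
      moreover have "(e, restrict n {..<s - 1}) \<in>
          carrier ?G"
        using e by (auto simp: sign_img_def DirProd_def integer_group_def)
      ultimately show "\<exists>x\<in>carrier ?G. u = h x"
        by blast
    qed
  qed
  then show ?thesis unfolding is_iso_def by blast
qed

end

section \<open>From a \<int>-basis of a ring to the number field it spans\<close>

lemma common_denominator:
  assumes "finite S"
  shows "\<exists>D::int. D > 0 \<and> (\<forall>x\<in>S. \<exists>n::int. of_int D * f x = (of_int n :: rat))"
  using assms
proof induction
  case empty
  show ?case by (intro exI[of _ 1]) simp
next
  case (insert x S)
  then obtain D :: int where D: "D > 0" "\<And>x. x \<in> S \<Longrightarrow> \<exists>n::int. of_int D * f x = of_int n" by blast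
  obtain a d :: int where ad: "f x = of_int a / of_int d" "d > 0"
    by (cases "f x") (simp add: Fract_of_int_quotient)
  have "of_int (D * d) * f x = of_int (D * a)" using ad by simp
  moreover have "\<exists>n::int. of_int (D * d) * f y = of_int n" if "y \<in> S" for y
  proof -
    from D(2)[OF that] obtain n :: int where "of_int D * f y = of_int n" ..
    then have "of_int (D * d) * f y = of_int (d * n)" by (simp add: mult.commute mult.left_commute)
    then show ?thesis ..
  qed
  ultimately have "\<forall>y\<in>insert x S. \<exists>n::int. of_int (D * d) * f y = of_int n" by blast
  then show ?case using D(1) ad(2) by (intro exI[of _ "D * d"]) simp
qed

text \<open>Membership of a product in the span is linear in each factor separately, so span
  induction is run once per factor.\<close>

lemma span_mult_closed:
  assumes R: "\<And>x y. x \<in> R \<Longrightarrow> y \<in> R \<Longrightarrow> x * y \<in> R"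
    and xy: "x \<in> rat_vec.span R" "y \<in> rat_vec.span R"
  shows "x * y \<in> rat_vec.span R"
proof -
  have sub: "rat_vec.subspace {x. x * y \<in> rat_vec.span R}" for y
    unfolding rat_vec.subspace_def
    by (auto simp: distrib_right rat_vec.span_zero mult.assoc intro: rat_vec.span_add rat_vec.span_scale)
  have 1: "x * y \<in> rat_vec.span R" if "x \<in> rat_vec.span R" "y \<in> R" for x y
    using that(1) sub by (rule rat_vec.span_induct) (use R that(2) rat_vec.span_base in blast)
  have "y * x \<in> rat_vec.span R"
    using xy(2) sub by (rule rat_vec.span_induct) (metis 1 xy(1) mem_Collect_eq mult.commute)
  then show ?thesis by (simp add: mult.commute)
qed

text \<open>A common denominator turns a rational relation among the \<open>b i\<close> into an
  integral one.\<close>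

lemma int_basis_rat_basis:
  fixes R :: "complex set" and b :: "nat \<Rightarrow> complex"
  assumes b: "\<And>i. i < n \<Longrightarrow> b i \<in> R"
    and gen: "\<And>x. x \<in> R \<Longrightarrow> \<exists>c::nat \<Rightarrow> int. x = (\<Sum>i<n. of_int (c i) * b i)"
    and ind: "\<And>(c::nat \<Rightarrow> int) i. (\<Sum>i<n. of_int (c i) * b i) = 0 \<Longrightarrow> i < n \<Longrightarrow> c i = 0"
  shows "card (b ` {..<n}) = n" and "rat_vec.independent (b ` {..<n})"
    and "rat_vec.span R = rat_vec.span (b ` {..<n})"
proof -
  define B where "B = b ` {..<n}"
  have inj: "inj_on b {..<n}"
  proof (rule inj_onI)
    fix i j assume ij: "i \<in> {..<n}" "j \<in> {..<n}" "b i = b j"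
    show "i = j"
    proof (rule ccontr)
      assume "i \<noteq> j"
      define c :: "nat \<Rightarrow> int" where "c = (\<lambda>k. if k = i then 1 else if k = j then -1 else 0)"
      have "(\<Sum>k<n. of_int (c k) * b k) = (\<Sum>k\<in>{i, j}. of_int (c k) * b k)"
        by (rule sum.mono_neutral_right) (use ij in \<open>auto simp: c_def\<close>)
      also have "\<dots> = 0" using ij \<open>i \<noteq> j\<close> by (simp add: c_def)
      finally have "c i = 0" using ij by (intro ind) auto
      then show False by (simp add: c_def)
    qed
  qed
  have finB: "finite B" by (simp add: B_def)
  have cardB: "card B = n" using inj by (simp add: B_def card_image)
  have indB: "rat_vec.independent B"
  proof (rule rat_vec.independent_if_scalars_zero[OF finB])
    fix f x assume f: "(\<Sum>x\<in>B. of_rat (f x) * x) = 0" and x: "x \<in> B"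
    obtain D :: int where D: "D > 0" "\<forall>x\<in>B. \<exists>m::int. of_int D * f x = of_int m"
      using common_denominator[OF finB] by blast
    then obtain m :: "complex \<Rightarrow> int" where m: "\<And>x. x \<in> B \<Longrightarrow> of_int D * f x = of_int (m x)" by metis
    have m': "of_int (m x) = of_int D * (of_rat (f x) :: complex)" if "x \<in> B" for x
      using arg_cong[OF m[OF that], of "of_rat :: rat \<Rightarrow> complex"] by (simp add: of_rat_mult)
    have "(\<Sum>i<n. of_int (m (b i)) * b i) = (\<Sum>x\<in>B. of_int (m x) * x)"
      unfolding B_def using inj by (simp add: sum.reindex)
    also have "\<dots> = of_int D * (\<Sum>x\<in>B. of_rat (f x) * x)"
      by (simp add: m' sum_distrib_left mult.assoc)
    also have "\<dots> = 0" by (simp add: f)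
    finally have "(\<Sum>i<n. of_int (m (b i)) * b i) = 0" .
    from ind[OF this] have "m x = 0" using x by (auto simp: B_def)
    with m'[OF x] D(1) show "f x = 0" by simp
  qed
  have FB: "rat_vec.span R = rat_vec.span B"
  proof (rule antisym)
    have "x \<in> rat_vec.span B" if x: "x \<in> R" for x
    proof -
      from gen[OF x] obtain c :: "nat \<Rightarrow> int" where c: "x = (\<Sum>i<n. of_int (c i) * b i)" ..
      have "(\<Sum>i<n. of_rat (of_int (c i)) * b i) \<in> rat_vec.span B"
        by (rule rat_vec.span_sum, rule rat_vec.span_scale, rule rat_vec.span_base) (simp add: B_def)
      then show ?thesis by (simp add: c)
    qed
    then show "rat_vec.span R \<subseteq> rat_vec.span B" by (intro rat_vec.span_minimal rat_vec.subspace_span) auto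
    show "rat_vec.span B \<subseteq> rat_vec.span R" unfolding B_def using b by (intro rat_vec.span_mono) auto
  qed
  show "card (b ` {..<n}) = n" "rat_vec.independent (b ` {..<n})"
    "rat_vec.span R = rat_vec.span (b ` {..<n})"
    using cardB indB FB by (simp_all add: B_def)
qed

text \<open>Supplies the abstract order with its embeddings: the rational span of R is a number
  field of degree 2s, and a primitive element yields them. A ring homomorphism on the span is given
  as a total function constrained only there.\<close>

theorem imaginary_order_unit_group:
  fixes R :: "complex set" and b :: "nat \<Rightarrow> complex"
  assumes one: "1 \<in> R" and diff: "\<And>x y. x \<in> R \<Longrightarrow> y \<in> R \<Longrightarrow> x - y \<in> R"
    and mult: "\<And>x y. x \<in> R \<Longrightarrow> y \<in> R \<Longrightarrow> x * y \<in> R"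
    and b: "\<And>i. i < 2 * s \<Longrightarrow> b i \<in> R"
    and gen: "\<And>x. x \<in> R \<Longrightarrow> \<exists>c::nat \<Rightarrow> int. x = (\<Sum>i<2 * s. of_int (c i) * b i)"
    and ind: "\<And>(c::nat \<Rightarrow> int) i. (\<Sum>i<2 * s. of_int (c i) * b i) = 0 \<Longrightarrow> i < 2 * s \<Longrightarrow> c i = 0"
    and inv: "\<And>x. x \<in> rat_vec.span R \<Longrightarrow> inverse x \<in> rat_vec.span R"
    and imaginary: "\<And>\<rho> :: complex \<Rightarrow> real. \<rho> 1 = 1 \<Longrightarrow>
      (\<And>x y. x \<in> rat_vec.span R \<Longrightarrow> y \<in> rat_vec.span R \<Longrightarrow> \<rho> (x + y) = \<rho> x + \<rho> y) \<Longrightarrow>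
      (\<And>x y. x \<in> rat_vec.span R \<Longrightarrow> y \<in> rat_vec.span R \<Longrightarrow> \<rho> (x * y) = \<rho> x * \<rho> y) \<Longrightarrow> False"
    and unity: "\<And>x n. x \<in> R \<Longrightarrow> n > 0 \<Longrightarrow> x ^ n = 1 \<Longrightarrow> x = 1 \<or> x = -1"
  shows "sign_img \<times>\<times> product_group {..<s - 1} (\<lambda>_. integer_group) \<cong>
    \<lparr>carrier = {x \<in> R. \<exists>y\<in>R. x * y = 1}, monoid.mult = (*), one = 1\<rparr>"
proof -
  define F where "F = rat_vec.span R"
  define B where "B = b ` {..<2 * s}"
  have RF: "x \<in> F" if "x \<in> R" for x using that by (simp add: F_def rat_vec.span_base)
  have finB: "finite B" by (simp add: B_def)
  have cardB: "card B = 2 * s" and indB: "rat_vec.independent B" and FB: "F = rat_vec.span B"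
    using int_basis_rat_basis[of "2 * s" b R] b gen ind by (auto simp: B_def F_def)
  have Fmult: "x * y \<in> F" if "x \<in> F" "y \<in> F" for x y
    using span_mult_closed[of R x y] mult that by (simp add: F_def)
  show ?thesis
  proof (rule number_field_embeddings[OF finB indB FB RF[OF one]])
    show "x * y \<in> F" if "x \<in> F" "y \<in> F" for x y using that by (rule Fmult)
  next
    fix Z \<sigma> \<theta>
    assume Z: "finite Z" "card Z = card B" "\<theta> \<in> F" "\<And>z. \<sigma> z \<theta> = z"
      and add_s: "\<And>z x y. z \<in> Z \<Longrightarrow> x \<in> F \<Longrightarrow> y \<in> F \<Longrightarrow> \<sigma> z (x + y) = \<sigma> z x + \<sigma> z y"
      and mult_s: "\<And>z x y. z \<in> Z \<Longrightarrow> x \<in> F \<Longrightarrow> y \<in> F \<Longrightarrow> \<sigma> z (x * y) = \<sigma> z x * \<sigma> z y"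
      and rat_s: "\<And>z q. z \<in> Z \<Longrightarrow> \<sigma> z (of_rat q) = of_rat q"
      and cnjs: "\<And>z. z \<in> Z \<Longrightarrow> cnj z \<in> Z" "\<And>z x. \<sigma> (cnj z) x = cnj (\<sigma> z x)"
    have one_s: "\<sigma> z 1 = 1" if "z \<in> Z" for z using rat_s[OF that, of 1] by simp
    \<comment> \<open>A real label makes the embedding its own conjugate, hence real-valued, which
      \<open>imaginary\<close> excludes.\<close>
    have nonreal: "Im z \<noteq> 0" if z: "z \<in> Z" for z
    proof
      assume "Im z = 0"
      then have "cnj z = z" by (simp add: complex_eq_iff)
      then have real: "\<sigma> z x = of_real (Re (\<sigma> z x))" for x
        using cnjs(2)[of z x] unfolding \<open>cnj z = z\<close> by (simp add: complex_eq_iff)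
      show False
      proof (rule imaginary[of "\<lambda>x. Re (\<sigma> z x)"])
        show "Re (\<sigma> z 1) = 1" using one_s[OF z] by simp
        show "Re (\<sigma> z (x + y)) = Re (\<sigma> z x) + Re (\<sigma> z y)"
          if "x \<in> rat_vec.span R" "y \<in> rat_vec.span R" for x y
          using add_s[OF z] that by (simp add: F_def)
        show "Re (\<sigma> z (x * y)) = Re (\<sigma> z x) * Re (\<sigma> z y)"
          if "x \<in> rat_vec.span R" "y \<in> rat_vec.span R" for x y
        proof -
          have "\<sigma> z (x * y) = of_real (Re (\<sigma> z x)) * of_real (Re (\<sigma> z y))"
            using mult_s[OF z, of x y] that real by (simp add: F_def)
          then show ?thesis by simp
        qed
      qed
    qed
    \<comment> \<open>The primitive element lies in the span of R but perhaps not in R; a positive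
      integer multiple does, and it still has distinct conjugates.\<close>
    obtain m :: int where m: "m > 0" "of_int m * \<theta> \<in> R"
    proof -
      have uminus: "- x \<in> R" if "x \<in> R" for x
        using diff[OF diff[OF one one] that] by simp
      have addR: "x + y \<in> R" if "x \<in> R" "y \<in> R" for x y
        using diff[OF that(1) uminus[OF that(2)]] by simp
      have int_R: "of_int k \<in> R" for k
        by (induction k rule: int_induct[where k = 0]) (use addR diff one diff[OF one one] in auto)
      have "\<exists>m::int. m > 0 \<and> of_int m * x \<in> R" if "x \<in> rat_vec.span R" for x
        using that
      proof (induction rule: rat_vec.span_induct_alt)
        case base
        show ?case using diff[OF one one] by (intro exI[of _ 1]) simp
      next
        case (step q x y)
        then obtain m :: int where m: "m > 0" "of_int m * y \<in> R" by blast
        obtain a d :: int where ad: "q = of_int a / of_int d" "d > 0"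
          by (cases q) (simp add: Fract_of_int_quotient)
        have dq: "of_int d * (of_rat q :: complex) = of_int a" using ad by (simp add: of_rat_divide)
        have "of_int (m * d) * (of_rat q * x + y) =
            of_int m * (of_int d * of_rat q) * x + of_int d * (of_int m * y)"
          by (simp add: algebra_simps)
        also have "\<dots> = of_int (m * a) * x + of_int d * (of_int m * y)" by (simp add: dq)
        also have "\<dots> \<in> R" by (intro addR mult int_R m step)
        finally show ?case using m ad by (intro exI[of _ "m * d"]) simp
      qed
      then show thesis using that Z(3) by (auto simp: F_def)
    qed
    have sm: "\<sigma> z (of_int m * \<theta>) = of_int m * z" if "z \<in> Z" for z
    proof -
      have "of_int m * 1 \<in> F" using rat_vec.span_scale[of 1 R "of_int m"] RF[OF one] by (simp add: F_def)
      then have "\<sigma> z (of_int m * \<theta>) = \<sigma> z (of_rat (of_int m)) * \<sigma> z \<theta>"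
        using mult_s[OF that _ Z(3)] by simp
      then show ?thesis using rat_s[OF that, of "of_int m"] Z(4)[of z] by simp
    qed
    interpret imaginary_order R b s Z \<sigma> "of_int m * \<theta>"
    proof unfold_locales
      show "\<sigma> z x \<noteq> 0" if "z \<in> Z" "x \<in> R" "x \<noteq> 0" for z x
      proof -
        have "\<sigma> z x * \<sigma> z (inverse x) = \<sigma> z 1"
          using mult_s[OF that(1) RF[OF that(2)], of "inverse x"] inv[of x] RF[OF that(2)] that(3)
          by (simp add: F_def)
        then show ?thesis using one_s[OF that(1)] by auto
      qed
      show "inj_on (\<lambda>z. \<sigma> z (of_int m * \<theta>)) Z"
        using m(1) by (intro inj_onI) (simp add: sm)
      show "card Z = 2 * s" using Z(2) cardB by simp
    qed (use one diff mult b gen Z(1) add_s mult_s RF one_s cnjs nonreal m(2) unity in \<open>auto\<close>)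
    show ?thesis using unit_group_iso unfolding units_def .
  qed
qed

section \<open>Endomorphisms of complex tori as matrices\<close>

lemma additive_group_simps [simp]:
  "carrier additive_group = UNIV" "x \<otimes>\<^bsub>additive_group\<^esub> y = x + y" "\<one>\<^bsub>additive_group\<^esub> = 0"
  by (simp_all add: additive_group_def)

lemma comm_group_additive_group: "comm_group additive_group"
  by (rule comm_groupI) (auto intro: exI[of _ "- x" for x] simp: add_ac left_minus)

lemma inv_additive_group [simp]: "inv\<^bsub>additive_group\<^esub> x = - x"
  using group.inv_equality[OF comm_group.axioms(2)[OF comm_group_additive_group], of "- x" x] by simp

lemma torus_proj_iff: "w \<in> torus_proj L z \<longleftrightarrow> w - z \<in> L"
  by (auto simp: torus_proj_def r_coset_def algebra_simps intro: bexI[of _ "w - z"])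

lemma scaleR_matrix_vector: "A *v (t *\<^sub>R z) = t *\<^sub>R (A *v z)" for A :: "complex^'n^'m"
  by (simp add: Finite_Cartesian_Product.vec_eq_iff matrix_vector_mult_def scaleR_sum_right)

lemma has_derivative_matrix_vector: "((*v) A has_derivative (*v) A) F" for A :: "complex^'n^'m"
  by (intro bounded_linear_imp_has_derivative linear_conv_bounded_linear[THEN iffD1] linearI)
    (simp_all add: matrix_vector_right_distrib scaleR_matrix_vector)

locale lattice =
  fixes B :: "(complex^'n) set" and L :: "(complex^'n) set"
  assumes indep: "independent B" and span: "span B = UNIV"
    and L_def: "L = {\<Sum>b\<in>B. of_int (c b) *\<^sub>R b | c :: complex^'n \<Rightarrow> int. True}"
begin

abbreviation "Tor \<equiv> complex_torus L"
abbreviation "End \<equiv> torus_End L"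
abbreviation "Aut \<equiv> torus_Aut L"
abbreviation "K0 \<equiv> torus_End0 L"

lemma finite_B: "finite B" using indep by (rule independent_imp_finite)

lemma zero_mem: "0 \<in> L" unfolding L_def by (auto intro!: exI[of _ "\<lambda>_. 0"])

lemma diff_mem: "x \<in> L \<Longrightarrow> y \<in> L \<Longrightarrow> x - y \<in> L"
proof -
  assume "x \<in> L" "y \<in> L"
  then obtain c c' :: "complex^'n \<Rightarrow> int" where
    "x = (\<Sum>b\<in>B. of_int (c b) *\<^sub>R b)" "y = (\<Sum>b\<in>B. of_int (c' b) *\<^sub>R b)"
    by (auto simp: L_def)
  then have "x - y = (\<Sum>b\<in>B. of_int (c b - c' b) *\<^sub>R b)"
    by (simp add: scaleR_diff_left sum_subtractf)
  then show ?thesis unfolding L_def by (intro CollectI exI[of _ "\<lambda>b. c b - c' b"]) simp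
qed

lemma uminus_mem: "x \<in> L \<Longrightarrow> - x \<in> L" using diff_mem[OF zero_mem] by simp

lemma add_mem: "x \<in> L \<Longrightarrow> y \<in> L \<Longrightarrow> x + y \<in> L"
  using diff_mem[OF _ uminus_mem] by fastforce

lemma basis_mem: "b \<in> B \<Longrightarrow> b \<in> L"
  unfolding L_def using finite_B
  by (auto intro!: exI[of _ "\<lambda>x. if x = b then 1 else 0"] simp: if_distrib[of of_int] if_distrib[of "\<lambda>x. x *\<^sub>R _"] cong: if_cong)

lemma representation_int: "x \<in> L \<Longrightarrow> representation B x b \<in> \<int>"
proof -
  assume "x \<in> L"
  then obtain c :: "complex^'n \<Rightarrow> int" where c: "x = (\<Sum>b\<in>B. of_int (c b) *\<^sub>R b)"
    by (auto simp: L_def)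
  have "representation B x b = (\<Sum>b'\<in>B. of_int (c b') * representation B b' b)"
    unfolding c by (simp add: representation_sum[OF indep] span representation_scale[OF indep])
  also have "\<dots> \<in> \<int>"
    by (intro Ints_sum Ints_mult Ints_of_int) (simp add: representation_basis[OF indep])
  finally show ?thesis .
qed

lemma representation_inj:
  assumes "\<And>b. b \<in> B \<Longrightarrow> representation B x b = representation B y b"
  shows "x = y"
proof -
  have "x = (\<Sum>b\<in>B. representation B x b *\<^sub>R b)" "y = (\<Sum>b\<in>B. representation B y b *\<^sub>R b)"
    using sum_representation_eq[OF indep _ finite_B order_refl] span by simp_all
  with assms show ?thesis by simp
qed

lemma linear_representation: "linear (\<lambda>x. representation B x b)"
  by (rule linearI) (simp_all add: representation_add[OF indep] representation_scale[OF indep] span)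

text \<open>Coordinates with respect to \<open>B\<close> are bounded linear functionals and take
  integer values on \<open>L\<close>; on a short lattice vector they are less than 1 in absolute
  value, hence zero.\<close>

lemma discrete:
  obtains e where "e > 0" "\<And>x. x \<in> L \<Longrightarrow> norm x < e \<Longrightarrow> x = 0"
proof -
  have "\<forall>b. \<exists>C. C > 0 \<and> (\<forall>x. norm (representation B x b) \<le> C * norm x)"
    using linear_bounded_pos[OF linear_representation] by metis
  then obtain C where C: "\<And>b. C b > 0" "\<And>b x. \<bar>representation B x b\<bar> \<le> C b * norm x"
    unfolding real_norm_def by metis
  define K where "K = (\<Sum>b\<in>B. C b) + 1"
  have K0: "K > 0" unfolding K_def using C(1) by (simp add: add_nonneg_pos sum_nonneg less_imp_le)
  show thesis
  proof (rule that)
    show "1 / K > 0" using K0 by simp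
    fix x assume x: "x \<in> L" "norm x < 1 / K"
    have "representation B x b = representation B 0 b" if b: "b \<in> B" for b
    proof -
      have "C b \<le> (\<Sum>b\<in>B. C b)"
        by (rule member_le_sum) (use b C(1) finite_B in \<open>auto intro: less_imp_le\<close>)
      then have "C b \<le> K" by (simp add: K_def)
      have "\<bar>representation B x b\<bar> \<le> K * norm x"
        by (rule order_trans[OF C(2)]) (rule mult_right_mono[OF \<open>C b \<le> K\<close>], simp)
      also have "\<dots> < 1" using x(2) K0 by (simp add: field_simps)
      finally have "\<bar>representation B x b\<bar> < 1" .
      with representation_int[OF x(1), of b] have "representation B x b = 0"
        using Ints_nonzero_abs_less1 by blast
      then show ?thesis by (simp add: representation_zero)
    qed
    then show "x = 0" by (rule representation_inj)
  qed
qed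

lemma normal_L: "normal L additive_group"
proof -
  interpret comm_group "additive_group :: (complex^'n) monoid" by (rule comm_group_additive_group)
  have "subgroup L additive_group"
    by (rule subgroupI) (use zero_mem uminus_mem add_mem in auto)
  then show ?thesis by (rule normal_iff_subgroup[THEN iffD2])
qed

lemma torus_proj_eq_iff: "torus_proj L z = torus_proj L w \<longleftrightarrow> z - w \<in> L"
proof
  assume "torus_proj L z = torus_proj L w"
  moreover have "z \<in> torus_proj L z" using zero_mem by (simp add: torus_proj_iff)
  ultimately show "z - w \<in> L" by (simp add: torus_proj_iff)
next
  assume zw: "z - w \<in> L"
  have "x - z \<in> L \<longleftrightarrow> x - w \<in> L" for x
    using add_mem[OF _ zw, of "x - z"] diff_mem[OF _ zw, of "x - w"] by auto
  then show "torus_proj L z = torus_proj L w" by (auto simp: torus_proj_iff)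
qed

lemma carrier_torus: "carrier Tor = range (torus_proj L)"
  by (auto simp: complex_torus_def FactGroup_def RCOSETS_def torus_proj_def)

lemma torus_proj_mem [simp]: "torus_proj L z \<in> carrier Tor"
  by (simp add: carrier_torus)

lemma torus_mult: "torus_proj L z \<otimes>\<^bsub>Tor\<^esub> torus_proj L w = torus_proj L (z + w)"
  using normal.rcos_sum[OF normal_L, of z w]
  by (simp add: complex_torus_def FactGroup_def torus_proj_def)

lemma torus_one: "\<one>\<^bsub>Tor\<^esub> = torus_proj L 0"
  by (auto simp: complex_torus_def FactGroup_def torus_proj_iff)

lemma group_torus: "group Tor"
  unfolding complex_torus_def by (rule normal.factorgroup_is_group[OF normal_L])

lemma hom_torus_cong:
  assumes "f \<in> hom Tor Tor"
  shows "f (torus_proj L (z + w)) = f (torus_proj L z) \<otimes>\<^bsub>Tor\<^esub> f (torus_proj L w)"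
  using hom_mult[OF assms, of "torus_proj L z" "torus_proj L w"] by (simp add: torus_mult)

text \<open>A continuous lift near the origin is additive up to a small element of the lattice, hence
  additive, and therefore it agrees with its derivative at the origin.\<close>

lemma torus_hom_lift:
  assumes hom: "f \<in> hom Tor Tor" and hol: "torus_holomorphic L f"
  obtains A where "\<And>z. f (torus_proj L z) = torus_proj L (A *v z)"
proof -
  from hol obtain U g where U: "0 \<in> U" "holomorphic_on_vec g U"
    and g: "\<And>z. z \<in> U \<Longrightarrow> f (torus_proj L z) = torus_proj L (g z)"
    unfolding torus_holomorphic_def by metis
  from U obtain g' where "open U" and lin: "Vector_Spaces.linear (*s) (*s) g'"
    and der: "(g has_derivative g') (at 0)"
    unfolding holomorphic_on_vec_def by blast
  \<comment> \<open>The lift is normalised to vanish at the origin. As \<open>f\<close> fixes the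
    identity, \<open>g 0\<close> is a lattice vector, so the induced map is the same.\<close>
  define h where "h z = g z - g 0" for z
  have "f (torus_proj L 0) = torus_proj L 0"
    using hom_one[OF hom group_torus group_torus] by (simp add: torus_one)
  then have g0: "g 0 \<in> L" using g[OF U(1)] by (simp add: torus_proj_eq_iff)
  have h: "f (torus_proj L z) = torus_proj L (h z)" if "z \<in> U" for z
    using g[OF that] g0 by (simp add: h_def torus_proj_eq_iff)
  have hder: "(h has_derivative g') (at 0)"
    unfolding h_def using has_derivative_diff[OF der has_derivative_const[of "g 0"]] by simp
  obtain e where e: "e > 0" "\<And>x. x \<in> L \<Longrightarrow> norm x < e \<Longrightarrow> x = 0" by (rule discrete) blast
  have "continuous (at 0) h" using hder by (rule has_derivative_continuous)
  \<comment> \<open>Three values of \<open>h\<close> enter the defect of additivity; with each below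
    \<open>e / 3\<close>, the defect is shorter than any non-zero lattice vector.\<close>
  then obtain d1 where d1: "d1 > 0" "\<And>z. norm z < d1 \<Longrightarrow> norm (h z) < e / 3"
    unfolding continuous_at_eps_delta using e(1)
    by (metis diff_zero divide_pos_pos h_def dist_norm diff_self zero_less_numeral)
  obtain d2 where d2: "d2 > 0" "ball 0 d2 \<subseteq> U"
    using \<open>open U\<close> U(1) open_contains_ball by blast
  \<comment> \<open>Half the radius, so that a sum of two small vectors stays where \<open>h\<close>
    is a small lift.\<close>
  define d where "d = min d1 d2 / 2"
  have d: "d > 0" using d1 d2 by (simp add: d_def)
  have small: "z \<in> U" "norm (h z) < e / 3" if "norm z < 2 * d" for z
    using that d1(2)[of z] d2(2) by (auto simp: d_def)
  have add: "h (x + y) = h x + h y" if xy: "norm x < d" "norm y < d" for x y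
  proof -
    have n: "norm x < 2 * d" "norm y < 2 * d" "norm (x + y) < 2 * d"
      using xy norm_triangle_ineq[of x y] norm_ge_zero[of x] norm_ge_zero[of y] by linarith+
    have "torus_proj L (h (x + y)) = torus_proj L (h x + h y)"
      using hom_torus_cong[OF hom, of x y] n by (simp add: h small(1) torus_mult)
    then have "h (x + y) - (h x + h y) \<in> L" by (simp add: torus_proj_eq_iff)
    moreover have "norm (h (x + y) - (h x + h y)) < e"
      using small(2)[OF n(1)] small(2)[OF n(2)] small(2)[OF n(3)]
        norm_triangle_ineq4[of "h (x + y)" "h x + h y"] norm_triangle_ineq[of "h x" "h y"] by linarith
    ultimately have "h (x + y) - (h x + h y) = 0" by (rule e(2))
    then show ?thesis by simp
  qed
  have h_g': "h x = g' x" if x: "norm x < d" for x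
  proof -
    have lin': "linear g'" using hder has_derivative_linear by blast
    \<comment> \<open>Repeated halving moves \<open>x\<close> to the origin, where the relative
      error of the derivative is below any prescribed c; doubling back leaves the relative error
      unchanged.\<close>
    have pow: "h x = 2 ^ n *\<^sub>R h (inverse (2 ^ n) *\<^sub>R x)" for n :: nat
    proof (induction n)
      case (Suc n)
      define y where "y = inverse (2 ^ Suc n) *\<^sub>R x"
      have "inverse (2 ^ Suc n) * norm x \<le> 1 * norm x"
        by (intro mult_right_mono) (simp_all add: inverse_le_1_iff one_le_power del: power_Suc)
      then have "norm y < d" using x by (simp add: y_def)
      have "h (inverse (2 ^ n) *\<^sub>R x) = h (y + y)"
        by (simp add: y_def flip: scaleR_add_left)
      also have "\<dots> = 2 *\<^sub>R h y" using add[OF \<open>norm y < d\<close> \<open>norm y < d\<close>] by (simp add: scaleR_2)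
      finally show ?case using Suc by (simp add: y_def)
    qed simp
    have "norm (h x - g' x) \<le> c * norm x" if c: "c > 0" for c
    proof -
      from hder c obtain r where r: "r > 0"
        "\<And>y. norm y < r \<Longrightarrow> norm (h y - g' y) \<le> c * norm y"
        unfolding has_derivative_at_alt by (auto simp: h_def)
      obtain n :: nat where n: "norm x / r < 2 ^ n"
        using real_arch_pow[of 2 "norm x / r"] by auto
      define y where "y = inverse (2 ^ n) *\<^sub>R x"
      have xy: "x = 2 ^ n *\<^sub>R y" by (simp add: y_def)
      have "norm y < r" using n r(1) by (simp add: y_def field_simps)
      have "h x = 2 ^ n *\<^sub>R h y" unfolding y_def by (rule pow)
      moreover have "g' x = 2 ^ n *\<^sub>R g' y" using linear_scale[OF lin', of "2 ^ n" y] xy by metis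
      ultimately have "h x - g' x = 2 ^ n *\<^sub>R (h y - g' y)" by (simp add: scaleR_diff_right)
      then have "norm (h x - g' x) = 2 ^ n * norm (h y - g' y)" by simp
      also have "\<dots> \<le> 2 ^ n * (c * norm y)" using r(2)[OF \<open>norm y < r\<close>] by simp
      also have "\<dots> = c * norm x" by (subst xy) simp
      finally show ?thesis .
    qed
    note le = this
    have "norm (h x - g' x) \<le> 0"
    proof (rule field_le_epsilon)
      fix r :: real assume r: "r > 0"
      have pos: "norm x + 1 > 0" by (rule add_nonneg_pos) simp_all
      have "norm (h x - g' x) \<le> r / (norm x + 1) * norm x" using r pos by (intro le divide_pos_pos)
      also have "\<dots> \<le> r" using r pos by (simp add: field_simps)
      finally show "norm (h x - g' x) \<le> 0 + r" by simp
    qed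
    then show ?thesis by simp
  qed
  define A where "A = matrix g'"
  have A: "A *v z = g' z" for z unfolding A_def by (rule matrix_works[OF lin])
  \<comment> \<open>Every vector is a small one doubled often enough, and the homomorphism property
    carries the formula outward from the ball.\<close>
  have double: "f (torus_proj L (2 ^ n *\<^sub>R y)) = torus_proj L (A *v (2 ^ n *\<^sub>R y))"
    if y: "norm y < d" for n :: nat and y
  proof (induction n)
    case 0
    have "norm y < 2 * d" using y d by simp
    then show ?case using h[OF small(1)] h_g'[OF y] by (simp add: A)
  next
    case (Suc n)
    have "2 ^ Suc n *\<^sub>R y = 2 ^ n *\<^sub>R y + 2 ^ n *\<^sub>R y" by (simp flip: scaleR_add_left)
    then show ?case
      by (simp only: hom_torus_cong[OF hom] Suc torus_mult matrix_vector_right_distrib)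
  qed
  have "f (torus_proj L z) = torus_proj L (A *v z)" for z
  proof -
    obtain n :: nat where n: "norm z / d < 2 ^ n"
      using real_arch_pow[of 2 "norm z / d"] by auto
    then have "norm (inverse (2 ^ n) *\<^sub>R z) < d" using d by (simp add: field_simps)
    from double[OF this, of n] show ?thesis by simp
  qed
  then show thesis by (rule that)
qed

text \<open>Both lifts agree modulo \<open>L\<close> along a whole real line, so all multiples of
  their difference are lattice vectors; a sufficiently short one must vanish.\<close>

lemma lift_unique:
  assumes "\<And>z. torus_proj L (A *v z) = torus_proj L (A' *v z)"
  shows "A = A'"
proof -
  obtain e where e: "e > 0" "\<And>x. x \<in> L \<Longrightarrow> norm x < e \<Longrightarrow> x = 0" by (rule discrete) blast
  have "A *v z = A' *v z" for z
  proof (rule ccontr)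
    define w where "w = A *v z - A' *v z"
    assume "A *v z \<noteq> A' *v z"
    then have w: "norm w > 0" by (simp add: w_def)
    define t where "t = e / (2 * norm w)"
    have "t > 0" using e w by (simp add: t_def)
    have "t *\<^sub>R w = A *v (t *\<^sub>R z) - A' *v (t *\<^sub>R z)"
      by (simp only: w_def scaleR_matrix_vector scaleR_diff_right)
    also have "\<dots> \<in> L" using assms by (simp add: torus_proj_eq_iff)
    finally have "t *\<^sub>R w = 0" using e w by (intro e(2)) (simp_all add: t_def)
    with \<open>t > 0\<close> w show False by simp
  qed
  then show ?thesis by (simp add: matrix_eq)
qed

text \<open>The concrete model of the endomorphism ring: exactly these matrices induce maps of the
  quotient by \<open>L\<close>.\<close>

definition lattice_matrices :: "(complex^'n^'n) set" where
  "lattice_matrices = {A. \<forall>z\<in>L. A *v z \<in> L}"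

lemma lift_mem:
  assumes "\<And>z. f (torus_proj L z) = torus_proj L (A *v z)"
  shows "A \<in> lattice_matrices"
  unfolding lattice_matrices_def
proof safe
  fix z assume "z \<in> L"
  then have "torus_proj L z = torus_proj L 0" by (simp add: torus_proj_eq_iff)
  with assms[of z] assms[of 0] have "torus_proj L (A *v z) = torus_proj L 0" by simp
  then show "A *v z \<in> L" by (simp add: torus_proj_eq_iff)
qed

definition torus_map :: "complex^'n^'n \<Rightarrow> (complex^'n) set \<Rightarrow> (complex^'n) set" where
  "torus_map A = (\<lambda>x\<in>carrier Tor. torus_proj L (A *v (SOME z. x = torus_proj L z)))"

lemma torus_map_proj:
  assumes "A \<in> lattice_matrices"
  shows "torus_map A (torus_proj L z) = torus_proj L (A *v z)"
proof -
  define w where "w = (SOME w. torus_proj L z = torus_proj L w)"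
  have "torus_proj L z = torus_proj L w" unfolding w_def by (rule someI) (rule refl)
  then have "w - z \<in> L" by (simp add: torus_proj_eq_iff[symmetric])
  then have "A *v w - A *v z \<in> L"
    using assms by (auto simp: lattice_matrices_def simp flip: matrix_vector_mult_diff_distrib)
  then show ?thesis by (simp add: torus_map_def w_def torus_proj_eq_iff)
qed

lemma torus_End_simps:
  "carrier End = {f \<in> hom Tor Tor \<inter>
     extensional (carrier Tor). torus_holomorphic L f}"
  "f \<otimes>\<^bsub>End\<^esub> g = compose (carrier Tor) f g"
  "\<one>\<^bsub>End\<^esub> = (\<lambda>x\<in>carrier Tor. x)"
  "f \<oplus>\<^bsub>End\<^esub> g = (\<lambda>x\<in>carrier Tor. f x \<otimes>\<^bsub>Tor\<^esub> g x)"
  by (simp_all add: torus_End_def Let_def)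

lemma torus_map_End: "A \<in> lattice_matrices \<Longrightarrow> torus_map A \<in> carrier End"
proof -
  assume A: "A \<in> lattice_matrices"
  have "torus_map A \<in> hom Tor Tor"
    by (rule homI) (auto simp: carrier_torus torus_map_proj[OF A] torus_mult matrix_vector_right_distrib)
  moreover have "torus_map A \<in> extensional (carrier Tor)" by (simp add: torus_map_def)
  moreover have "torus_holomorphic L (torus_map A)"
    unfolding torus_holomorphic_def holomorphic_on_vec_def
    by (intro allI exI[of _ UNIV] exI[of _ "(*v) A"] conjI ballI)
      (auto simp: torus_map_proj[OF A] intro!: exI[of _ "(*v) A"] has_derivative_matrix_vector)
  ultimately show ?thesis by (simp add: torus_End_simps)
qed

text \<open>The analytic representation of an endomorphism, that is, its action on the universal
  cover.\<close>

definition torus_matrix :: "((complex^'n) set \<Rightarrow> (complex^'n) set) \<Rightarrow> complex^'n^'n" where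
  "torus_matrix f = (THE A. \<forall>z. f (torus_proj L z) = torus_proj L (A *v z))"

lemma torus_matrix_eqI:
  assumes "\<And>z. f (torus_proj L z) = torus_proj L (A *v z)"
  shows "torus_matrix f = A"
  unfolding torus_matrix_def using assms lift_unique by (intro the_equality) auto

lemma torus_End_proj:
  assumes "f \<in> carrier End"
  shows "f (torus_proj L z) = torus_proj L (torus_matrix f *v z)"
proof -
  obtain A where A: "\<And>z. f (torus_proj L z) = torus_proj L (A *v z)"
    using torus_hom_lift[of f] assms by (auto simp: torus_End_simps)
  from A torus_matrix_eqI[of f A] show ?thesis by metis
qed

lemma torus_matrix_mem: "f \<in> carrier End \<Longrightarrow> torus_matrix f \<in> lattice_matrices"
  by (rule lift_mem[of f]) (rule torus_End_proj)

lemma torus_matrix_map: "A \<in> lattice_matrices \<Longrightarrow> torus_matrix (torus_map A) = A"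
  by (rule torus_matrix_eqI) (rule torus_map_proj)

lemma torus_map_matrix: "f \<in> carrier End \<Longrightarrow> torus_map (torus_matrix f) = f"
  by (rule extensionalityI[of _ "carrier Tor"])
    (auto simp: carrier_torus torus_End_proj torus_map_proj torus_matrix_mem,
      simp_all add: torus_End_simps torus_map_def carrier_torus)

lemma torus_matrix_inj:
  "f \<in> carrier End \<Longrightarrow> g \<in> carrier End \<Longrightarrow> torus_matrix f = torus_matrix g \<Longrightarrow> f = g"
  using torus_map_matrix by metis

lemma torus_map_mult:
  "A \<in> lattice_matrices \<Longrightarrow> A' \<in> lattice_matrices \<Longrightarrow>
    torus_map A \<otimes>\<^bsub>End\<^esub> torus_map A' = torus_map (A ** A')"
proof -
  assume A: "A \<in> lattice_matrices" "A' \<in> lattice_matrices"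
  then have "A ** A' \<in> lattice_matrices"
    by (auto simp: lattice_matrices_def simp flip: matrix_vector_mul_assoc)
  note maps = torus_map_proj[OF A(1)] torus_map_proj[OF A(2)] torus_map_proj[OF this]
  show ?thesis
  proof (rule extensionalityI[of _ "carrier Tor"])
    fix x assume x: "x \<in> carrier Tor"
    then obtain z where "x = torus_proj L z" by (auto simp: carrier_torus)
    with x show "(torus_map A \<otimes>\<^bsub>End\<^esub> torus_map A') x = torus_map (A ** A') x"
      by (simp add: torus_End_simps compose_def maps matrix_vector_mul_assoc)
  qed (simp_all add: torus_End_simps torus_map_def)
qed

end

section \<open>The ring of lattice matrices, its integral basis, and automorphisms as its
  units\<close>

context lattice
begin

lemma lattice_matrices_one: "mat 1 \<in> lattice_matrices"
  by (simp add: lattice_matrices_def)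

lemma lattice_matrices_mult: "A \<in> lattice_matrices \<Longrightarrow> A' \<in> lattice_matrices \<Longrightarrow> A ** A' \<in> lattice_matrices"
  by (auto simp: lattice_matrices_def simp flip: matrix_vector_mul_assoc)

lemma lattice_matrices_add: "A \<in> lattice_matrices \<Longrightarrow> A' \<in> lattice_matrices \<Longrightarrow> A + A' \<in> lattice_matrices"
  by (auto simp: lattice_matrices_def matrix_vector_mult_add_rdistrib add_mem)

lemma lattice_matrices_diff: "A \<in> lattice_matrices \<Longrightarrow> A' \<in> lattice_matrices \<Longrightarrow> A - A' \<in> lattice_matrices"
  by (auto simp: lattice_matrices_def matrix_vector_mult_diff_rdistrib diff_mem)

lemma torus_map_add:
  assumes A: "A \<in> lattice_matrices" "A' \<in> lattice_matrices"
  shows "torus_map A \<oplus>\<^bsub>End\<^esub> torus_map A' = torus_map (A + A')"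
proof (rule extensionalityI[of _ "carrier Tor"])
  fix x assume x: "x \<in> carrier Tor"
  then obtain z where "x = torus_proj L z" by (auto simp: carrier_torus)
  with x show "(torus_map A \<oplus>\<^bsub>End\<^esub> torus_map A') x = torus_map (A + A') x"
    by (simp add: torus_End_simps torus_map_proj A lattice_matrices_add torus_mult
        matrix_vector_mult_add_rdistrib)
qed (simp_all add: torus_End_simps torus_map_def)

lemma torus_map_one: "\<one>\<^bsub>End\<^esub> = torus_map (mat 1)"
proof (rule extensionalityI[of _ "carrier Tor"])
  fix x assume x: "x \<in> carrier Tor"
  then obtain z where "x = torus_proj L z" by (auto simp: carrier_torus)
  with x show "\<one>\<^bsub>End\<^esub> x = torus_map (mat 1) x"
    by (simp add: torus_End_simps torus_map_proj lattice_matrices_one)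
qed (simp_all add: torus_End_simps torus_map_def)

lemma torus_End_obtain:
  assumes "f \<in> carrier End"
  obtains A where "A \<in> lattice_matrices" "f = torus_map A"
  using that[OF torus_matrix_mem[OF assms]] torus_map_matrix[OF assms] by simp

lemma torus_End_add_closed:
  "f \<in> carrier End \<Longrightarrow> g \<in> carrier End \<Longrightarrow> f \<oplus>\<^bsub>End\<^esub> g \<in> carrier End"
  by (auto elim!: torus_End_obtain simp: torus_map_add intro!: torus_map_End lattice_matrices_add)

lemma torus_matrix_mult:
  "f \<in> carrier End \<Longrightarrow> g \<in> carrier End \<Longrightarrow>
    torus_matrix (f \<otimes>\<^bsub>End\<^esub> g) = torus_matrix f ** torus_matrix g"
  by (auto elim!: torus_End_obtain simp: torus_map_mult lattice_matrices_mult torus_matrix_map)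

lemma torus_matrix_add:
  "f \<in> carrier End \<Longrightarrow> g \<in> carrier End \<Longrightarrow>
    torus_matrix (f \<oplus>\<^bsub>End\<^esub> g) = torus_matrix f + torus_matrix g"
  by (auto elim!: torus_End_obtain simp: torus_map_add lattice_matrices_add torus_matrix_map)

lemma torus_matrix_one: "torus_matrix \<one>\<^bsub>End\<^esub> = mat 1"
  by (simp add: torus_map_one torus_matrix_map lattice_matrices_one)

lemma torus_End_one_closed: "\<one>\<^bsub>End\<^esub> \<in> carrier End"
  by (simp add: torus_map_one torus_map_End lattice_matrices_one)

lemma monoid_torus_End: "monoid End"
  by (rule monoidI)
    (auto elim!: torus_End_obtain simp: torus_map_one torus_map_mult lattice_matrices_mult
      lattice_matrices_one matrix_mul_assoc intro!: torus_map_End lattice_matrices_mult)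

text \<open>The rational representation: in the real basis \<open>B\<close> a matrix preserving
  \<open>L\<close> has integer entries, so these matrices form a discrete group of coordinate
  vectors. The rank \<open>r\<close> is left open here; the degree of the endomorphism algebra
  determines it later.\<close>

lemma lattice_matrices_basis:
  obtains r and G :: "nat \<Rightarrow> complex^'n^'n" where "\<And>k. k < r \<Longrightarrow> G k \<in> lattice_matrices"
    "\<And>A. A \<in> lattice_matrices \<Longrightarrow> \<exists>n :: nat \<Rightarrow> int. A = (\<Sum>k<r. of_int (n k) *\<^sub>R G k)"
    "\<And>(n :: nat \<Rightarrow> int) k. (\<Sum>k<r. of_int (n k) *\<^sub>R G k) = 0 \<Longrightarrow> k < r \<Longrightarrow> n k = 0"
proof -
  define \<phi> where "\<phi> A = (\<lambda>p. if p \<in> B \<times> B then representation B (A *v fst p) (snd p) else 0)"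
    for A :: "complex^'n^'n"
  have scale_v: "(t *\<^sub>R A) *v z = t *\<^sub>R (A *v z)" for t and A :: "complex^'n^'n" and z
    by (simp add: Finite_Cartesian_Product.vec_eq_iff matrix_vector_mult_def scaleR_sum_right)
  have sum_v: "(\<Sum>k\<in>K. F k) *v z = (\<Sum>k\<in>K. F k *v z)" for F :: "nat \<Rightarrow> complex^'n^'n" and K z
    by (induction K rule: infinite_finite_induct) (simp_all add: matrix_vector_mult_add_rdistrib)
  have \<phi>_diff: "\<phi> (A - A') = (\<lambda>p. \<phi> A p - \<phi> A' p)" for A A'
    by (auto simp: \<phi>_def matrix_vector_mult_diff_rdistrib representation_diff[OF indep] span)
  have \<phi>_sum: "\<phi> (\<Sum>k<r. of_int (n k) *\<^sub>R G k) p = (\<Sum>k<r. of_int (n k) * \<phi> (G k) p)"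
    for r and n :: "nat \<Rightarrow> int" and G p
    by (auto simp: \<phi>_def sum_v scale_v representation_sum[OF indep] representation_scale[OF indep] span)
  have \<phi>_inj: "A = A'" if "\<And>p. \<phi> A p = \<phi> A' p" for A A'
  proof -
    have eqB: "A *v b = A' *v b" if "b \<in> B" for b
    proof (rule representation_inj)
      fix b' assume "b' \<in> B"
      with \<open>b \<in> B\<close> \<open>\<And>p. \<phi> A p = \<phi> A' p\<close>[of "(b, b')"]
      show "representation B (A *v b) b' = representation B (A' *v b) b'" by (simp add: \<phi>_def)
    qed
    have lin: "linear ((*v) C)" for C :: "complex^'n^'n"
      by (rule linearI) (simp_all add: matrix_vector_right_distrib scaleR_matrix_vector)
    have "A *v z = A' *v z" for z
      using linear_eq_on[OF lin lin, of z B A A'] eqB span by simp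
    then show ?thesis by (simp add: matrix_eq)
  qed
  have "\<exists>r g. int_basis (\<phi> ` lattice_matrices) r g \<and>
      (relatively_dense (B \<times> B) (\<phi> ` lattice_matrices) \<longrightarrow> r = card (B \<times> B))"
  proof (rule discrete_subgroup_basis)
    show "finite (B \<times> B)" using finite_B by simp
    have "0 \<in> lattice_matrices" using lattice_matrices_diff[OF lattice_matrices_one lattice_matrices_one] by simp
    moreover have "(\<lambda>_. 0) = \<phi> 0" by (auto simp: \<phi>_def representation_zero)
    ultimately show "(\<lambda>_. 0) \<in> \<phi> ` lattice_matrices" by (rule rev_image_eqI)
    show "(\<lambda>i. x i - y i) \<in> \<phi> ` lattice_matrices"
      if "x \<in> \<phi> ` lattice_matrices" "y \<in> \<phi> ` lattice_matrices" for x y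
      using that lattice_matrices_diff by (auto simp flip: \<phi>_diff)
    show "x i = 0" if "x \<in> \<phi> ` lattice_matrices" "i \<notin> B \<times> B" for x i
      using that by (auto simp: \<phi>_def)
    show "finite {x \<in> \<phi> ` lattice_matrices. \<forall>i\<in>B \<times> B. \<bar>x i\<bar> \<le> C}" for C
    proof (rule finite_subset)
      let ?e = "\<lambda>c :: _ \<Rightarrow> int. (\<lambda>p. if p \<in> B \<times> B then real_of_int (c p) else 0)"
      show "{x \<in> \<phi> ` lattice_matrices. \<forall>i\<in>B \<times> B. \<bar>x i\<bar> \<le> C} \<subseteq>
          ?e ` PiE (B \<times> B) (\<lambda>_. {\<lfloor>- C\<rfloor>..\<lceil>C\<rceil>})"
      proof
        fix x assume x: "x \<in> {x \<in> \<phi> ` lattice_matrices. \<forall>i\<in>B \<times> B. \<bar>x i\<bar> \<le> C}"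
        then obtain A where A: "A \<in> lattice_matrices" "x = \<phi> A" by blast
        have int: "x p = of_int \<lfloor>x p\<rfloor>" for p
        proof -
          have "x p \<in> \<int>"
            using A basis_mem by (auto simp: \<phi>_def lattice_matrices_def intro!: representation_int)
          then show ?thesis by (auto elim: Ints_cases)
        qed
        have "\<lfloor>x p\<rfloor> \<in> {\<lfloor>- C\<rfloor>..\<lceil>C\<rceil>}" if "p \<in> B \<times> B" for p
        proof -
          have "\<bar>x p\<bar> \<le> C" using x that by blast
          then have "- C \<le> x p" "x p \<le> C" by linarith+
          then show ?thesis by (auto intro: floor_mono order_trans[OF floor_mono floor_le_ceiling])
        qed
        then have "(\<lambda>p\<in>B \<times> B. \<lfloor>x p\<rfloor>) \<in> PiE (B \<times> B) (\<lambda>_. {\<lfloor>- C\<rfloor>..\<lceil>C\<rceil>})" by auto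
        moreover have "x = ?e (\<lambda>p\<in>B \<times> B. \<lfloor>x p\<rfloor>)"
        proof
          fix p show "x p = ?e (\<lambda>p\<in>B \<times> B. \<lfloor>x p\<rfloor>) p"
          proof (cases "p \<in> B \<times> B")
            case True
            then show ?thesis using int[of p] by simp
          next
            case False
            then show ?thesis by (auto simp: A(2) \<phi>_def)
          qed
        qed
        ultimately show "x \<in> ?e ` PiE (B \<times> B) (\<lambda>_. {\<lfloor>- C\<rfloor>..\<lceil>C\<rceil>})" by blast
      qed
      show "finite (?e ` PiE (B \<times> B) (\<lambda>_. {\<lfloor>- C\<rfloor>..\<lceil>C\<rceil>}))"
        using finite_B by (intro finite_imageI finite_PiE) auto
    qed
  qed
  then obtain r g where basis: "int_basis (\<phi> ` lattice_matrices) r g" by blast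
  note g = int_basisD(1)[OF basis] and gen = int_basisD(2)[OF basis] and ind = int_basisD(3)[OF basis]
  have "\<forall>k. \<exists>A. k < r \<longrightarrow> A \<in> lattice_matrices \<and> g k = \<phi> A" using g by blast
  then obtain G where G: "\<And>k. k < r \<Longrightarrow> G k \<in> lattice_matrices" "\<And>k. k < r \<Longrightarrow> g k = \<phi> (G k)" by metis
  have sum_g: "(\<Sum>k<r. of_int (n k) * g k p) = \<phi> (\<Sum>k<r. of_int (n k) *\<^sub>R G k) p" for n :: "nat \<Rightarrow> int" and p
    unfolding \<phi>_sum by (intro sum.cong) (simp_all add: G)
  show thesis
  proof (rule that[of r G])
    show "\<exists>n :: nat \<Rightarrow> int. A = (\<Sum>k<r. of_int (n k) *\<^sub>R G k)" if "A \<in> lattice_matrices" for A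
      using gen[of "\<phi> A"] that \<phi>_inj[of A] unfolding sum_g by blast
    show "n k = 0" if "(\<Sum>k<r. of_int (n k) *\<^sub>R G k) = 0" "k < r" for n :: "nat \<Rightarrow> int" and k
    proof -
      have "(\<Sum>k<r. of_int (n k) * g k p) = 0" for p
        unfolding sum_g that(1) by (simp add: \<phi>_def representation_zero)
      then show ?thesis using ind[of n] that(2) by blast
    qed
  qed (use G in auto)
qed

lemma torus_holomorphic_cong:
  assumes "\<And>z. f (torus_proj L z) = g (torus_proj L z)"
  shows "torus_holomorphic L f \<longleftrightarrow> torus_holomorphic L g"
  by (simp add: torus_holomorphic_def assms)

text \<open>Automorphisms are the two-sided units of \<open>End\<close>. The inverse of a bijective
  homomorphism is a homomorphism, so holomorphy of the inverse is the only extra condition, and it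
  concerns values on the torus alone.\<close>

lemma carrier_torus_Aut:
  "carrier Aut = {f \<in> carrier End. \<exists>g\<in>carrier End.
     f \<otimes>\<^bsub>End\<^esub> g = \<one>\<^bsub>End\<^esub> \<and> g \<otimes>\<^bsub>End\<^esub> f = \<one>\<^bsub>End\<^esub>}"
proof -
  let ?T = "Tor"
  let ?S = "carrier ?T"
  have car: "carrier Aut = {f \<in> auto ?T. torus_holomorphic L f \<and>
      torus_holomorphic L (inv_into ?S f)}"
    by (simp add: torus_Aut_def Let_def)
  interpret T: group ?T by (rule group_torus)
  show ?thesis
  proof (intro equalityI subsetI)
    fix f assume "f \<in> carrier Aut"
    then have f: "f \<in> hom ?T ?T" "f \<in> extensional ?S" "bij_betw f ?S ?S" "torus_holomorphic L f"
      "torus_holomorphic L (inv_into ?S f)" by (auto simp: car auto_def Bij_def)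
    \<comment> \<open>\<open>inv_into\<close> has arbitrary values outside the torus; the
      restriction makes it extensional and hence a candidate for \<open>End\<close>.\<close>
    define g where "g = (\<lambda>x\<in>?S. inv_into ?S f x)"
    have gS: "g x \<in> ?S" if "x \<in> ?S" for x
      using f(3) that by (auto simp: g_def bij_betw_def intro: inv_into_into)
    have fg: "f (g x) = x" if "x \<in> ?S" for x
      using f(3) that by (auto simp: g_def bij_betw_def f_inv_into_f)
    have gf: "g (f x) = x" if "x \<in> ?S" for x
      using f(1,3) that by (auto simp: g_def bij_betw_def inv_into_f_f hom_def)
    have "g \<in> hom ?T ?T"
    proof (rule homI)
      fix x y assume xy: "x \<in> ?S" "y \<in> ?S"
      have "g (x \<otimes>\<^bsub>?T\<^esub> y) = g (f (g x \<otimes>\<^bsub>?T\<^esub> g y))"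
        using hom_mult[OF f(1) gS gS] xy by (simp add: fg)
      also have "\<dots> = g x \<otimes>\<^bsub>?T\<^esub> g y" using gf gS xy by simp
      finally show "g (x \<otimes>\<^bsub>?T\<^esub> y) = g x \<otimes>\<^bsub>?T\<^esub> g y" .
    qed (rule gS)
    moreover have "torus_holomorphic L g"
      using f(5) by (subst torus_holomorphic_cong) (simp_all add: g_def)
    ultimately have "g \<in> carrier End" by (simp add: torus_End_simps g_def)
    moreover have "f \<in> carrier End" using f by (simp add: torus_End_simps)
    moreover have "f \<otimes>\<^bsub>End\<^esub> g = \<one>\<^bsub>End\<^esub>" "g \<otimes>\<^bsub>End\<^esub> f = \<one>\<^bsub>End\<^esub>"
      by (simp_all add: torus_End_simps compose_def fg gf cong: restrict_cong)
    ultimately show "f \<in> {f \<in> carrier End. \<exists>g\<in>carrier End.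
     f \<otimes>\<^bsub>End\<^esub> g = \<one>\<^bsub>End\<^esub> \<and> g \<otimes>\<^bsub>End\<^esub> f = \<one>\<^bsub>End\<^esub>}" by blast
  next
    fix f assume "f \<in> {f \<in> carrier End. \<exists>g\<in>carrier End.
     f \<otimes>\<^bsub>End\<^esub> g = \<one>\<^bsub>End\<^esub> \<and> g \<otimes>\<^bsub>End\<^esub> f = \<one>\<^bsub>End\<^esub>}"
    then obtain g where fg: "f \<in> carrier End" "g \<in> carrier End"
      "f \<otimes>\<^bsub>End\<^esub> g = \<one>\<^bsub>End\<^esub>" "g \<otimes>\<^bsub>End\<^esub> f = \<one>\<^bsub>End\<^esub>" by blast
    have f: "f \<in> hom ?T ?T" "f \<in> extensional ?S" "torus_holomorphic L f"
      and g: "g \<in> hom ?T ?T" "torus_holomorphic L g" using fg(1,2) by (auto simp: torus_End_simps)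
    have maps: "f x \<in> ?S" "g x \<in> ?S" if "x \<in> ?S" for x
      using that f(1) g(1) by (auto simp: hom_def)
    have inv: "f (g x) = x" "g (f x) = x" if "x \<in> ?S" for x
      using fun_cong[OF fg(3), of x] fun_cong[OF fg(4), of x] that
      by (simp_all add: torus_End_simps compose_def)
    have bij: "bij_betw f ?S ?S"
      by (rule bij_betw_byWitness[of _ g]) (use inv maps in auto)
    have "inv_into ?S f x = g x" if "x \<in> ?S" for x
      using bij_betw_imp_inj_on[OF bij] inv(1)[OF that] maps(2)[OF that] inv_into_f_f by metis
    then have "torus_holomorphic L (inv_into ?S f)"
      using g(2) by (subst torus_holomorphic_cong[of _ g]) simp_all
    with f bij show "f \<in> carrier Aut" by (simp add: car auto_def Bij_def)
  qed
qed

lemma torus_Aut_mult: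
  assumes "f \<in> carrier Aut" "g \<in> carrier Aut"
  shows "f \<otimes>\<^bsub>Aut\<^esub> g = f \<otimes>\<^bsub>End\<^esub> g"
  using assms
  by (simp add: torus_Aut_def Let_def AutoGroup_def BijGroup_def auto_def torus_End_simps)

lemma torus_Aut_one: "\<one>\<^bsub>Aut\<^esub> = \<one>\<^bsub>End\<^esub>"
  by (simp add: torus_Aut_def Let_def AutoGroup_def BijGroup_def torus_End_simps)

end

section \<open>The endomorphism algebra as a subfield of the complex numbers\<close>

text \<open>The induction principle for formal sums proceeds through differences, which is why
  bilinearity is recorded for subtraction.\<close>

lemma frag_extend_diff_fun:
  fixes f g :: "'a \<Rightarrow> 'b \<Rightarrow>\<^sub>0 int"
  shows "frag_extend (\<lambda>a. f a - g a) x = frag_extend f x - frag_extend g x"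
proof -
  have "frag_cmul k (a - b) = frag_cmul k a - frag_cmul k b" for k and a b :: "'b \<Rightarrow>\<^sub>0 int"
    by (rule poly_mapping_eqI) (simp add: lookup_minus algebra_simps)
  then show ?thesis unfolding frag_extend_def by (simp add: sum_subtractf)
qed

abbreviation frag_mult :: "('a, 'b) monoid_scheme \<Rightarrow> ('a \<Rightarrow>\<^sub>0 int) \<Rightarrow> ('a \<Rightarrow>\<^sub>0 int) \<Rightarrow> ('a \<Rightarrow>\<^sub>0 int)" where
  "frag_mult M x y \<equiv> frag_extend (\<lambda>a. frag_extend (\<lambda>b. frag_of (a \<otimes>\<^bsub>M\<^esub> b)) y) x"

lemma frag_mult_diff_left: "frag_mult M (x - x') y = frag_mult M x y - frag_mult M x' y"
  by (rule frag_extend_diff)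

lemma frag_mult_diff_right: "frag_mult M x (y - y') = frag_mult M x y - frag_mult M x y'"
  by (simp add: frag_extend_diff frag_extend_diff_fun)

lemma frag_extend_zero_fun [simp]: "frag_extend (\<lambda>_. 0) x = 0"
  by (rule frag_extend_eq_0) simp

lemma keys_frag_mult:
  assumes "monoid M" "Poly_Mapping.keys x \<subseteq> carrier M" "Poly_Mapping.keys y \<subseteq> carrier M"
  shows "Poly_Mapping.keys (frag_mult M x y) \<subseteq> carrier M"
proof -
  interpret monoid M by fact
  have "Poly_Mapping.keys (frag_extend (\<lambda>b. frag_of (a \<otimes>\<^bsub>M\<^esub> b)) y) \<subseteq> carrier M" if "a \<in> carrier M" for a
    by (rule order_trans[OF keys_frag_extend]) (use assms that in \<open>auto simp: keys_frag_of\<close>)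
  then show ?thesis
    by (intro order_trans[OF keys_frag_extend]) (use assms in blast)
qed

lemma frag_mult_assoc:
  assumes "monoid M" "Poly_Mapping.keys x \<subseteq> carrier M" "Poly_Mapping.keys y \<subseteq> carrier M"
    "Poly_Mapping.keys z \<subseteq> carrier M"
  shows "frag_mult M (frag_mult M x y) z = frag_mult M x (frag_mult M y z)"
proof -
  interpret monoid M by fact
  show ?thesis
    using assms(4)
  proof (induction z rule: frag_induction)
    case (one c)
    show ?case
      using assms(3)
    proof (induction y rule: frag_induction)
      case (one b)
      show ?case
        using assms(2)
      proof (induction x rule: frag_induction)
        case (one a)
        then show ?case using \<open>b \<in> carrier M\<close> \<open>c \<in> carrier M\<close> by (simp add: m_assoc)
      qed (simp_all add: frag_extend_diff)
    qed (simp_all only: frag_mult_diff_left frag_mult_diff_right frag_extend_zero_fun frag_extend_0)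
  qed (simp_all only: frag_mult_diff_left frag_mult_diff_right frag_extend_zero_fun frag_extend_0)
qed

lemma ring_int_monoid_ring:
  assumes "monoid M"
  shows "ring (int_monoid_ring M)"
proof -
  interpret monoid M by fact
  have keys_add': "Poly_Mapping.keys (x + y) \<subseteq> carrier M"
    if "Poly_Mapping.keys x \<subseteq> carrier M" "Poly_Mapping.keys y \<subseteq> carrier M" for x y :: "'a \<Rightarrow>\<^sub>0 int"
    using that Poly_Mapping.keys_add[of x y] by blast
  show ?thesis
  proof (rule ringI)
    show "abelian_group (int_monoid_ring M)"
    proof (rule abelian_groupI)
      show "\<exists>y\<in>carrier (int_monoid_ring M). y \<oplus>\<^bsub>int_monoid_ring M\<^esub> x = \<zero>\<^bsub>int_monoid_ring M\<^esub>"
        if "x \<in> carrier (int_monoid_ring M)" for x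
        using that by (intro bexI[of _ "- x"]) (auto simp: int_monoid_ring_def)
    qed (simp_all add: int_monoid_ring_def add_ac keys_add')
    show "monoid (int_monoid_ring M)"
    proof (rule monoidI)
      fix x assume "x \<in> carrier (int_monoid_ring M)"
      then have x: "Poly_Mapping.keys x \<subseteq> carrier M" by (simp add: int_monoid_ring_def)
      from x have "frag_mult M (frag_of \<one>\<^bsub>M\<^esub>) x = x"
        by (induction x rule: frag_induction) (simp_all add: frag_extend_diff)
      then show "\<one>\<^bsub>int_monoid_ring M\<^esub> \<otimes>\<^bsub>int_monoid_ring M\<^esub> x = x" by (simp add: int_monoid_ring_def)
      from x have "frag_mult M x (frag_of \<one>\<^bsub>M\<^esub>) = x"
        by (induction x rule: frag_induction) (simp_all add: frag_extend_diff)
      then show "x \<otimes>\<^bsub>int_monoid_ring M\<^esub> \<one>\<^bsub>int_monoid_ring M\<^esub> = x" by (simp add: int_monoid_ring_def)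
    qed (use assms in \<open>auto simp: int_monoid_ring_def keys_frag_of frag_mult_assoc
        dest: keys_frag_mult[THEN subsetD]\<close>)
  next
    fix x y z
    show "(x \<oplus>\<^bsub>int_monoid_ring M\<^esub> y) \<otimes>\<^bsub>int_monoid_ring M\<^esub> z =
        x \<otimes>\<^bsub>int_monoid_ring M\<^esub> z \<oplus>\<^bsub>int_monoid_ring M\<^esub> y \<otimes>\<^bsub>int_monoid_ring M\<^esub> z"
      by (simp add: int_monoid_ring_def frag_extend_add)
    have "frag_mult M z (x + y) = frag_mult M z x + frag_mult M z y"
      using frag_mult_diff_right[where M = M and x = z and y = x and y' = "- y"]
        frag_mult_diff_right[where M = M and x = z and y = 0 and y' = y] by simp
    then show "z \<otimes>\<^bsub>int_monoid_ring M\<^esub> (x \<oplus>\<^bsub>int_monoid_ring M\<^esub> y) =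
        z \<otimes>\<^bsub>int_monoid_ring M\<^esub> x \<oplus>\<^bsub>int_monoid_ring M\<^esub> z \<otimes>\<^bsub>int_monoid_ring M\<^esub> y"
      by (simp add: int_monoid_ring_def)
  qed
qed

text \<open>The additive extension of \<open>h\<close> to formal sums. Its values lie in a real
  vector space, where both the integer multiplicities and the rational tensor factor can
  act.\<close>

definition frag_eval :: "('a \<Rightarrow> 'v::real_vector) \<Rightarrow> ('a \<Rightarrow>\<^sub>0 int) \<Rightarrow> 'v" where
  "frag_eval h c = (\<Sum>p\<in>Poly_Mapping.keys c. of_int (Poly_Mapping.lookup c p) *\<^sub>R h p)"

lemma frag_eval_superset:
  assumes "finite S" "Poly_Mapping.keys c \<subseteq> S"
  shows "frag_eval h c = (\<Sum>p\<in>S. of_int (Poly_Mapping.lookup c p) *\<^sub>R h p)"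
  unfolding frag_eval_def
  by (rule sum.mono_neutral_left) (use assms in \<open>auto simp: in_keys_iff\<close>)

lemma frag_eval_0 [simp]: "frag_eval h 0 = 0"
  by (simp add: frag_eval_def)

lemma frag_eval_of [simp]: "frag_eval h (frag_of p) = h p"
  by (simp add: frag_eval_def keys_frag_of)

lemma frag_eval_diff: "frag_eval h (x - y) = frag_eval h x - frag_eval h y"
proof -
  let ?S = "Poly_Mapping.keys x \<union> Poly_Mapping.keys y"
  have "Poly_Mapping.keys (x - y) \<subseteq> ?S" by (rule keys_diff)
  then show ?thesis
    by (simp add: frag_eval_superset[of ?S] lookup_minus scaleR_diff_left sum_subtractf)
qed

lemma frag_eval_add: "frag_eval h (x + y) = frag_eval h x + frag_eval h y"
  using frag_eval_diff[of h x "- y"] frag_eval_diff[of h 0 y] by simp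

lemma matrix_diff_mult: "(A - A') ** C = A ** C - A' ** C" "C ** (A - A') = C ** A - C ** A'"
  for A A' C :: "'a::ring_1^'n^'n"
  by (simp_all add: Finite_Cartesian_Product.vec_eq_iff matrix_matrix_mult_def algebra_simps sum_subtractf)

lemma scaleR_matrix_mult: "(s *\<^sub>R A) ** (t *\<^sub>R C) = (s * t) *\<^sub>R (A ** C)"
  for A C :: "complex^'n^'n"
  by (simp add: Finite_Cartesian_Product.vec_eq_iff matrix_matrix_mult_def scaleR_sum_right mult.commute)

section \<open>Evaluation of the tensor product by complex matrices\<close>

context lattice
begin

abbreviation "rat_ring \<equiv> (ring_of_type_algebra :: rat ring)"

abbreviation "End_rat \<equiv> End \<times>\<times> rat_ring"

abbreviation "End_frag \<equiv> int_monoid_ring End_rat"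

abbreviation "End_ideal \<equiv> Idl\<^bsub>End_frag\<^esub> (tensor_relations End rat_ring)"

lemma End0_eq: "K0 = End_frag Quot End_ideal"
  by (simp add: torus_End0_def ring_tensor_def Let_def)

lemma rat_ring_simps [simp]: "carrier rat_ring = UNIV" "x \<otimes>\<^bsub>rat_ring\<^esub> y = x * y"
    "x \<oplus>\<^bsub>rat_ring\<^esub> y = x + y" "\<one>\<^bsub>rat_ring\<^esub> = 1"
  by (simp_all add: ring_of_type_algebra_def)

lemma End_rat_simps: "carrier End_rat = carrier End \<times> UNIV"
    "(f, q) \<otimes>\<^bsub>End_rat\<^esub> (g, q') = (f \<otimes>\<^bsub>End\<^esub> g, q * q')"
    "\<one>\<^bsub>End_rat\<^esub> = (\<one>\<^bsub>End\<^esub>, 1)"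
  by (simp_all add: DirProd_def)

lemma monoid_End_rat: "monoid End_rat"
  by (rule DirProd_monoid[OF monoid_torus_End]) (rule monoidI, simp_all)

lemma End_frag_simps: "carrier End_frag = {c. Poly_Mapping.keys c \<subseteq> carrier End_rat}"
    "x \<otimes>\<^bsub>End_frag\<^esub> y = frag_mult End_rat x y" "x \<oplus>\<^bsub>End_frag\<^esub> y = x + y"
    "\<one>\<^bsub>End_frag\<^esub> = frag_of \<one>\<^bsub>End_rat\<^esub>" "\<zero>\<^bsub>End_frag\<^esub> = 0"
  by (simp_all add: int_monoid_ring_def)

text \<open>The map taking f \<otimes> q to q times the matrix of f, written on formal sums before
  the quotient is formed.\<close>

definition End_eval ::
    "(((complex^'n) set \<Rightarrow> (complex^'n) set) \<times> rat \<Rightarrow>\<^sub>0 int) \<Rightarrow> complex^'n^'n" where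
  "End_eval = frag_eval (\<lambda>p. (of_rat (snd p) :: real) *\<^sub>R torus_matrix (fst p))"

lemma End_eval_of: "End_eval (frag_of (f, q)) = (of_rat q :: real) *\<^sub>R torus_matrix f"
  by (simp add: End_eval_def)

lemma End_eval_add: "End_eval (x + y) = End_eval x + End_eval y"
  by (simp add: End_eval_def frag_eval_add)

lemma End_eval_diff: "End_eval (x - y) = End_eval x - End_eval y"
  by (simp add: End_eval_def frag_eval_diff)

lemma End_eval_0 [simp]: "End_eval 0 = 0"
  by (simp add: End_eval_def)

lemma End_eval_one: "End_eval \<one>\<^bsub>End_frag\<^esub> = mat 1"
  by (simp add: End_frag_simps End_rat_simps End_eval_of torus_matrix_one)

lemma End_eval_mult:
  assumes "x \<in> carrier End_frag" "y \<in> carrier End_frag"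
  shows "End_eval (x \<otimes>\<^bsub>End_frag\<^esub> y) = End_eval x ** End_eval y"
proof -
  have x: "Poly_Mapping.keys x \<subseteq> carrier End_rat" and y: "Poly_Mapping.keys y \<subseteq> carrier End_rat"
    using assms by (simp_all add: End_frag_simps)
  have 0: "0 ** A = 0" "A ** 0 = 0" for A :: "complex^'n^'n"
    by (simp_all add: Finite_Cartesian_Product.vec_eq_iff matrix_matrix_mult_def)
  have "End_eval (frag_mult End_rat x y) = End_eval x ** End_eval y"
    using y
  proof (induction y rule: frag_induction)
    case (one b)
    show ?case
      using x
    proof (induction x rule: frag_induction)
      case (one a)
      obtain f q where a: "a = (f, q)" by (cases a)
      obtain g q' where b: "b = (g, q')" by (cases b)
      show ?case
        using \<open>a \<in> carrier End_rat\<close> \<open>b \<in> carrier End_rat\<close>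
        by (simp add: a b End_rat_simps End_eval_of scaleR_matrix_mult torus_matrix_mult of_rat_mult)
    qed (simp_all add: frag_extend_diff End_eval_diff matrix_diff_mult 0)
  qed (simp_all only: frag_mult_diff_right frag_extend_0 frag_extend_zero_fun End_eval_diff matrix_diff_mult 0 End_eval_0)
  then show ?thesis by (simp add: End_frag_simps)
qed

lemma ring_End_frag: "ring End_frag"
  by (rule ring_int_monoid_ring[OF monoid_End_rat])

lemma frag_of_End_frag: "f \<in> carrier End \<Longrightarrow> frag_of (f, q) \<in> carrier End_frag"
  by (simp add: End_frag_simps End_rat_simps)

lemma End_frag_diff_closed:
  "x \<in> carrier End_frag \<Longrightarrow> y \<in> carrier End_frag \<Longrightarrow> x - y \<in> carrier End_frag"
  using keys_diff[of x y] by (auto simp: End_frag_simps)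

lemma tensor_relations_subset:
  "tensor_relations End rat_ring \<subseteq> {c \<in> carrier End_frag. End_eval c = 0}"
  unfolding tensor_relations_def
  by (auto intro!: End_frag_diff_closed frag_of_End_frag torus_End_add_closed
      simp: End_eval_diff End_eval_of torus_matrix_add of_rat_add
        scaleR_add_left scaleR_add_right)

lemma ideal_End_ideal: "ideal End_ideal End_frag"
  by (rule ring.genideal_ideal[OF ring_End_frag]) (use tensor_relations_subset in blast)

text \<open>The kernel of the evaluation is an ideal containing the tensor relations, so it contains
  the ideal they generate.\<close>

lemma End_ideal_eval:
  assumes "c \<in> End_ideal"
  shows "End_eval c = 0"
proof -
  interpret ring End_frag by (rule ring_End_frag)
  have "ideal {c \<in> carrier End_frag. End_eval c = 0} End_frag"
  proof (rule idealI)
    show "subgroup {c \<in> carrier End_frag. End_eval c = 0} (add_monoid End_frag)"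
    proof (rule group.subgroupI)
      show "inv\<^bsub>add_monoid End_frag\<^esub> a \<in> {c \<in> carrier End_frag. End_eval c = 0}"
        if "a \<in> {c \<in> carrier End_frag. End_eval c = 0}" for a
      proof -
        have a: "a \<in> carrier End_frag" "End_eval a = 0" using that by auto
        have "\<ominus>\<^bsub>End_frag\<^esub> a + a = 0" using l_neg[OF a(1)] by (simp add: End_frag_simps)
        then have "End_eval (\<ominus>\<^bsub>End_frag\<^esub> a) = 0"
          using End_eval_add[of "\<ominus>\<^bsub>End_frag\<^esub> a" a] a(2) by simp
        then show ?thesis using a_inv_closed[OF a(1)] by (simp add: a_inv_def)
      qed
      show "{c \<in> carrier End_frag. End_eval c = 0} \<noteq> {}"
        using zero_closed by (auto simp: End_frag_simps intro!: exI[of _ 0])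
      show "a \<otimes>\<^bsub>add_monoid End_frag\<^esub> b \<in> {c \<in> carrier End_frag. End_eval c = 0}"
        if "a \<in> {c \<in> carrier End_frag. End_eval c = 0}" "b \<in> {c \<in> carrier End_frag. End_eval c = 0}" for a b
        using that a_closed[of a b] End_eval_add[of a b] by (simp add: End_frag_simps)
    qed (use a_group in auto)
  next
    have 0: "0 ** A = 0" "A ** 0 = 0" for A :: "complex^'n^'n"
      by (simp_all add: Finite_Cartesian_Product.vec_eq_iff matrix_matrix_mult_def)
    fix a x assume *: "a \<in> {c \<in> carrier End_frag. End_eval c = 0}" "x \<in> carrier End_frag"
    show "x \<otimes>\<^bsub>End_frag\<^esub> a \<in> {c \<in> carrier End_frag. End_eval c = 0}"
      using * End_eval_mult[of x a] m_closed[of x a] 0 by simp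
    show "a \<otimes>\<^bsub>End_frag\<^esub> x \<in> {c \<in> carrier End_frag. End_eval c = 0}"
      using * End_eval_mult[of a x] m_closed[of a x] 0 by simp
  qed (rule ring_End_frag)
  from genideal_minimal[OF this tensor_relations_subset] assms show ?thesis by blast
qed

definition End_class where "End_class c = End_ideal +>\<^bsub>End_frag\<^esub> c"

lemma End_class_hom: "End_class \<in> ring_hom End_frag K0"
  unfolding End0_eq End_class_def[abs_def] by (rule ideal.rcos_ring_hom[OF ideal_End_ideal])

lemma carrier_End0: "carrier K0 = End_class ` carrier End_frag"
  by (auto simp: End0_eq FactRing_def A_RCOSETS_def' End_class_def)

text \<open>Evaluation is well defined on \<open>K0\<close>. Injectivity is not settled here; it
  comes from the field structure.\<close>

lemma End_class_eval:
  assumes "c \<in> carrier End_frag" "c' \<in> carrier End_frag" "End_class c = End_class c'"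
  shows "End_eval c = End_eval c'"
proof -
  interpret ideal End_ideal End_frag by (rule ideal_End_ideal)
  have "c \<in> End_class c'" using a_rcos_self[OF assms(1)] assms(3) by (simp add: End_class_def)
  then obtain i where "i \<in> End_ideal" "c = i + c'"
    by (auto simp: End_class_def a_r_coset_def' End_frag_simps)
  then show ?thesis by (simp add: End_eval_add End_ideal_eval)
qed

end

lemma (in comm_group) two_element_torsion:
  assumes m: "m \<in> carrier G" "m \<noteq> \<one>" "m \<otimes> m = \<one>" and tor: "torsion G = {\<one>, m}"
  shows "subgroup (torsion G) G" and "cyclic_group (G\<lparr>carrier := torsion G\<rparr>)"
    and "order (G\<lparr>carrier := torsion G\<rparr>) = 2"
proof -
  show sub: "subgroup (torsion G) G"
    by (rule subgroupI) (use m inv_equality[OF m(3)] in \<open>auto simp: tor\<close>)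
  interpret H: group "G\<lparr>carrier := torsion G\<rparr>" by (rule subgroup_imp_group[OF sub])
  have mem: "m \<in> carrier (G\<lparr>carrier := torsion G\<rparr>)" by (simp add: tor)
  have "carrier (G\<lparr>carrier := torsion G\<rparr>) \<subseteq> range (\<lambda>n::int. m [^]\<^bsub>G\<lparr>carrier := torsion G\<rparr>\<^esub> n)"
  proof
    fix x assume "x \<in> carrier (G\<lparr>carrier := torsion G\<rparr>)"
    then have "x = \<one> \<or> x = m" by (simp add: tor)
    then show "x \<in> range (\<lambda>n::int. m [^]\<^bsub>G\<lparr>carrier := torsion G\<rparr>\<^esub> n)"
    proof
      assume "x = \<one>"
      then have "x = m [^]\<^bsub>G\<lparr>carrier := torsion G\<rparr>\<^esub> (0::int)" by simp
      then show ?thesis by (rule range_eqI)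
    next
      assume "x = m"
      then have "x = m [^]\<^bsub>G\<lparr>carrier := torsion G\<rparr>\<^esub> (1::int)" using H.int_pow_1[OF mem] by simp
      then show ?thesis by (rule range_eqI)
    qed
  qed
  moreover have "range (\<lambda>n::int. m [^]\<^bsub>G\<lparr>carrier := torsion G\<rparr>\<^esub> n) \<subseteq> carrier (G\<lparr>carrier := torsion G\<rparr>)"
    using H.int_pow_closed[OF mem] by blast
  ultimately have "carrier (G\<lparr>carrier := torsion G\<rparr>) = range (\<lambda>n::int. m [^]\<^bsub>G\<lparr>carrier := torsion G\<rparr>\<^esub> n)"
    by (rule antisym)
  with mem show "cyclic_group (G\<lparr>carrier := torsion G\<rparr>)" unfolding H.cyclic_group by blast
  show "order (G\<lparr>carrier := torsion G\<rparr>) = 2" using m(2) by (simp add: order_def tor)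
qed

text \<open>Evaluation depends only on the class, and classes commute in the field
  \<open>K0\<close>; hence the matrices commute.\<close>

lemma (in lattice) End0_joint_eigenvector:
  assumes "field K0"
  obtains v where "v \<noteq> 0" "\<And>c. c \<in> carrier End_frag \<Longrightarrow> \<exists>e. End_eval c *v v = e *s v"
proof -
  interpret K: field "K0" by fact
  interpret F: ring End_frag by (rule ring_End_frag)
  have comm: "A ** A' = A' ** A" if AA': "A \<in> End_eval ` carrier End_frag" "A' \<in> End_eval ` carrier End_frag" for A A'
  proof -
    from AA' obtain c c' where c: "c \<in> carrier End_frag" "c' \<in> carrier End_frag"
      "A = End_eval c" "A' = End_eval c'" by blast
    have "End_class c \<in> carrier K0" "End_class c' \<in> carrier K0"
      using c by (simp_all add: carrier_End0)
    then have "End_class (c \<otimes>\<^bsub>End_frag\<^esub> c') = End_class (c' \<otimes>\<^bsub>End_frag\<^esub> c)"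
      using c ring_hom_mult[OF End_class_hom] K.m_comm by metis
    from End_class_eval[OF _ _ this] c show ?thesis by (simp add: End_eval_mult)
  qed
  show thesis
    by (rule commuting_joint_eigenvector[of "End_eval ` carrier End_frag", OF comm]) (auto intro: that)
qed

section \<open>The eigenvalue on a fixed joint eigenvector as an embedding of the endomorphism
  algebra\<close>

locale torus_field = lattice B L for B L :: "(complex^'n) set" +
  fixes v :: "complex^'n"
  assumes field_End0: "field K0" and v_nonzero: "v \<noteq> 0"
    and eigen: "\<And>c. c \<in> carrier End_frag \<Longrightarrow> \<exists>e. End_eval c *v v = e *s v"
begin

sublocale K: field "K0" by (rule field_End0)
sublocale F: ring End_frag by (rule ring_End_frag)

definition eigenvalue :: "complex^'n^'n \<Rightarrow> complex" where
  "eigenvalue A = (SOME e. A *v v = e *s v)"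

lemma eigenvalue_eqI: "A *v v = e *s v \<Longrightarrow> eigenvalue A = e"
  unfolding eigenvalue_def using v_nonzero by (intro some_equality) auto

lemma eigenvalue_eval: "c \<in> carrier End_frag \<Longrightarrow> End_eval c *v v = eigenvalue (End_eval c) *s v"
  using eigen eigenvalue_eqI by metis

definition emb where
  "emb \<alpha> = eigenvalue (End_eval (SOME c. c \<in> carrier End_frag \<and> End_class c = \<alpha>))"

lemma emb_class:
  assumes "c \<in> carrier End_frag"
  shows "emb (End_class c) = eigenvalue (End_eval c)"
proof -
  define c' where "c' = (SOME c'. c' \<in> carrier End_frag \<and> End_class c' = End_class c)"
  have "c' \<in> carrier End_frag \<and> End_class c' = End_class c"
    unfolding c'_def by (rule someI[of _ c]) (use assms in simp)
  then have "End_eval c' = End_eval c" using assms by (intro End_class_eval) auto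
  then show ?thesis by (simp add: emb_def c'_def)
qed

lemma eigenvalue_add:
  "x \<in> carrier End_frag \<Longrightarrow> y \<in> carrier End_frag \<Longrightarrow>
    eigenvalue (End_eval x + End_eval y) = eigenvalue (End_eval x) + eigenvalue (End_eval y)"
  by (rule eigenvalue_eqI) (simp add: eigenvalue_eval matrix_vector_mult_add_rdistrib vec.scale_left_distrib)

lemma eigenvalue_diff:
  "x \<in> carrier End_frag \<Longrightarrow> y \<in> carrier End_frag \<Longrightarrow>
    eigenvalue (End_eval x - End_eval y) = eigenvalue (End_eval x) - eigenvalue (End_eval y)"
  by (rule eigenvalue_eqI) (simp add: eigenvalue_eval matrix_vector_mult_diff_rdistrib vec.scale_left_diff_distrib)

lemma eigenvalue_mult:
  assumes "x \<in> carrier End_frag" "y \<in> carrier End_frag"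
  shows "eigenvalue (End_eval x ** End_eval y) = eigenvalue (End_eval x) * eigenvalue (End_eval y)"
proof (rule eigenvalue_eqI)
  have "(End_eval x ** End_eval y) *v v = End_eval x *v (End_eval y *v v)"
    by (simp add: matrix_vector_mul_assoc)
  also have "\<dots> = eigenvalue (End_eval y) *s (End_eval x *v v)"
    by (subst eigenvalue_eval[OF assms(2)]) (rule vec.scale)
  also have "\<dots> = (eigenvalue (End_eval x) * eigenvalue (End_eval y)) *s v"
    by (subst eigenvalue_eval[OF assms(1)]) (simp add: mult.commute)
  finally show "(End_eval x ** End_eval y) *v v = (eigenvalue (End_eval x) * eigenvalue (End_eval y)) *s v" .
qed

lemma eigenvalue_one: "eigenvalue (mat 1) = 1"
  by (rule eigenvalue_eqI) simp

lemma emb_add: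
  assumes "\<alpha> \<in> carrier K0" "\<beta> \<in> carrier K0"
  shows "emb (\<alpha> \<oplus>\<^bsub>K0\<^esub> \<beta>) = emb \<alpha> + emb \<beta>"
proof -
  from assms obtain x y where xy: "x \<in> carrier End_frag" "y \<in> carrier End_frag"
    "\<alpha> = End_class x" "\<beta> = End_class y" by (auto simp: carrier_End0)
  then have "\<alpha> \<oplus>\<^bsub>K0\<^esub> \<beta> = End_class (x + y)"
    using ring_hom_add[OF End_class_hom xy(1,2)] by (simp add: End_frag_simps)
  moreover have "x + y \<in> carrier End_frag" using F.a_closed[OF xy(1,2)] by (simp add: End_frag_simps)
  ultimately show ?thesis using xy by (simp add: emb_class End_eval_add eigenvalue_add)
qed

lemma emb_mult:
  assumes "\<alpha> \<in> carrier K0" "\<beta> \<in> carrier K0"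
  shows "emb (\<alpha> \<otimes>\<^bsub>K0\<^esub> \<beta>) = emb \<alpha> * emb \<beta>"
proof -
  from assms obtain x y where xy: "x \<in> carrier End_frag" "y \<in> carrier End_frag"
    "\<alpha> = End_class x" "\<beta> = End_class y" by (auto simp: carrier_End0)
  then have "\<alpha> \<otimes>\<^bsub>K0\<^esub> \<beta> = End_class (x \<otimes>\<^bsub>End_frag\<^esub> y)"
    using ring_hom_mult[OF End_class_hom xy(1,2)] by simp
  with xy show ?thesis by (simp add: emb_class End_eval_mult eigenvalue_mult)
qed

lemma emb_one: "emb \<one>\<^bsub>K0\<^esub> = 1"
proof -
  have "emb (End_class \<one>\<^bsub>End_frag\<^esub>) = eigenvalue (End_eval \<one>\<^bsub>End_frag\<^esub>)"
    by (rule emb_class) simp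
  then show ?thesis using ring_hom_one[OF End_class_hom] by (simp add: End_eval_one eigenvalue_one)
qed

lemma emb_zero: "emb \<zero>\<^bsub>K0\<^esub> = 0"
  using emb_add[OF K.zero_closed K.zero_closed] by simp

lemma emb_uminus: "\<alpha> \<in> carrier K0 \<Longrightarrow> emb (\<ominus>\<^bsub>K0\<^esub> \<alpha>) = - emb \<alpha>"
  using emb_add[of \<alpha> "\<ominus>\<^bsub>K0\<^esub> \<alpha>"] by (simp add: K.r_neg emb_zero eq_neg_iff_add_eq_0 add.commute)

lemma emb_inverse:
  assumes "\<alpha> \<in> carrier K0" "\<alpha> \<noteq> \<zero>\<^bsub>K0\<^esub>"
  shows "emb (inv\<^bsub>K0\<^esub> \<alpha>) = inverse (emb \<alpha>)" "emb \<alpha> \<noteq> 0"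
proof -
  have "\<alpha> \<in> Units K0" using assms K.field_Units by simp
  then have "emb \<alpha> * emb (inv\<^bsub>K0\<^esub> \<alpha>) = 1"
    using emb_mult[OF assms(1), of "inv\<^bsub>K0\<^esub> \<alpha>"] K.Units_inv_closed[of \<alpha>]
    by (simp add: emb_one)
  then show "emb (inv\<^bsub>K0\<^esub> \<alpha>) = inverse (emb \<alpha>)" "emb \<alpha> \<noteq> 0"
    by (simp_all add: inverse_unique) auto
qed

lemma emb_pow: "\<alpha> \<in> carrier K0 \<Longrightarrow> emb (\<alpha> [^]\<^bsub>K0\<^esub> (n::nat)) = emb \<alpha> ^ n"
  by (induction n) (simp_all add: emb_one emb_mult)

text \<open>A unital homomorphism out of a field: invertibility forces non-zero elements to have
  non-zero values.\<close>

lemma emb_inj: "inj_on emb (carrier K0)"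
proof (rule inj_onI)
  fix \<alpha> \<beta> assume ab: "\<alpha> \<in> carrier K0" "\<beta> \<in> carrier K0" "emb \<alpha> = emb \<beta>"
  then have "emb (\<alpha> \<oplus>\<^bsub>K0\<^esub> \<ominus>\<^bsub>K0\<^esub> \<beta>) = 0" by (simp add: emb_add emb_uminus)
  then have "\<alpha> \<oplus>\<^bsub>K0\<^esub> \<ominus>\<^bsub>K0\<^esub> \<beta> = \<zero>\<^bsub>K0\<^esub>"
    using emb_inverse(2)[of "\<alpha> \<oplus>\<^bsub>K0\<^esub> \<ominus>\<^bsub>K0\<^esub> \<beta>"] ab by auto
  then show "\<alpha> = \<beta>" using ab by (metis K.minus_equality K.minus_minus K.a_inv_closed K.a_comm)
qed

text \<open>The image of the endomorphism ring itself under the embedding; it is the order whose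
  units are to be computed.\<close>

definition order_ring :: "complex set" where "order_ring = eigenvalue ` lattice_matrices"

definition frag_of_matrix where "frag_of_matrix A = frag_of (torus_map A, 1 :: rat)"

lemma frag_of_matrix:
  assumes "A \<in> lattice_matrices"
  shows "frag_of_matrix A \<in> carrier End_frag" "End_eval (frag_of_matrix A) = A"
  using assms
  by (simp_all add: frag_of_matrix_def frag_of_End_frag torus_map_End End_eval_of torus_matrix_map)

lemma lattice_eigenvalue:
  assumes "A \<in> lattice_matrices" "A' \<in> lattice_matrices"
  shows "eigenvalue (A + A') = eigenvalue A + eigenvalue A'"
    "eigenvalue (A - A') = eigenvalue A - eigenvalue A'"
    "eigenvalue (A ** A') = eigenvalue A * eigenvalue A'"
  using eigenvalue_add[OF frag_of_matrix(1) frag_of_matrix(1), of A A']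
    eigenvalue_diff[OF frag_of_matrix(1) frag_of_matrix(1), of A A']
    eigenvalue_mult[OF frag_of_matrix(1) frag_of_matrix(1), of A A'] assms
  by (simp_all add: frag_of_matrix(2))

text \<open>The eigenvalue of A is the embedded value of the class of A \<otimes> 1. The class is
  therefore determined by the eigenvalue, and evaluating the class returns the matrix.\<close>

lemma eigenvalue_inj: "inj_on eigenvalue lattice_matrices"
proof (rule inj_onI)
  fix A A' assume A: "A \<in> lattice_matrices" "A' \<in> lattice_matrices" "eigenvalue A = eigenvalue A'"
  then have "emb (End_class (frag_of_matrix A)) = emb (End_class (frag_of_matrix A'))"
    by (simp add: emb_class frag_of_matrix)
  then have "End_class (frag_of_matrix A) = End_class (frag_of_matrix A')"
    using A by (intro inj_onD[OF emb_inj]) (auto simp: carrier_End0 frag_of_matrix)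
  then have "End_eval (frag_of_matrix A) = End_eval (frag_of_matrix A')"
    using A by (intro End_class_eval) (simp_all add: frag_of_matrix)
  then show "A = A'" using A by (simp add: frag_of_matrix)
qed

lemma eigenvalue_scaleR:
  assumes "A \<in> lattice_matrices"
  shows "eigenvalue (t *\<^sub>R A) = of_real t * eigenvalue A"
proof (rule eigenvalue_eqI)
  have "(t *\<^sub>R A) *v v = t *\<^sub>R (A *v v)"
    by (simp add: Finite_Cartesian_Product.vec_eq_iff matrix_vector_mult_def scaleR_sum_right)
  also have "A *v v = eigenvalue A *s v"
    using eigenvalue_eval[OF frag_of_matrix(1)] assms by (simp add: frag_of_matrix)
  finally show "(t *\<^sub>R A) *v v = (of_real t * eigenvalue A) *s v"
    by (simp add: Finite_Cartesian_Product.vec_eq_iff scaleR_conv_of_real[where 'a = complex])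
qed

lemma of_real_of_rat: "complex_of_real (of_rat q) = of_rat q"
  by (cases q) (simp add: of_rat_rat)

text \<open>A generator f \<otimes> q has eigenvalue q times an element of the order; conversely the
  image is a rational subspace containing the order.\<close>

lemma emb_image: "emb ` carrier K0 = rat_vec.span order_ring"
proof (rule antisym)
  have "eigenvalue (End_eval c) \<in> rat_vec.span order_ring" if c: "c \<in> carrier End_frag" for c
  proof -
    have "Poly_Mapping.keys c \<subseteq> carrier End_rat" using c by (simp add: End_frag_simps)
    then have "c \<in> carrier End_frag \<and> eigenvalue (End_eval c) \<in> rat_vec.span order_ring"
    proof (induction c rule: frag_induction)
      case zero
      have "eigenvalue 0 = 0" by (rule eigenvalue_eqI) (simp add: Finite_Cartesian_Product.vec_eq_iff matrix_vector_mult_def)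
      then show ?case using F.zero_closed by (simp add: End_frag_simps rat_vec.span_zero)
    next
      case (one p)
      obtain f q where p: "p = (f, q)" by (cases p)
      with one have f: "f \<in> carrier End" by (simp add: End_rat_simps)
      have "eigenvalue (End_eval (frag_of p)) = of_rat q * eigenvalue (torus_matrix f)"
        by (simp add: p End_eval_of eigenvalue_scaleR torus_matrix_mem[OF f] of_real_of_rat)
      also have "\<dots> \<in> rat_vec.span order_ring"
        using torus_matrix_mem[OF f] by (intro rat_vec.span_scale rat_vec.span_base) (simp add: order_ring_def)
      finally show ?case using frag_of_End_frag[OF f] p by simp
    next
      case (diff a b)
      then show ?case
        by (simp add: End_eval_diff eigenvalue_diff End_frag_diff_closed rat_vec.span_diff)
    qed
    then show ?thesis ..
  qed
  then show "emb ` carrier K0 \<subseteq> rat_vec.span order_ring"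
    by (auto simp: carrier_End0 emb_class)
  have "rat_vec.subspace (emb ` carrier K0)"
    unfolding rat_vec.subspace_def
  proof (intro conjI ballI allI)
    show "0 \<in> emb ` carrier K0" using emb_zero K.zero_closed by (metis imageI)
    show "x + y \<in> emb ` carrier K0"
      if "x \<in> emb ` carrier K0" "y \<in> emb ` carrier K0" for x y
      using that by (auto simp flip: emb_add)
    fix q x assume "x \<in> emb ` carrier K0"
    then obtain \<alpha> where \<alpha>: "\<alpha> \<in> carrier K0" "x = emb \<alpha>" by blast
    \<comment> \<open>The class of 1 \<otimes> q, which realises the rational scalar q inside the
      endomorphism algebra.\<close>
    define Q where "Q = End_class (frag_of (\<one>\<^bsub>End\<^esub>, q))"
    have fr: "frag_of (\<one>\<^bsub>End\<^esub>, q) \<in> carrier End_frag"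
      by (rule frag_of_End_frag[OF torus_End_one_closed])
    then have Q: "Q \<in> carrier K0" by (simp add: Q_def carrier_End0)
    have "emb Q = of_rat q"
      using lattice_matrices_one
      by (simp add: Q_def emb_class[OF fr] End_eval_of torus_matrix_one eigenvalue_scaleR eigenvalue_one
          of_real_of_rat)
    then have "of_rat q * x = emb (Q \<otimes>\<^bsub>K0\<^esub> \<alpha>)" by (simp add: emb_mult[OF Q \<alpha>(1)] \<alpha>(2))
    then show "of_rat q * x \<in> emb ` carrier K0" using Q \<alpha> by auto
  qed
  moreover have "order_ring \<subseteq> emb ` carrier K0"
  proof
    fix x assume "x \<in> order_ring"
    then obtain A where A: "A \<in> lattice_matrices" "x = eigenvalue A" by (auto simp: order_ring_def)
    then have "x = emb (End_class (frag_of_matrix A))" by (simp add: emb_class frag_of_matrix)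
    then show "x \<in> emb ` carrier K0" using A by (simp add: carrier_End0 frag_of_matrix)
  qed
  ultimately show "rat_vec.span order_ring \<subseteq> emb ` carrier K0"
    by (intro rat_vec.span_minimal)
qed

text \<open>The degree of a number field is counted over the abstract prime field, whereas spans in
  \<complex> are taken over \<rat>; this identifies the two scalar fields.\<close>

lemma emb_prime_field: "emb ` generate_field K0 {} = range of_rat"
proof
  let ?P = "generate_field K0 {}"
  have PK: "\<alpha> \<in> carrier K0" if "\<alpha> \<in> ?P" for \<alpha>
    using K.generate_field_in_carrier[OF _ that] by simp
  show "emb ` ?P \<subseteq> range of_rat"
  proof (rule image_subsetI)
    fix \<alpha> assume "\<alpha> \<in> ?P"
    then show "emb \<alpha> \<in> range of_rat"
    proof (induction rule: generate_field.induct)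
      case one
      show ?case using emb_one by (metis of_rat_1 rangeI)
    next
      case (a_inv h)
      then obtain q where "emb h = of_rat q" by blast
      then have "emb (\<ominus>\<^bsub>K0\<^esub> h) = of_rat (- q)"
        using emb_uminus[OF PK[OF a_inv(1)]] by (simp add: of_rat_minus)
      then show ?case by simp
    next
      case (m_inv h)
      then obtain q where "emb h = of_rat q" by blast
      then have "emb (inv\<^bsub>K0\<^esub> h) = of_rat (inverse q)"
        using emb_inverse(1)[OF PK[OF m_inv(1)] m_inv(2)] by (simp add: of_rat_inverse)
      then show ?case by simp
    next
      case (eng_add h1 h2)
      then obtain q q' where "emb h1 = of_rat q" "emb h2 = of_rat q'" by blast
      then have "emb (h1 \<oplus>\<^bsub>K0\<^esub> h2) = of_rat (q + q')"
        using emb_add[OF PK[OF eng_add(1)] PK[OF eng_add(2)]] by (simp add: of_rat_add)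
      then show ?case by simp
    next
      case (eng_mult h1 h2)
      then obtain q q' where "emb h1 = of_rat q" "emb h2 = of_rat q'" by blast
      then have "emb (h1 \<otimes>\<^bsub>K0\<^esub> h2) = of_rat (q * q')"
        using emb_mult[OF PK[OF eng_mult(1)] PK[OF eng_mult(2)]] by (simp add: of_rat_mult)
      then show ?case by simp
    qed simp
  qed
  have one: "1 \<in> emb ` ?P" using emb_one generate_field.one by (metis imageI)
  have add: "x + y \<in> emb ` ?P" if "x \<in> emb ` ?P" "y \<in> emb ` ?P" for x y
    using that generate_field.eng_add by (auto simp: PK simp flip: emb_add intro!: imageI)
  have mult: "x * y \<in> emb ` ?P" if "x \<in> emb ` ?P" "y \<in> emb ` ?P" for x y
    using that generate_field.eng_mult by (auto simp: PK simp flip: emb_mult intro!: imageI)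
  have uminus: "- x \<in> emb ` ?P" if "x \<in> emb ` ?P" for x
    using that generate_field.a_inv by (auto simp: PK simp flip: emb_uminus intro!: imageI)
  have inverse: "inverse x \<in> emb ` ?P" if x: "x \<in> emb ` ?P" "x \<noteq> 0" for x
  proof -
    from x obtain \<alpha> where \<alpha>: "\<alpha> \<in> ?P" "x = emb \<alpha>" by blast
    then have "\<alpha> \<noteq> \<zero>\<^bsub>K0\<^esub>" using x emb_zero by auto
    then have "inverse x = emb (inv\<^bsub>K0\<^esub> \<alpha>)" "inv\<^bsub>K0\<^esub> \<alpha> \<in> ?P"
      using \<alpha> by (simp_all add: emb_inverse PK generate_field.m_inv)
    then show ?thesis by blast
  qed
  have int: "of_int n \<in> emb ` ?P" for n
  proof (induction n rule: int_induct[where k = 0])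
    case base
    show ?case using add[OF one uminus[OF one]] by simp
  next
    case (step1 i)
    show ?case using add[OF step1(2) one] by simp
  next
    case (step2 i)
    show ?case using add[OF step2(2) uminus[OF one]] by simp
  qed
  show "range of_rat \<subseteq> emb ` ?P"
  proof (rule image_subsetI)
    fix q :: rat
    obtain a d :: int where "q = of_int a / of_int d" "d > 0"
      by (cases q) (simp add: Fract_of_int_quotient)
    then have "(of_rat q :: complex) = of_int a * inverse (of_int d)" by (simp only: of_rat_divide of_rat_of_int_eq divide_inverse[symmetric])
    then show "of_rat q \<in> emb ` ?P" using mult[OF int inverse[OF int]] \<open>d > 0\<close> by simp
  qed
qed

text \<open>Each line extension in the inductive definition of \<open>dimension\<close> contributes
  one vector, and injectivity of the embedding keeps it outside the span of the earlier
  ones.\<close>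

lemma emb_dimension:
  assumes "K.dimension n (generate_field K0 {}) E"
  shows "E \<subseteq> carrier K0 \<and>
    (\<exists>S. finite S \<and> card S = n \<and> rat_vec.independent S \<and> rat_vec.span S = emb ` E)"
  using assms
proof (induction n "generate_field K0 {}" E rule: K.dimension.induct)
  case zero_dim
  show ?case by (auto intro!: exI[of _ "{}"] simp: emb_zero rat_vec.independent_empty)
next
  case (Suc_dim w E n)
  then obtain S where S: "finite S" "card S = n" "rat_vec.independent S" "rat_vec.span S = emb ` E"
    and E: "E \<subseteq> carrier K0" by blast
  let ?P = "generate_field K0 {}"
  have PK: "\<alpha> \<in> carrier K0" if "\<alpha> \<in> ?P" for \<alpha>
    using K.generate_field_in_carrier[OF _ that] by simp
  have closed: "k \<otimes>\<^bsub>K0\<^esub> w \<oplus>\<^bsub>K0\<^esub> u \<in> carrier K0"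
    if "k \<in> ?P" "u \<in> E" for k u
    by (rule K.a_closed[OF K.m_closed[OF PK[OF that(1)] Suc_dim(1)] subsetD[OF E that(2)]])
  have sub: "K.line_extension ?P w E \<subseteq> carrier K0"
    by (auto simp: K.line_extension_mem_iff closed)
  have nw: "emb w \<notin> rat_vec.span S"
  proof
    assume "emb w \<in> rat_vec.span S"
    then obtain \<alpha> where "\<alpha> \<in> E" "emb w = emb \<alpha>" using S(4) by auto
    then have "w = \<alpha>" using E Suc_dim(1) by (intro inj_onD[OF emb_inj]) auto
    with \<open>\<alpha> \<in> E\<close> Suc_dim(2) show False by simp
  qed
  have "rat_vec.span (insert (emb w) S) = emb ` K.line_extension ?P w E"
  proof (intro equalityI subsetI)
    fix x assume "x \<in> rat_vec.span (insert (emb w) S)"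
    then obtain q where "x - of_rat q * emb w \<in> emb ` E"
      using S(4) rat_vec.span_breakdown_eq[of x "emb w" S] by auto
    then obtain \<alpha> where \<alpha>: "\<alpha> \<in> E" "x = of_rat q * emb w + emb \<alpha>" by (metis add.commute diff_add_cancel imageE)
    obtain Q where Q: "Q \<in> ?P" "of_rat q = emb Q" using emb_prime_field by (metis imageE rangeI)
    have "x = emb (Q \<otimes>\<^bsub>K0\<^esub> w \<oplus>\<^bsub>K0\<^esub> \<alpha>)"
      using \<alpha> Q E Suc_dim(1) PK[OF Q(1)] by (simp add: emb_add emb_mult subsetD)
    moreover have "Q \<otimes>\<^bsub>K0\<^esub> w \<oplus>\<^bsub>K0\<^esub> \<alpha> \<in> K.line_extension ?P w E"
      unfolding K.line_extension_mem_iff using \<alpha>(1) Q(1) by blast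
    ultimately show "x \<in> emb ` K.line_extension ?P w E" by (rule image_eqI)
  next
    fix x assume "x \<in> emb ` K.line_extension ?P w E"
    then obtain Q \<alpha> where qa: "Q \<in> ?P" "\<alpha> \<in> E" "x = emb (Q \<otimes>\<^bsub>K0\<^esub> w \<oplus>\<^bsub>K0\<^esub> \<alpha>)"
      by (auto simp: K.line_extension_mem_iff)
    then have x: "x = emb Q * emb w + emb \<alpha>"
      using E Suc_dim(1) PK[OF qa(1)] by (simp add: emb_add emb_mult subsetD)
    obtain q where "emb Q = of_rat q" using emb_prime_field qa(1) by blast
    moreover have "emb \<alpha> \<in> rat_vec.span (insert (emb w) S)"
      using S(4) qa(2) rat_vec.span_mono[of S "insert (emb w) S"] by blast
    ultimately show "x \<in> rat_vec.span (insert (emb w) S)"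
      unfolding x by (auto intro!: rat_vec.span_add rat_vec.span_scale[OF rat_vec.span_base])
  qed
  moreover have "rat_vec.independent (insert (emb w) S)" using nw S(3) by (rule rat_vec.independent_insertI)
  moreover have "card (insert (emb w) S) = Suc n"
    using S(1,2) nw rat_vec.span_base[of "emb w" S] by (subst card_insert_disjoint) auto
  ultimately show ?case using sub S(1) by (intro conjI exI[of _ "insert (emb w) S"]) auto
qed

end

section \<open>The automorphism group\<close>

lemma (in torus_field) lattice_eigenvalue_sum:
  assumes "\<And>k. k < r \<Longrightarrow> G k \<in> lattice_matrices"
  shows "(\<Sum>k<(r::nat). of_int (n k) *\<^sub>R G k) \<in> lattice_matrices \<and>
    eigenvalue (\<Sum>k<r. of_int (n k) *\<^sub>R G k) = (\<Sum>k<r. of_int (n k) * eigenvalue (G k))"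
  using assms
proof (induction r)
  case 0
  have "0 \<in> lattice_matrices"
    using lattice_matrices_diff[OF lattice_matrices_one lattice_matrices_one] by simp
  moreover have "eigenvalue 0 = 0"
    by (rule eigenvalue_eqI) (simp add: Finite_Cartesian_Product.vec_eq_iff matrix_vector_mult_def)
  ultimately show ?case by simp
next
  case (Suc r)
  have G: "of_int m *\<^sub>R G r \<in> lattice_matrices" for m
  proof (induction m rule: int_induct[where k = 0])
    case base
    show ?case using lattice_matrices_diff[OF lattice_matrices_one lattice_matrices_one] by simp
  next
    case (step1 i)
    then show ?case using lattice_matrices_add[of "of_int i *\<^sub>R G r" "G r"] Suc.prems[of r]
      by (simp add: scaleR_add_left)
  next
    case (step2 i)
    then show ?case using lattice_matrices_diff[of "of_int i *\<^sub>R G r" "G r"] Suc.prems[of r]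
      by (simp add: scaleR_diff_left)
  qed
  have "(\<Sum>k<r. of_int (n k) *\<^sub>R G k) \<in> lattice_matrices"
    "eigenvalue (\<Sum>k<r. of_int (n k) *\<^sub>R G k) = (\<Sum>k<r. of_int (n k) * eigenvalue (G k))"
    using Suc by simp_all
  then show ?case
    using lattice_matrices_add[OF _ G[of "n r"]] lattice_eigenvalue(1)[OF _ G[of "n r"]]
      eigenvalue_scaleR[of "G r" "of_int (n r)"] Suc.prems[of r]
    by simp
qed

text \<open>The eigenvalues of a basis of the lattice matrices; injectivity of the eigenvalue
  carries independence over, since a vanishing combination comes from the zero matrix.\<close>

lemma (in torus_field) order_ring_basis:
  obtains r b where "\<And>k. k < (r::nat) \<Longrightarrow> b k \<in> order_ring"
    "\<And>x. x \<in> order_ring \<Longrightarrow> \<exists>n::nat \<Rightarrow> int. x = (\<Sum>k<r. of_int (n k) * b k)"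
    "\<And>(n::nat \<Rightarrow> int) k. (\<Sum>k<r. of_int (n k) * b k) = 0 \<Longrightarrow> k < r \<Longrightarrow> n k = 0"
proof (rule lattice_matrices_basis)
  fix r and G :: "nat \<Rightarrow> complex^'n^'n"
  assume G: "\<And>k. k < r \<Longrightarrow> G k \<in> lattice_matrices"
    and gen: "\<And>A. A \<in> lattice_matrices \<Longrightarrow> \<exists>n :: nat \<Rightarrow> int. A = (\<Sum>k<r. of_int (n k) *\<^sub>R G k)"
    and ind: "\<And>(n :: nat \<Rightarrow> int) k. (\<Sum>k<r. of_int (n k) *\<^sub>R G k) = 0 \<Longrightarrow> k < r \<Longrightarrow> n k = 0"
  have comb: "(\<Sum>k<r. of_int (n k) *\<^sub>R G k) \<in> lattice_matrices"
    "eigenvalue (\<Sum>k<r. of_int (n k) *\<^sub>R G k) = (\<Sum>k<r. of_int (n k) * eigenvalue (G k))"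
    for n :: "nat \<Rightarrow> int"
    using lattice_eigenvalue_sum[of r G n] G by auto
  show thesis
  proof (rule that[of r "\<lambda>k. eigenvalue (G k)"])
    show "eigenvalue (G k) \<in> order_ring" if "k < r" for k
      using G[OF that] by (simp add: order_ring_def)
    show "\<exists>n::nat \<Rightarrow> int. x = (\<Sum>k<r. of_int (n k) * eigenvalue (G k))" if "x \<in> order_ring" for x
      using that gen comb(2) by (force simp: order_ring_def)
    show "n k = 0" if "(\<Sum>k<r. of_int (n k) * eigenvalue (G k)) = 0" "k < r" for n :: "nat \<Rightarrow> int" and k
    proof (rule ind[OF _ that(2)])
      show "(\<Sum>k<r. of_int (n k) *\<^sub>R G k) = 0"
        using comb[of n] comb[of "\<lambda>_. 0"] that(1)
        by (intro inj_onD[OF eigenvalue_inj]) auto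
    qed
  qed
qed

definition (in torus_field) order_units :: "complex set" where
  "order_units = {x \<in> order_ring. \<exists>y\<in>order_ring. x * y = 1}"

lemma (in torus_field) order_ring_closed:
  shows order_ring_one: "1 \<in> order_ring"
    and order_ring_diff: "x \<in> order_ring \<Longrightarrow> y \<in> order_ring \<Longrightarrow> x - y \<in> order_ring"
    and order_ring_mult: "x \<in> order_ring \<Longrightarrow> y \<in> order_ring \<Longrightarrow> x * y \<in> order_ring"
proof -
  show "1 \<in> order_ring"
    unfolding order_ring_def using lattice_matrices_one eigenvalue_one by force
  show "x - y \<in> order_ring" if "x \<in> order_ring" "y \<in> order_ring"
    using that lattice_matrices_diff by (auto simp: order_ring_def simp flip: lattice_eigenvalue(2))
  show "x * y \<in> order_ring" if "x \<in> order_ring" "y \<in> order_ring"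
    using that lattice_matrices_mult by (auto simp: order_ring_def simp flip: lattice_eigenvalue(3))
qed

text \<open>The embedding is injective, so the relation \<open>x ^ n = 1\<close> pulls back to
  \<open>K0\<close>, where its roots of unity are known.\<close>

lemma (in torus_field) order_unity:
  assumes roots: "roots_of_unity K0 \<subseteq> {\<one>\<^bsub>K0\<^esub>, \<ominus>\<^bsub>K0\<^esub> \<one>\<^bsub>K0\<^esub>}"
    and x: "x \<in> order_ring" "n > 0" "x ^ n = 1"
  shows "x = 1 \<or> x = -1"
proof -
  have "x \<in> emb ` carrier K0"
    unfolding emb_image using x(1) by (rule rat_vec.span_base)
  then obtain a where a: "a \<in> carrier K0" "x = emb a" by blast
  have "emb (a [^]\<^bsub>K0\<^esub> n) = emb \<one>\<^bsub>K0\<^esub>"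
    using x(3) by (simp add: emb_pow a emb_one)
  then have "a [^]\<^bsub>K0\<^esub> n = \<one>\<^bsub>K0\<^esub>"
    using a by (intro inj_onD[OF emb_inj]) auto
  then have "a \<in> roots_of_unity K0"
    using a x(2) by (auto simp: roots_of_unity_def torsion_def)
  then have "a = \<one>\<^bsub>K0\<^esub> \<or> a = \<ominus>\<^bsub>K0\<^esub> \<one>\<^bsub>K0\<^esub>"
    using roots by blast
  then show ?thesis using a(2) emb_one emb_uminus[OF K.one_closed] by auto
qed

lemma (in torus_field) order_unit_group:
  assumes dim: "number_field K0 (2 * s)" and im: "purely_imaginary K0"
    and roots: "roots_of_unity K0 \<subseteq> {\<one>\<^bsub>K0\<^esub>, \<ominus>\<^bsub>K0\<^esub> \<one>\<^bsub>K0\<^esub>}"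
  shows "sign_img \<times>\<times> product_group {..<s - 1} (\<lambda>_. integer_group) \<cong>
    \<lparr>carrier = order_units, monoid.mult = (*), one = 1\<rparr>"
proof (rule order_ring_basis)
  fix r :: nat and b
  assume b: "\<And>k. k < r \<Longrightarrow> b k \<in> order_ring"
    and gen: "\<And>x. x \<in> order_ring \<Longrightarrow> \<exists>n::nat \<Rightarrow> int. x = (\<Sum>k<r. of_int (n k) * b k)"
    and ind: "\<And>(n::nat \<Rightarrow> int) k. (\<Sum>k<r. of_int (n k) * b k) = 0 \<Longrightarrow> k < r \<Longrightarrow> n k = 0"
  have "rat_vec.dim (rat_vec.span order_ring) = r"
    using int_basis_rat_basis[of r b order_ring] b gen ind
    by (simp add: rat_vec.dim_eq_card_independent)
  \<comment> \<open>Integral rank and field degree are compared as dimensions of one and the same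
    rational span.\<close>
  moreover have "rat_vec.dim (rat_vec.span order_ring) = 2 * s"
  proof -
    have "K.dimension (2 * s) (generate_field K0 {}) (carrier K0)"
      using dim by (simp add: number_field_def)
    from emb_dimension[OF this] obtain S where "card S = 2 * s" "rat_vec.independent S"
      "rat_vec.span S = rat_vec.span order_ring" unfolding emb_image by blast
    then show ?thesis by (metis rat_vec.dim_eq_card_independent rat_vec.dim_span)
  qed
  ultimately have r: "r = 2 * s" by simp
  show ?thesis
    unfolding order_units_def
  proof (rule imaginary_order_unit_group[of order_ring s b])
    show "inverse x \<in> rat_vec.span order_ring" if "x \<in> rat_vec.span order_ring" for x
    proof (cases "x = 0")
      case False
      from that obtain a where a: "a \<in> carrier K0" "x = emb a"
        unfolding emb_image[symmetric] by blast
      with False have nz: "a \<noteq> \<zero>\<^bsub>K0\<^esub>" using emb_zero by auto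
      then have "inv\<^bsub>K0\<^esub> a \<in> carrier K0"
        using a K.field_Units by (intro K.Units_inv_closed) simp
      then show ?thesis
        using emb_inverse(1)[OF a(1) nz] unfolding emb_image[symmetric] a(2) by (metis imageI)
    qed (simp add: rat_vec.span_zero)
    fix \<rho> :: "complex \<Rightarrow> real"
    assume \<rho>: "\<rho> 1 = 1"
      "\<And>x y. x \<in> rat_vec.span order_ring \<Longrightarrow> y \<in> rat_vec.span order_ring \<Longrightarrow> \<rho> (x + y) = \<rho> x + \<rho> y"
      "\<And>x y. x \<in> rat_vec.span order_ring \<Longrightarrow> y \<in> rat_vec.span order_ring \<Longrightarrow> \<rho> (x * y) = \<rho> x * \<rho> y"
    have emb_span: "emb a \<in> rat_vec.span order_ring" if "a \<in> carrier K0" for a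
      unfolding emb_image[symmetric] using that by (rule imageI)
    \<comment> \<open>A real-valued homomorphism on the span would compose with the embedding to a
      real embedding of \<open>K0\<close>.\<close>
    have "\<rho> \<circ> emb \<in> ring_hom K0 (ring_of_type_algebra :: real ring)"
      by (rule ring_hom_memI)
        (auto simp: ring_of_type_algebra_def emb_add emb_mult emb_one \<rho> emb_span)
    with im show False by (simp add: purely_imaginary_def)
  qed (use b gen ind order_ring_closed order_unity[OF roots] in \<open>auto simp: r\<close>)
qed

lemma (in torus_field) torus_Aut_eigenvalue:
  assumes "f \<in> carrier Aut"
  shows "f \<in> carrier End" "torus_matrix f \<in> lattice_matrices"
    "eigenvalue (torus_matrix f) \<in> order_units"
proof -
  from assms obtain g where fg: "f \<in> carrier End" "g \<in> carrier End"
    "f \<otimes>\<^bsub>End\<^esub> g = \<one>\<^bsub>End\<^esub>" by (auto simp: carrier_torus_Aut)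
  then show "f \<in> carrier End" "torus_matrix f \<in> lattice_matrices"
    by (auto intro: torus_matrix_mem)
  have "eigenvalue (torus_matrix f) * eigenvalue (torus_matrix g) = 1"
    using fg by (simp add: torus_matrix_mem torus_matrix_one eigenvalue_one
        flip: lattice_eigenvalue(3) torus_matrix_mult)
  then show "eigenvalue (torus_matrix f) \<in> order_units"
    using fg(1,2) by (auto simp: order_units_def order_ring_def torus_matrix_mem)
qed

lemma (in torus_field) torus_Aut_mult_closed:
  assumes "f \<in> carrier Aut" "g \<in> carrier Aut"
  shows "f \<otimes>\<^bsub>Aut\<^esub> g \<in> carrier Aut"
proof -
  interpret E: monoid "End" by (rule monoid_torus_End)
  from assms obtain f' g' where *: "f \<in> carrier End" "f' \<in> carrier End"
    "g \<in> carrier End" "g' \<in> carrier End"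
    "f \<otimes>\<^bsub>End\<^esub> f' = \<one>\<^bsub>End\<^esub>" "f' \<otimes>\<^bsub>End\<^esub> f = \<one>\<^bsub>End\<^esub>"
    "g \<otimes>\<^bsub>End\<^esub> g' = \<one>\<^bsub>End\<^esub>" "g' \<otimes>\<^bsub>End\<^esub> g = \<one>\<^bsub>End\<^esub>"
    by (auto simp: carrier_torus_Aut)
  then have "f \<in> Units End" "g \<in> Units End" by (auto simp: Units_def)
  then have "f \<otimes>\<^bsub>End\<^esub> g \<in> Units End" by (rule E.Units_m_closed)
  then have "f \<otimes>\<^bsub>End\<^esub> g \<in> carrier Aut" by (auto simp: Units_def carrier_torus_Aut)
  then show ?thesis by (simp add: torus_Aut_mult assms)
qed

lemma (in torus_field) eigenvalue_torus_Aut_mult: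
  assumes "f \<in> carrier Aut" "g \<in> carrier Aut"
  shows "eigenvalue (torus_matrix (f \<otimes>\<^bsub>Aut\<^esub> g)) =
    eigenvalue (torus_matrix f) * eigenvalue (torus_matrix g)"
  using assms torus_Aut_eigenvalue(1,2)
  by (simp add: torus_Aut_mult torus_matrix_mult lattice_eigenvalue(3))

lemma (in torus_field) eigenvalue_torus_Aut_inj:
  assumes "f \<in> carrier Aut" "g \<in> carrier Aut"
    "eigenvalue (torus_matrix f) = eigenvalue (torus_matrix g)"
  shows "f = g"
  using assms torus_Aut_eigenvalue(1,2)
  by (intro torus_matrix_inj) (auto intro: inj_onD[OF eigenvalue_inj])

lemma (in torus_field) torus_Aut_one_closed: "\<one>\<^bsub>Aut\<^esub> \<in> carrier Aut"
proof -
  interpret E: monoid "End" by (rule monoid_torus_End)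
  show ?thesis by (auto simp: carrier_torus_Aut torus_Aut_one intro!: bexI[of _ "\<one>\<^bsub>End\<^esub>"])
qed

lemma (in torus_field) eigenvalue_torus_Aut_one: "eigenvalue (torus_matrix \<one>\<^bsub>Aut\<^esub>) = 1"
  by (simp add: torus_Aut_one torus_matrix_one eigenvalue_one)

text \<open>The inverse of \<open>u\<close> is also an eigenvalue of a lattice matrix; injectivity
  of the eigenvalue lifts the relation in \<complex> to both matrix products.\<close>

lemma (in torus_field) eigenvalue_torus_Aut_surj:
  assumes "u \<in> order_units"
  obtains f where "f \<in> carrier Aut" "eigenvalue (torus_matrix f) = u"
proof -
  from assms obtain A A' where A: "A \<in> lattice_matrices" "A' \<in> lattice_matrices"
    "u = eigenvalue A" "eigenvalue A * eigenvalue A' = 1"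
    by (auto simp: order_units_def order_ring_def)
  have "eigenvalue (A ** A') = eigenvalue (mat 1)" "eigenvalue (A' ** A) = eigenvalue (mat 1)"
    using A by (simp_all add: lattice_eigenvalue(3) eigenvalue_one mult.commute)
  then have "A ** A' = mat 1" "A' ** A = mat 1"
    using A by (auto intro!: inj_onD[OF eigenvalue_inj] lattice_matrices_mult lattice_matrices_one)
  then have "torus_map A \<in> carrier Aut"
    using A(1,2) unfolding carrier_torus_Aut
    by (auto simp: torus_map_End torus_map_mult torus_map_one intro!: bexI[of _ "torus_map A'"])
  moreover have "eigenvalue (torus_matrix (torus_map A)) = u" using A by (simp add: torus_matrix_map)
  ultimately show thesis by (rule that)
qed

text \<open>Each law is tested on eigenvalues, where it is a law of complex multiplication;
  commutativity is obtained in the same way.\<close>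

lemma (in torus_field) comm_group_torus_Aut: "comm_group Aut"
proof (rule comm_groupI)
  fix f g h assume fgh: "f \<in> carrier Aut" "g \<in> carrier Aut" "h \<in> carrier Aut"
  show "f \<otimes>\<^bsub>Aut\<^esub> g \<otimes>\<^bsub>Aut\<^esub> h = f \<otimes>\<^bsub>Aut\<^esub> (g \<otimes>\<^bsub>Aut\<^esub> h)"
    using fgh by (intro eigenvalue_torus_Aut_inj torus_Aut_mult_closed)
      (simp_all add: eigenvalue_torus_Aut_mult torus_Aut_mult_closed)
next
  fix f g assume fg: "f \<in> carrier Aut" "g \<in> carrier Aut"
  show "f \<otimes>\<^bsub>Aut\<^esub> g = g \<otimes>\<^bsub>Aut\<^esub> f"
    using fg by (intro eigenvalue_torus_Aut_inj torus_Aut_mult_closed)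
      (simp_all add: eigenvalue_torus_Aut_mult mult.commute)
next
  fix f assume f: "f \<in> carrier Aut"
  show "\<one>\<^bsub>Aut\<^esub> \<otimes>\<^bsub>Aut\<^esub> f = f"
    using f torus_Aut_one_closed by (intro eigenvalue_torus_Aut_inj torus_Aut_mult_closed)
      (simp_all add: eigenvalue_torus_Aut_mult eigenvalue_torus_Aut_one)
  have "eigenvalue (torus_matrix f) \<in> order_units" using f by (rule torus_Aut_eigenvalue)
  then obtain y where "y \<in> order_units" "eigenvalue (torus_matrix f) * y = 1"
    by (auto simp: order_units_def mult.commute)
  moreover from this obtain g where "g \<in> carrier Aut" "eigenvalue (torus_matrix g) = y"
    using eigenvalue_torus_Aut_surj by metis
  ultimately have "g \<in> carrier Aut" "g \<otimes>\<^bsub>Aut\<^esub> f = \<one>\<^bsub>Aut\<^esub>"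
    using f torus_Aut_one_closed
    by (auto intro!: eigenvalue_torus_Aut_inj torus_Aut_mult_closed
        simp: eigenvalue_torus_Aut_mult eigenvalue_torus_Aut_one mult.commute)
  then show "\<exists>g\<in>carrier Aut. g \<otimes>\<^bsub>Aut\<^esub> f = \<one>\<^bsub>Aut\<^esub>" by blast
qed (use torus_Aut_mult_closed torus_Aut_one_closed in auto)

lemma (in torus_field) torus_Aut_iso_order_units:
  "Aut \<cong> \<lparr>carrier = order_units, monoid.mult = (*), one = 1\<rparr>"
proof -
  have "(\<lambda>f. eigenvalue (torus_matrix f)) \<in> iso Aut \<lparr>carrier = order_units, monoid.mult = (*), one = 1\<rparr>"
    unfolding iso_def bij_betw_def inj_on_def
    by (auto intro!: homI eigenvalue_torus_Aut_inj
        simp: eigenvalue_torus_Aut_mult torus_Aut_eigenvalue(3) elim: eigenvalue_torus_Aut_surj)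
  then show ?thesis by (auto simp: is_iso_def)
qed

text \<open>Everything is read off the units of the order through the eigenvalue; an automorphism of
  finite order has a root of unity of the order as its eigenvalue. A field has positive degree, so
  the subtraction in \<open>s - 1\<close> never truncates.\<close>

theorem proposition1p9:
  fixes L :: "(complex^'n::finite) set" and s :: nat
  assumes "is_lattice L"
    and "number_field (torus_End0 L) (2 * s)"
    and "purely_imaginary (torus_End0 L)"
    and "roots_of_unity (torus_End0 L) \<subseteq>
           {\<one>\<^bsub>torus_End0 L\<^esub>, \<ominus>\<^bsub>torus_End0 L\<^esub> \<one>\<^bsub>torus_End0 L\<^esub>}"
  shows "torus_Aut L \<cong> sign_img \<times>\<times> product_group {..<s - 1} (\<lambda>_. integer_group) \<and>
         comm_group (torus_Aut L) \<and>
         subgroup (torsion (torus_Aut L)) (torus_Aut L) \<and>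
         cyclic_group (torus_Aut L \<lparr>carrier := torsion (torus_Aut L)\<rparr>) \<and>
         order (torus_Aut L \<lparr>carrier := torsion (torus_Aut L)\<rparr>) = 2"
proof -
  from assms(1) obtain B :: "(complex^'n) set" where "lattice B L"
    unfolding is_lattice_def lattice_def by blast
  then interpret lattice B L .
  have field: "field K0" using assms(2) by (simp add: number_field_def)
  obtain v where v: "v \<noteq> 0" "\<And>c. c \<in> carrier End_frag \<Longrightarrow> \<exists>e. End_eval c *v v = e *s v"
    using End0_joint_eigenvector[OF field] by metis
  interpret torus_field B L v
    by (intro torus_field.intro torus_field_axioms.intro lattice_axioms field v)
  interpret Aut: comm_group "Aut" by (rule comm_group_torus_Aut)
  let ?Z = "sign_img \<times>\<times> product_group {..<s - 1} (\<lambda>_. integer_group)"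
  have "group ?Z"
    by (intro DirProd_group sign_img_is_group product_group) auto
  then have "\<lparr>carrier = order_units, monoid.mult = (*), one = 1\<rparr> \<cong> ?Z"
    using order_unit_group[OF assms(2-4)] by (rule group.iso_sym)
  with torus_Aut_iso_order_units have iso: "Aut \<cong> ?Z" by (rule iso_trans)
  let ?ev = "\<lambda>f. eigenvalue (torus_matrix f)"
  \<comment> \<open>The non-trivial torsion element is the automorphism with eigenvalue -1.\<close>
  have "-1 \<in> order_units"
    using order_ring_diff[OF order_ring_diff[OF order_ring_one order_ring_one] order_ring_one]
    by (auto simp: order_units_def intro!: bexI[of _ "-1"])
  then obtain m where m: "m \<in> carrier Aut" "?ev m = -1"
    by (rule eigenvalue_torus_Aut_surj)
  have m1: "m \<noteq> \<one>\<^bsub>Aut\<^esub>" using m eigenvalue_torus_Aut_one by auto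
  have mm: "m \<otimes>\<^bsub>Aut\<^esub> m = \<one>\<^bsub>Aut\<^esub>"
    using m by (intro eigenvalue_torus_Aut_inj)
      (simp_all add: eigenvalue_torus_Aut_mult eigenvalue_torus_Aut_one)
  have pow: "?ev (f [^]\<^bsub>Aut\<^esub> n) = ?ev f ^ n" if "f \<in> carrier Aut" for f and n :: nat
    using that by (induction n) (simp_all add: eigenvalue_torus_Aut_one eigenvalue_torus_Aut_mult)
  have "torsion Aut = {\<one>\<^bsub>Aut\<^esub>, m}"
  proof (intro equalityI subsetI)
    fix f assume "f \<in> torsion Aut"
    then obtain n :: nat where f: "f \<in> carrier Aut" "n > 0" "f [^]\<^bsub>Aut\<^esub> n = \<one>\<^bsub>Aut\<^esub>"
      by (auto simp: torsion_def)
    have "?ev f \<in> order_ring" using torus_Aut_eigenvalue(3)[OF f(1)] by (simp add: order_units_def)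
    moreover have "?ev f ^ n = 1" using pow[OF f(1), of n] f(3) by (simp add: eigenvalue_torus_Aut_one)
    ultimately have "?ev f = 1 \<or> ?ev f = -1" using order_unity[OF assms(4) _ f(2)] by blast
    then have "f = \<one>\<^bsub>Aut\<^esub> \<or> f = m"
      using eigenvalue_torus_Aut_inj[OF f(1)] m eigenvalue_torus_Aut_one by auto
    then show "f \<in> {\<one>\<^bsub>Aut\<^esub>, m}" by simp
  next
    fix f assume "f \<in> {\<one>\<^bsub>Aut\<^esub>, m}"
    then have "f \<in> carrier Aut" "f [^]\<^bsub>Aut\<^esub> (2::nat) = \<one>\<^bsub>Aut\<^esub>"
      using m mm by (auto simp: numeral_2_eq_2)
    then show "f \<in> torsion Aut" by (auto simp: torsion_def intro!: exI[of _ 2])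
  qed
  from Aut.two_element_torsion[OF m(1) m1 mm this] iso show ?thesis
    using comm_group_torus_Aut by blast
qed

end
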